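(* Let $n \geq 2$, let $\Omega \subset \mathbb{R}^n$ be open, let $s \in (0,1)$ and $p \in (1,\infty)$ with $sp > n-1$. Let $f_j \in W^{s,p}(\Omega;\mathbb{R}^n)$, $j\in\mathbb{N}$, be a sequence of homeomorphisms (onto their images) that converges weakly in $W^{s,p}(\Omega;\mathbb{R}^n)$ to $f : \Omega \to \mathbb{R}^n$. Then there exist a representative $\widehat{f}:\Omega\to\mathbb{R}^n$ of $f$ (a map defined at every point of $\Omega$ with $\widehat f = f$ Lebesgue-almost everywhere) and a set $\Gamma \subset \mathbb{R}^n$ of Hausdorff dimension at most $\frac{n-1}{s}$ such that $\widehat{f}^{-1}(\{y\})$ consists of only one point for every $y \in \widehat{f}(\Omega) \setminus \Gamma$.
   Context: For $s\in(0,1)$ and $p\in(1,\infty)$, $W^{s,p}(\Omega;\mathbb{R}^n)$ is the space of measurable $u:\Omega\to\mathbb{R}^n$ with finite norm $\|u\|_{W^{s,p}(\Omega)}^p := \|u\|_{L^p(\Omega)}^p + [u]_{W^{s,p}(\Omega)}^p$, where $[u]_{W^{s,p}(\Omega)}^p := \int_\Omega\int_\Omega \frac{|u(x)-u(y)|^p}{|x-y|^{n+sp}}\,dy\,dx$. *)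

theory Defs
  imports "HOL-Analysis.Analysis"
begin

section \<open>Fractional Sobolev spaces\<close>

text \<open>A map on \<open>\<Omega>\<close> is represented by a total function of which only the restriction to \<open>\<Omega>\<close>
  matters. The integrals take values in \<open>[0,\<infinity>]\<close>, and functions equal almost everywhere
  on \<open>\<Omega>\<close> are not identified.\<close>

definition Lp_pow :: "real \<Rightarrow> 'a::euclidean_space set \<Rightarrow> ('a \<Rightarrow> 'b::euclidean_space) \<Rightarrow> ennreal" where
  "Lp_pow p \<Omega> u = (\<integral>\<^sup>+ x. ennreal (norm (u x) powr p) \<partial>lebesgue_on \<Omega>)"

definition gagliardo_pow ::
  "real \<Rightarrow> real \<Rightarrow> 'a::euclidean_space set \<Rightarrow> ('a \<Rightarrow> 'b::euclidean_space) \<Rightarrow> ennreal" where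
  "gagliardo_pow s p \<Omega> u =
     (\<integral>\<^sup>+ x. (\<integral>\<^sup>+ y. ennreal (norm (u x - u y) powr p / norm (x - y) powr (real DIM('a) + s * p))
        \<partial>lebesgue_on \<Omega>) \<partial>lebesgue_on \<Omega>)"

definition Wsp_pow ::
  "real \<Rightarrow> real \<Rightarrow> 'a::euclidean_space set \<Rightarrow> ('a \<Rightarrow> 'b::euclidean_space) \<Rightarrow> ennreal" where
  "Wsp_pow s p \<Omega> u = Lp_pow p \<Omega> u + gagliardo_pow s p \<Omega> u"

definition Wsp ::
  "real \<Rightarrow> real \<Rightarrow> 'a::euclidean_space set \<Rightarrow> ('a \<Rightarrow> 'b::euclidean_space) set" where
  "Wsp s p \<Omega> = {u. u \<in> borel_measurable (lebesgue_on \<Omega>) \<and> Wsp_pow s p \<Omega> u < \<infinity>}"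

definition Wsp_norm ::
  "real \<Rightarrow> real \<Rightarrow> 'a::euclidean_space set \<Rightarrow> ('a \<Rightarrow> 'b::euclidean_space) \<Rightarrow> real" where
  "Wsp_norm s p \<Omega> u = enn2real (Wsp_pow s p \<Omega> u) powr (1 / p)"

text \<open>Bounded linear functionals on \<open>W\<^sup>s\<^sup>,\<^sup>p\<close>. By boundedness and linearity such a functional takes
  the same value on functions that agree almost everywhere on \<open>\<Omega>\<close>, so these are exactly the
  elements of the dual of the quotient space.\<close>

definition Wsp_dual ::
  "real \<Rightarrow> real \<Rightarrow> 'a::euclidean_space set \<Rightarrow> (('a \<Rightarrow> 'b::euclidean_space) \<Rightarrow> real) set" where
  "Wsp_dual s p \<Omega> = {L.
     (\<forall>u\<in>Wsp s p \<Omega>. \<forall>v\<in>Wsp s p \<Omega>. L (\<lambda>x. u x + v x) = L u + L v) \<and>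
     (\<forall>c. \<forall>u\<in>Wsp s p \<Omega>. L (\<lambda>x. c *\<^sub>R u x) = c * L u) \<and>
     (\<exists>C. \<forall>u\<in>Wsp s p \<Omega>. \<bar>L u\<bar> \<le> C * Wsp_norm s p \<Omega> u)}"

definition Wsp_weakly_converges ::
  "real \<Rightarrow> real \<Rightarrow> 'a::euclidean_space set \<Rightarrow> (nat \<Rightarrow> 'a \<Rightarrow> 'b::euclidean_space)
     \<Rightarrow> ('a \<Rightarrow> 'b) \<Rightarrow> bool" where
  "Wsp_weakly_converges s p \<Omega> f g \<longleftrightarrow>
     (\<forall>j. f j \<in> Wsp s p \<Omega>) \<and> g \<in> Wsp s p \<Omega> \<and>
     (\<forall>L\<in>Wsp_dual s p \<Omega>. (\<lambda>j. L (f j)) \<longlonglongrightarrow> L g)"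

section \<open>Hausdorff measure and dimension\<close>

text \<open>The contribution \<open>(diam U)\<^sup>d\<close> of a covering set, with \<open>(diam U)\<^sup>0 = 1\<close> for nonempty \<open>U\<close>;
  the case distinction is needed since \<open>0 powr 0 = 0\<close>.\<close>

definition diam_pow :: "real \<Rightarrow> 'a::metric_space set \<Rightarrow> real" where
  "diam_pow d U = (if U = {} then 0 else if d = 0 then 1 else diameter U powr d)"

text \<open>Boundedness of the covering sets is required separately because \<open>diameter\<close> is an
  unspecified real number on unbounded sets. The normalising factor of the Hausdorff measure is
  omitted; it does not affect the dimension.\<close>

definition hausdorff_premeasure :: "real \<Rightarrow> real \<Rightarrow> 'a::metric_space set \<Rightarrow> ennreal" where
  "hausdorff_premeasure d \<delta> A =
     Inf {(\<Sum>i. ennreal (diam_pow d (U i))) | U :: nat \<Rightarrow> 'a set.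
            A \<subseteq> (\<Union>i. U i) \<and> (\<forall>i. bounded (U i) \<and> diameter (U i) \<le> \<delta>)}"

definition hausdorff_measure :: "real \<Rightarrow> 'a::metric_space set \<Rightarrow> ennreal" where
  "hausdorff_measure d A = (SUP \<delta>\<in>{0<..}. hausdorff_premeasure d \<delta> A)"

definition hausdorff_dim :: "'a::metric_space set \<Rightarrow> ennreal" where
  "hausdorff_dim A = Inf {ennreal d | d. d \<ge> 0 \<and> hausdorff_measure d A = 0}"

end

theory Submission
  imports Defs
begin

text \<open>Two points with a common value are separated by a box, and a homeomorphism \<open>F\<close> controls what
  happens across its boundary. If a connected set \<open>C\<close> misses the \<open>F\<close>-image of the boundary, then by
  invariance of domain it lies in the image of the open box or misses the image of the closed one.
  Suppose \<open>f\<^sub>j x\<close> and \<open>f\<^sub>j x'\<close> both tend to \<open>y\<close>, where \<open>x\<close> is inside and \<open>x'\<close> outside the box, and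
  \<open>f\<^sub>j\<close> tends to the limit uniformly on the boundary. A small ball around \<open>y\<close> then contains values from
  both sides, so \<open>y\<close> belongs to the image of the boundary under the limit
  (\<open>values_separated\<close>). It is therefore enough to find countably many hyperplane slices, dense in
  every coordinate direction, on which a common subsequence converges uniformly and whose images
  under the limit are null sets for the \<open>q\<close>-dimensional Hausdorff measure, for every
  \<open>q > (n - 1) / s\<close>. The set \<open>\<Gamma>\<close> is the union of these images.

  Such slices come from averages \<open>u\<^sub>m\<close> over dyadic cells of side \<open>2\<^sup>-\<^sup>m\<close>. The Gagliardo seminorm yields
  the \<open>L\<^sup>p\<close> bound \<open>\<parallel>u - u\<^sub>m\<parallel> \<le> C 2\<^sup>-\<^sup>m\<^sup>s\<close> (\<open>Wsp_approx_cell_avg\<close>). The increment \<open>u\<^sub>m\<^sub>+\<^sub>1 - u\<^sub>m\<close> is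
  constant on cells of level \<open>m + 1\<close>, and a hyperplane meets only those in one layer of thickness
  \<open>2\<^sup>-\<^sup>m\<^sup>-\<^sup>1\<close>. By Tonelli, on almost every slice all increments at level \<open>m\<close> are at most
  \<open>C 2\<^sup>-\<^sup>m\<^sup>\<tau>\<^sup>/\<^sup>p\<close>, for any \<open>\<tau> < s p - (n - 1)\<close> (\<open>slice_energy_integral\<close>, \<open>slice_limit\<close>). The
  right-hand side of this restriction on \<open>\<tau>\<close> is positive, so the averages converge geometrically on
  the slice. More precisely, the oscillation of the limit on a cell \<open>R\<close> of level \<open>k\<close> is at most
  \<open>C 2\<^sup>-\<^sup>k\<^sup>\<tau>\<^sup>/\<^sup>p \<nu>(R)\<^sup>1\<^sup>/\<^sup>p\<close> with a finite measure \<open>\<nu>\<close>, and this forces the image of the slice to be null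
  (\<open>hausdorff_measure_slice_image\<close>).

  Uniform convergence on slices is the same estimate for \<open>f\<^sub>j - g\<close>. Weak convergence makes each
  average converge, and the uniform boundedness principle, applied to explicit functionals built from
  the increments (\<open>weak_conv_cell_inc_bounded\<close>), bounds the energies uniformly in \<open>j\<close>. By dominated
  convergence the energies of \<open>f\<^sub>j - g\<close>, with an exponent \<open>\<tau>\<close> below the critical one, tend to zero. Along
  a fast subsequence they do so on almost every slice of every cell (\<open>common_subsequence\<close>).

  The representative is \<open>g\<close> itself outside a null set and the constant \<open>0\<close> on that null set, where
  \<open>0\<close> is included in \<open>\<Gamma>\<close>.\<close>

section \<open>Dyadic cells\<close>

definition cell_index :: "nat \<Rightarrow> real ^ 'n \<Rightarrow> int ^ 'n" where
  "cell_index k x = (\<chi> i. \<lfloor>2 ^ k * x $ i\<rfloor>)"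

text \<open>Cells are the level sets of \<open>cell_index\<close>. A cell is thus named by any of its points, and a sum over
  all cells of one level becomes an integral over the point.\<close>

definition dcell :: "nat \<Rightarrow> real ^ 'n \<Rightarrow> (real ^ 'n) set" where
  "dcell k x = {y. cell_index k y = cell_index k x}"

text \<open>The slab formed by all cells of level \<open>k\<close> that meet the hyperplane through \<open>x\<close> orthogonal to
  the axis \<open>i\<close>.\<close>

definition layer :: "'n \<Rightarrow> nat \<Rightarrow> real ^ 'n \<Rightarrow> (real ^ 'n) set" where
  "layer i k x = {y. \<lfloor>2 ^ k * y $ i\<rfloor> = \<lfloor>2 ^ k * x $ i\<rfloor>}"

lemma cell_index_eq_iff: "cell_index k y = cell_index k x \<longleftrightarrow> (\<forall>i. \<lfloor>2 ^ k * y $ i\<rfloor> = \<lfloor>2 ^ k * x $ i\<rfloor>)"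
  by (simp add: cell_index_def vec_eq_iff)

lemma mem_dcell_self [simp]: "x \<in> dcell k x"
  by (simp add: dcell_def)

lemma dcell_eq: "y \<in> dcell k x \<Longrightarrow> dcell k y = dcell k x"
  by (auto simp: dcell_def)

lemma mem_layer_sym: "y \<in> layer i k x \<longleftrightarrow> x \<in> layer i k y"
  by (auto simp: layer_def)

lemma dcell_subset_layer: "dcell k x \<subseteq> layer i k x"
  by (auto simp: dcell_def layer_def cell_index_eq_iff)

lemma floor_dyadic_coarsen:
  fixes a b :: real
  assumes "\<lfloor>2 ^ m * a\<rfloor> = \<lfloor>2 ^ m * b\<rfloor>" "k \<le> m"
  shows "\<lfloor>2 ^ k * a\<rfloor> = \<lfloor>2 ^ k * b\<rfloor>"
proof -
  have *: "\<lfloor>2 ^ k * t\<rfloor> = \<lfloor>2 ^ m * t\<rfloor> div (2 ^ (m - k))" for t :: real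
  proof -
    have "(2::real) ^ m = 2 ^ k * 2 ^ (m - k)"
      using assms(2) by (simp flip: power_add)
    then have "2 ^ k * t = 2 ^ m * t / real_of_int (2 ^ (m - k))"
      by (simp add: field_simps)
    then show ?thesis
      using floor_divide_real_eq_div[of "2 ^ (m - k)" "2 ^ m * t"] by simp
  qed
  show ?thesis
    using assms(1) by (simp only: *)
qed

lemma dcell_mono: "k \<le> m \<Longrightarrow> dcell m x \<subseteq> dcell k x"
  by (auto simp: dcell_def cell_index_eq_iff intro: floor_dyadic_coarsen)

lemma dcell_subset: "k \<le> m \<Longrightarrow> y \<in> dcell k x \<Longrightarrow> dcell m y \<subseteq> dcell k x"
  using dcell_mono dcell_eq by blast

lemma measurable_cell_index [measurable]: "cell_index k \<in> borel \<rightarrow>\<^sub>M count_space UNIV"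
proof (subst measurable_count_space_eq2_countable; safe?)
  fix z :: "int ^ 'a"
  have "{x. \<forall>i. \<lfloor>2 ^ k * x $ i\<rfloor> = z $ i} \<in> sets (borel :: (real ^ 'a) measure)"
    by measurable
  moreover have "cell_index k -` {z} \<inter> space borel = {x. \<forall>i. \<lfloor>2 ^ k * x $ i\<rfloor> = z $ i}"
    by (auto simp: cell_index_def vec_eq_iff)
  ultimately show "cell_index k -` {z} \<inter> space borel \<in> sets borel" by simp
qed auto

lemma sets_dcell [measurable]: "dcell k x \<in> sets borel"
proof -
  have "dcell k x = cell_index k -` {cell_index k x} \<inter> space borel" by (auto simp: dcell_def)
  then show ?thesis using measurable_sets[OF measurable_cell_index, of "{cell_index k x}" k] by simp
qed

lemma sets_layer [measurable]: "layer i k x \<in> sets borel"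
  unfolding layer_def by measurable

lemma sets_lebesgue_dcell [measurable]: "dcell k x \<in> sets lebesgue"
  using sets_dcell[of k x] by (auto intro: sets_completionI_sets)

lemma dcell_bounds:
  "y \<in> dcell k x \<longleftrightarrow> (\<forall>i. \<lfloor>2 ^ k * x $ i\<rfloor> / 2 ^ k \<le> y $ i \<and> y $ i < (\<lfloor>2 ^ k * x $ i\<rfloor> + 1) / 2 ^ k)"
  by (simp add: dcell_def cell_index_eq_iff floor_eq_iff field_simps)

lemma emeasure_dcell: "emeasure lborel (dcell k (x :: real ^ 'n)) = ennreal (1 / 2 ^ (k * CARD('n)))"
proof -
  define a b :: "real ^ 'n" where "a = (\<chi> i. \<lfloor>2 ^ k * x $ i\<rfloor> / 2 ^ k)"
    and "b = (\<chi> i. (\<lfloor>2 ^ k * x $ i\<rfloor> + 1) / 2 ^ k)"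
  have ab: "a $ i \<le> b $ i" "b $ i - a $ i = 1 / 2 ^ k" for i
    by (simp_all add: a_def b_def divide_right_mono add_divide_distrib)
  have ne: "cbox a b \<noteq> {}"
    using ab(1) by (auto simp: interval_ne_empty_cart)
  have "measure lborel (cbox a b) = 1 / 2 ^ (k * CARD('n))"
    using ne by (simp add: content_cbox_cart ab power_mult power_one_over)
  then have c: "emeasure lborel (cbox a b) = ennreal (1 / 2 ^ (k * CARD('n)))"
    by (metis emeasure_lborel_cbox_finite emeasure_eq_ennreal_measure less_irrefl infinity_ennreal_def)
  have "\<forall>i\<in>Basis. a \<bullet> i \<le> b \<bullet> i"
    using ab(1) by (auto simp: Basis_vec_def inner_axis)
  then have c': "emeasure lborel (box a b) = emeasure lborel (cbox a b)"
    by (simp add: emeasure_lborel_box_eq emeasure_lborel_cbox_eq)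
  have "box a b \<subseteq> dcell k x" "dcell k x \<subseteq> cbox a b"
    by (auto simp: mem_box_cart dcell_bounds a_def b_def less_imp_le)
  then have "emeasure lborel (box a b) \<le> emeasure lborel (dcell k x)"
    "emeasure lborel (dcell k x) \<le> emeasure lborel (cbox a b)"
    by (auto intro!: emeasure_mono)
  with c c' show ?thesis by simp
qed

lemma emeasure_lebesgue_dcell:
  "emeasure lebesgue (dcell k (x :: real ^ 'n)) = ennreal (1 / 2 ^ (k * CARD('n)))"
  by (simp add: emeasure_dcell)

text \<open>The cell has side at most \<open>1\<close> in the directions other than \<open>i\<close>, so that only the thickness of
  the layer counts.\<close>

lemma emeasure_slab_le:
  "emeasure lborel (dcell k (x :: real ^ 'n) \<inter> layer i m z) \<le> ennreal (1 / 2 ^ m)"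
proof -
  define a b :: "real ^ 'n" where
    "a = (\<chi> j. if j = i then \<lfloor>2 ^ m * z $ i\<rfloor> / 2 ^ m else \<lfloor>2 ^ k * x $ j\<rfloor> / 2 ^ k)"
    and "b = (\<chi> j. if j = i then (\<lfloor>2 ^ m * z $ i\<rfloor> + 1) / 2 ^ m else (\<lfloor>2 ^ k * x $ j\<rfloor> + 1) / 2 ^ k)"
  have ab: "b $ j - a $ j = (if j = i then 1 / 2 ^ m else 1 / 2 ^ k)" "a $ j \<le> b $ j" for j
    by (simp_all add: a_def b_def divide_right_mono add_divide_distrib)
  have ne: "cbox a b \<noteq> {}"
    using ab(2) by (auto simp: interval_ne_empty_cart)
  have "measure lborel (cbox a b) = (\<Prod>j\<in>UNIV. if j = i then 1 / 2 ^ m else 1 / 2 ^ k)"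
    using ne by (simp add: content_cbox_cart ab(1))
  also have "\<dots> = 1 / 2 ^ m * (\<Prod>j\<in>UNIV - {i}. 1 / 2 ^ k)"
    by (subst prod.remove[of _ i]) auto
  also have "\<dots> \<le> 1 / 2 ^ m"
    by (intro mult_left_le prod_le_1) auto
  finally have "measure lborel (cbox a b) \<le> 1 / 2 ^ m" .
  then have c: "emeasure lborel (cbox a b) \<le> ennreal (1 / 2 ^ m)"
    by (metis emeasure_lborel_cbox_finite emeasure_eq_ennreal_measure less_irrefl infinity_ennreal_def
        ennreal_leI)
  have "dcell k x \<inter> layer i m z \<subseteq> cbox a b"
    by (auto simp: mem_box_cart dcell_bounds layer_def floor_eq_iff a_def b_def field_simps less_imp_le)
  then show ?thesis
    using c by (meson emeasure_mono order_trans sets_lborel lborelD borel_closed closed_cbox)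
qed

lemma norm_diff_dcell_le:
  assumes "y \<in> dcell k (x :: real ^ 'n)" "z \<in> dcell k x"
  shows "norm (y - z) \<le> real CARD('n) / 2 ^ k"
proof -
  have "\<bar>(y - z) $ i\<bar> \<le> 1 / 2 ^ k" for i
  proof -
    have "\<lfloor>2 ^ k * x $ i\<rfloor> / 2 ^ k \<le> y $ i" "y $ i \<le> (\<lfloor>2 ^ k * x $ i\<rfloor> + 1) / 2 ^ k"
      "\<lfloor>2 ^ k * x $ i\<rfloor> / 2 ^ k \<le> z $ i" "z $ i \<le> (\<lfloor>2 ^ k * x $ i\<rfloor> + 1) / 2 ^ k"
      using assms by (auto simp: dcell_bounds less_imp_le)
    then show ?thesis by (simp add: add_divide_distrib abs_le_iff)
  qed
  then have "(\<Sum>i\<in>UNIV. \<bar>(y - z) $ i\<bar>) \<le> (\<Sum>i\<in>(UNIV :: 'n set). 1 / 2 ^ k)"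
    by (intro sum_mono)
  then show ?thesis
    using norm_le_l1_cart[of "y - z"] by simp
qed

section \<open>Averages over dyadic cells\<close>

text \<open>The choice \<open>t = a / 2\<close> absorbs half of \<open>a\<close>. Together with \<open>le_young\<close> this replaces the
  inequalities of Hoelder and Jensen, up to a factor \<open>2\<close>, and treats \<open>b = 0\<close> without a separate
  normalisation.\<close>

lemma powr_le_of_young:
  fixes a b p :: real
  assumes "0 \<le> a" "1 < p" "\<And>t. 0 < t \<Longrightarrow> a \<le> t + t powr (1 - p) * b"
  shows "a powr p \<le> 2 powr p * b"
proof (cases "a = 0")
  case True
  have "0 \<le> b"
  proof (rule ccontr)
    assume "\<not> 0 \<le> b"
    define t where "t = (- b / 2) powr (1 / p)"
    have b: "b < 0" and t: "t > 0" "t powr p = - b / 2"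
      using \<open>\<not> 0 \<le> b\<close> assms(2) by (auto simp: t_def powr_powr)
    have "t = t powr (1 - p) * t powr p"
      using t(1) by (simp flip: powr_add)
    then have "t + t powr (1 - p) * b = t powr (1 - p) * (t powr p + b)"
      by (simp add: algebra_simps)
    also have "\<dots> < 0"
      using b t by (intro mult_pos_neg) auto
    finally show False using assms(3)[OF t(1)] True by simp
  qed
  then show ?thesis using True by simp
next
  case False
  then have a: "a > 0" using assms by simp
  have "a / 2 \<le> (a / 2) powr (1 - p) * b"
    using assms(3)[of "a / 2"] a by simp
  then have "(a / 2) powr (p - 1) * (a / 2) \<le> (a / 2) powr (p - 1) * ((a / 2) powr (1 - p) * b)"
    by (intro mult_left_mono) auto
  also have "\<dots> = b"
    using a by (simp flip: powr_add mult.assoc)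
  also have "(a / 2) powr (p - 1) * (a / 2) = (a / 2) powr p"
    using a by (simp add: powr_diff)
  finally show ?thesis
    using a by (simp add: powr_divide field_simps)
qed

lemma le_young:
  fixes a t p :: real
  assumes "0 \<le> a" "0 < t" "1 < p"
  shows "a \<le> t + t powr (1 - p) * a powr p"
proof (cases "a \<le> t")
  case True
  then show ?thesis using assms by (simp add: add_increasing2)
next
  case False
  have "a = a powr (1 - p) * a powr p"
    using False assms by (simp flip: powr_add)
  also have "\<dots> \<le> t powr (1 - p) * a powr p"
    using False assms by (intro mult_right_mono powr_mono2') auto
  finally show ?thesis using assms by simp
qed

lemma nn_set_integral_young:
  fixes v :: "'a \<Rightarrow> 'b :: {banach, second_countable_topology}"
  assumes [measurable]: "Q \<in> sets M" and Q: "emeasure M Q = ennreal \<mu>" "0 \<le> \<mu>"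
    and v [measurable]: "(\<lambda>x. indicator Q x *\<^sub>R v x) \<in> borel_measurable M"
    and p: "1 < p" and t: "0 < t"
  shows "(\<integral>\<^sup>+x\<in>Q. ennreal (norm (v x)) \<partial>M)
    \<le> ennreal (t * \<mu>) + ennreal (t powr (1 - p)) * (\<integral>\<^sup>+x\<in>Q. ennreal (norm (v x) powr p) \<partial>M)"
proof -
  have eq: "ennreal (norm (v x) powr p) * indicator Q x
      = ennreal (norm (indicator Q x *\<^sub>R v x) powr p)" for x
    using p by (simp split: split_indicator)
  have "(\<integral>\<^sup>+x\<in>Q. ennreal (norm (v x)) \<partial>M)
    \<le> (\<integral>\<^sup>+x. ennreal t * indicator Q x
        + ennreal (t powr (1 - p)) * (ennreal (norm (v x) powr p) * indicator Q x) \<partial>M)"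
    using le_young[OF _ t p, of "norm (v _)"] t p
    by (intro nn_integral_mono)
       (auto split: split_indicator simp flip: ennreal_plus ennreal_mult intro!: ennreal_leI)
  also have "\<dots> = (\<integral>\<^sup>+x. ennreal t * indicator Q x \<partial>M)
     + (\<integral>\<^sup>+x. ennreal (t powr (1 - p)) * (ennreal (norm (v x) powr p) * indicator Q x) \<partial>M)"
    unfolding eq by (intro nn_integral_add) measurable
  also have "(\<integral>\<^sup>+x. ennreal (t powr (1 - p)) * (ennreal (norm (v x) powr p) * indicator Q x) \<partial>M)
     = ennreal (t powr (1 - p)) * (\<integral>\<^sup>+x\<in>Q. ennreal (norm (v x) powr p) \<partial>M)"
    unfolding eq by (intro nn_integral_cmult) measurable
  also have "(\<integral>\<^sup>+x. ennreal t * indicator Q x \<partial>M) = ennreal (t * \<mu>)"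
    using t Q by (subst nn_integral_cmult) (auto simp: ennreal_mult)
  finally show ?thesis .
qed

lemma set_integrable_of_powr:
  fixes v :: "'a \<Rightarrow> 'b :: {banach, second_countable_topology}"
  assumes [measurable]: "Q \<in> sets M" and Q: "emeasure M Q = ennreal \<mu>" "0 \<le> \<mu>"
    and v [measurable]: "(\<lambda>x. indicator Q x *\<^sub>R v x) \<in> borel_measurable M"
    and p: "1 < p" and fin: "(\<integral>\<^sup>+x\<in>Q. ennreal (norm (v x) powr p) \<partial>M) < \<infinity>"
  shows "set_integrable M Q v"
  unfolding set_integrable_def
proof (rule integrableI_bounded)
  have "(\<integral>\<^sup>+x. ennreal (norm (indicator Q x *\<^sub>R v x)) \<partial>M) = (\<integral>\<^sup>+x\<in>Q. ennreal (norm (v x)) \<partial>M)"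
    by (intro nn_integral_cong) (auto split: split_indicator)
  also have "\<dots> \<le> ennreal (1 * \<mu>) + ennreal (1 powr (1 - p)) * (\<integral>\<^sup>+x\<in>Q. ennreal (norm (v x) powr p) \<partial>M)"
    using assms by (intro nn_set_integral_young) auto
  also have "\<dots> < \<infinity>" using fin by (simp add: ennreal_mult_less_top)
  finally show "(\<integral>\<^sup>+x. ennreal (norm (indicator Q x *\<^sub>R v x)) \<partial>M) < \<infinity>" .
qed (fact v)

text \<open>Jensen's inequality for the \<open>p\<close>-th power, up to the factor \<open>2\<^sup>p\<close>: integrate \<open>le_young\<close> and
  optimise over \<open>t\<close>.\<close>

lemma norm_set_integral_powr_le:
  fixes v :: "'a \<Rightarrow> 'b :: {banach, second_countable_topology}"
  assumes [measurable]: "Q \<in> sets M" and Q: "emeasure M Q = ennreal \<mu>" "0 < \<mu>"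
    and v [measurable]: "(\<lambda>x. indicator Q x *\<^sub>R v x) \<in> borel_measurable M"
    and p: "1 < p"
  shows "ennreal ((norm (LINT x:Q|M. v x) / \<mu>) powr p)
    \<le> ennreal (2 powr p / \<mu>) * (\<integral>\<^sup>+x\<in>Q. ennreal (norm (v x) powr p) \<partial>M)"
    (is "_ \<le> _ * ?B")
proof (cases "?B = \<infinity>")
  case True
  then show ?thesis using Q by (simp add: ennreal_mult_top)
next
  case False
  then obtain b where b: "?B = ennreal b" "0 \<le> b"
    by (cases ?B) auto
  have "norm (LINT x:Q|M. v x) / \<mu> \<le> t + t powr (1 - p) * (b / \<mu>)" if t: "0 < t" for t
  proof -
    have "ennreal (norm (LINT x:Q|M. v x)) \<le> (\<integral>\<^sup>+x. ennreal (norm (indicator Q x *\<^sub>R v x)) \<partial>M)"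
      unfolding set_lebesgue_integral_def
      using set_integrable_of_powr[of Q M \<mu> v p] Q p b
      by (intro integral_norm_bound_ennreal) (auto simp: set_integrable_def)
    also have "\<dots> = (\<integral>\<^sup>+x\<in>Q. ennreal (norm (v x)) \<partial>M)"
      by (intro nn_integral_cong) (auto split: split_indicator)
    also have "\<dots> \<le> ennreal (t * \<mu>) + ennreal (t powr (1 - p)) * ennreal b"
      unfolding b(1)[symmetric] using t p Q by (intro nn_set_integral_young) auto
    also have "\<dots> = ennreal (t * \<mu> + t powr (1 - p) * b)"
      using t Q b by (simp add: ennreal_mult)
    finally have "norm (LINT x:Q|M. v x) \<le> t * \<mu> + t powr (1 - p) * b"
      using t Q b by (subst (asm) ennreal_le_iff) auto
    then show ?thesis using Q by (simp add: field_simps)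
  qed
  then have "(norm (LINT x:Q|M. v x) / \<mu>) powr p \<le> 2 powr p * (b / \<mu>)"
    using Q p by (intro powr_le_of_young) auto
  then show ?thesis
    unfolding b(1) using Q b by (simp flip: ennreal_mult add: ennreal_leI)
qed

definition cell_avg :: "nat \<Rightarrow> (real ^ 'n \<Rightarrow> 'b :: euclidean_space) \<Rightarrow> real ^ 'n \<Rightarrow> 'b" where
  "cell_avg k u x = 2 ^ (k * CARD('n)) *\<^sub>R (LINT y:dcell k x|lebesgue. u y)"

lemma cell_avg_cong_cell: "y \<in> dcell k x \<Longrightarrow> cell_avg k u y = cell_avg k u x"
  by (simp add: cell_avg_def dcell_eq)

text \<open>The average factors through the index of the cell, which takes countably many values.\<close>

lemma borel_measurable_cell_avg [measurable]: "cell_avg k u \<in> borel_measurable borel"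
proof -
  define F where "F z = 2 ^ (k * CARD('a)) *\<^sub>R (LINT y:{y. cell_index k y = z}|lebesgue. u y)" for z
  have "F \<in> count_space UNIV \<rightarrow>\<^sub>M borel" by simp
  then have "(\<lambda>x. F (cell_index k x)) \<in> borel_measurable borel" by measurable
  moreover have "(\<lambda>x. F (cell_index k x)) = cell_avg k u" by (auto simp: F_def cell_avg_def dcell_def)
  ultimately show ?thesis by simp
qed

lemma borel_measurable_lebesgueI: "f \<in> borel_measurable borel \<Longrightarrow> f \<in> borel_measurable lebesgue"
  by (metis measurable_completion measurable_lborel2)

lemma cell_avg_powr_le:
  fixes u :: "real ^ 'n \<Rightarrow> 'b :: euclidean_space"
  assumes "(\<lambda>z. indicator (dcell k x) z *\<^sub>R u z) \<in> borel_measurable lebesgue" "1 < p"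
  shows "ennreal (norm (cell_avg k u x) powr p)
    \<le> ennreal (2 powr p * 2 ^ (k * CARD('n))) * (\<integral>\<^sup>+z\<in>dcell k x. ennreal (norm (u z) powr p) \<partial>lebesgue)"
proof -
  have "ennreal ((norm (LINT z:dcell k x|lebesgue. u z) / (1 / 2 ^ (k * CARD('n)))) powr p)
    \<le> ennreal (2 powr p / (1 / 2 ^ (k * CARD('n)))) * (\<integral>\<^sup>+z\<in>dcell k x. ennreal (norm (u z) powr p) \<partial>lebesgue)"
    using assms by (intro norm_set_integral_powr_le) (auto simp: emeasure_lebesgue_dcell)
  then show ?thesis by (simp add: cell_avg_def mult.commute)
qed

lemma cell_avg_add:
  assumes "set_integrable lebesgue (dcell k x) u" "set_integrable lebesgue (dcell k x) v"
  shows "cell_avg k (\<lambda>z. u z + v z) x = cell_avg k u x + cell_avg k v x"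
  using assms by (simp add: cell_avg_def set_integral_add scaleR_right_distrib)

lemma cell_avg_diff:
  assumes "set_integrable lebesgue (dcell k x) u" "set_integrable lebesgue (dcell k x) v"
  shows "cell_avg k (\<lambda>z. u z - v z) x = cell_avg k u x - cell_avg k v x"
  using assms by (simp add: cell_avg_def set_integral_diff scaleR_right_diff_distrib)

lemma cell_avg_scaleR: "cell_avg k (\<lambda>z. c *\<^sub>R u z) x = c *\<^sub>R cell_avg k u x"
  by (simp add: cell_avg_def set_integral_scaleR_right scaleR_left_commute)

lemma cell_avg_const: "cell_avg k (\<lambda>z. c) (x :: real ^ 'n) = c"
proof -
  have "measure lebesgue (dcell k x) = 1 / 2 ^ (k * CARD('n))"
    by (simp add: measure_def emeasure_dcell)
  then show ?thesis
    by (simp add: cell_avg_def set_integral_const emeasure_dcell)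
qed

section \<open>Fractional Sobolev functions\<close>

lemma norm_diff_powr_le:
  fixes a b :: "'a :: real_normed_vector"
  assumes "0 < p"
  shows "norm (a - b) powr p \<le> 2 powr p * (norm a powr p + norm b powr p)"
proof -
  define M where "M = max (norm a) (norm b)"
  have "norm (a - b) \<le> 2 * M"
    using norm_triangle_ineq4[of a b] by (simp add: M_def)
  then have "norm (a - b) powr p \<le> (2 * M) powr p"
    using assms by (intro powr_mono2) auto
  also have "\<dots> = 2 powr p * M powr p"
    by (simp add: powr_mult M_def)
  also have "M powr p \<le> norm a powr p + norm b powr p"
    by (simp add: M_def max_def)
  finally show ?thesis by simp
qed

lemma nn_integral_le_cmult:
  fixes \<phi> F :: "'a \<Rightarrow> ennreal"
  assumes [measurable]: "\<phi> \<in> borel_measurable M" and C: "0 < C"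
    and le: "\<And>x. x \<in> space M \<Longrightarrow> \<phi> x \<le> ennreal C * F x"
  shows "(\<integral>\<^sup>+x. \<phi> x \<partial>M) \<le> ennreal C * (\<integral>\<^sup>+x. F x \<partial>M)"
proof -
  have 1: "ennreal C * ennreal (1 / C) = 1"
    using C by (simp flip: ennreal_mult)
  have "(\<integral>\<^sup>+x. \<phi> x \<partial>M) = (\<integral>\<^sup>+x. ennreal C * (ennreal (1 / C) * \<phi> x) \<partial>M)"
    by (simp add: 1 flip: mult.assoc)
  also have "\<dots> = ennreal C * (\<integral>\<^sup>+x. ennreal (1 / C) * \<phi> x \<partial>M)"
    by (intro nn_integral_cmult) measurable
  also have "(\<integral>\<^sup>+x. ennreal (1 / C) * \<phi> x \<partial>M) \<le> (\<integral>\<^sup>+x. F x \<partial>M)"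
  proof (intro nn_integral_mono)
    fix x assume "x \<in> space M"
    then have "ennreal (1 / C) * \<phi> x \<le> ennreal (1 / C) * (ennreal C * F x)"
      using le by (intro mult_left_mono) auto
    also have "\<dots> = F x"
      by (simp add: 1 mult.commute[of "ennreal (1 / C)"] flip: mult.assoc)
    finally show "ennreal (1 / C) * \<phi> x \<le> F x" .
  qed
  finally show ?thesis by (simp add: mult_left_mono)
qed

lemma dcell_subset_ball:
  assumes "0 < e"
  shows "\<exists>k0. \<forall>k\<ge>k0. dcell k (x :: real ^ 'n) \<subseteq> ball x e"
proof -
  obtain k0 where k0: "real CARD('n) / e < 2 ^ k0"
    using real_arch_pow[of 2 "real CARD('n) / e"] by auto
  have "dcell k x \<subseteq> ball x e" if "k \<ge> k0" for k
  proof
    fix y assume "y \<in> dcell k x"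
    then have "norm (x - y) \<le> real CARD('n) / 2 ^ k"
      by (intro norm_diff_dcell_le[of _ _ x]) auto
    also have "\<dots> \<le> real CARD('n) / 2 ^ k0"
      using that by (intro divide_left_mono) (auto intro: power_increasing)
    also have "\<dots> < e" using k0 assms by (simp add: field_simps)
    finally show "y \<in> ball x e" by (simp add: dist_norm)
  qed
  then show ?thesis by blast
qed

lemma dcell_subset_open:
  assumes "open \<Omega>" "x \<in> \<Omega>"
  shows "\<exists>k0. \<forall>k\<ge>k0. dcell k (x :: real ^ 'n) \<subseteq> \<Omega>"
  using assms dcell_subset_ball[of _ x] by (meson openE subset_trans)

lemma Wsp_measurable:
  assumes "open \<Omega>" "u \<in> Wsp s p \<Omega>" "S \<subseteq> \<Omega>" "S \<in> sets lebesgue"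
  shows "(\<lambda>x. indicator S x *\<^sub>R u x) \<in> borel_measurable lebesgue"
proof -
  have [measurable]: "(\<lambda>x. indicator \<Omega> x *\<^sub>R u x) \<in> borel_measurable lebesgue"
    using assms(1,2) by (simp add: Wsp_def borel_measurable_restrict_space_iff)
  note [measurable] = assms(4)
  have "(\<lambda>x. indicator S x *\<^sub>R (indicator \<Omega> x *\<^sub>R u x)) \<in> borel_measurable lebesgue"
    by measurable
  moreover have "(\<lambda>x. indicator S x *\<^sub>R (indicator \<Omega> x *\<^sub>R u x)) = (\<lambda>x. indicator S x *\<^sub>R u x)"
    using assms(3) by (intro ext) (auto simp: indicator_def)
  ultimately show ?thesis by simp
qed

lemma Lp_pow_ge:
  assumes "open \<Omega>" "S \<subseteq> \<Omega>"
  shows "(\<integral>\<^sup>+x\<in>S. ennreal (norm (u x) powr p) \<partial>lebesgue) \<le> Lp_pow p \<Omega> u"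
proof -
  have "Lp_pow p \<Omega> u = (\<integral>\<^sup>+x\<in>\<Omega>. ennreal (norm (u x) powr p) \<partial>lebesgue)"
    using assms by (simp add: Lp_pow_def nn_integral_restrict_space)
  then show ?thesis
    using assms(2) by (auto intro!: nn_integral_mono split: split_indicator)
qed

lemma Wsp_pow_eq:
  assumes "u \<in> Wsp s p \<Omega>" "1 < p"
  shows "Wsp_pow s p \<Omega> u = ennreal (Wsp_norm s p \<Omega> u powr p)" "0 \<le> Wsp_norm s p \<Omega> u"
  using assms by (auto simp: Wsp_norm_def Wsp_def powr_powr)

lemma Wsp_set_integrable:
  assumes "open \<Omega>" "u \<in> Wsp s p \<Omega>" "1 < p" "dcell k x \<subseteq> \<Omega>"
  shows "set_integrable lebesgue (dcell k x) u"
proof (rule set_integrable_of_powr[OF _ emeasure_lebesgue_dcell])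
  have "(\<integral>\<^sup>+ x\<in>dcell k x. ennreal (norm (u x) powr p)\<partial>lebesgue) \<le> Wsp_pow s p \<Omega> u"
    using Lp_pow_ge[OF assms(1,4), of u p] unfolding Wsp_pow_def
    by (rule order_trans) (simp add: add_increasing2)
  then show "(\<integral>\<^sup>+ x\<in>dcell k x. ennreal (norm (u x) powr p)\<partial>lebesgue) < \<infinity>"
    using assms(2) by (auto simp: Wsp_def intro: le_less_trans)
qed (use Wsp_measurable[OF assms(1,2,4)] assms(3) in auto)

text \<open>Points of one cell of level \<open>m\<close> have distance at most \<open>n 2\<^sup>-\<^sup>m\<close>, so the Gagliardo kernel is at
  least \<open>(n 2\<^sup>-\<^sup>m)\<^sup>-\<^sup>(\<^sup>n\<^sup>+\<^sup>s\<^sup>p\<^sup>)\<close> times \<open>norm (u y - u z) powr p\<close> there. Multiplied by the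
  normalisation \<open>2\<^sup>m\<^sup>n\<close> of the average, this leaves \<open>2\<^sup>-\<^sup>m\<^sup>s\<^sup>p\<close>.\<close>

lemma Wsp_cell_avg_diff_powr_le:
  fixes u :: "real ^ 'n \<Rightarrow> 'b :: euclidean_space"
  assumes \<Omega>: "open \<Omega>" and u: "u \<in> Wsp s p \<Omega>" and p: "1 < p" and s: "0 < s"
    and y: "dcell m y \<subseteq> \<Omega>"
  shows "ennreal (norm (u y - cell_avg m u y) powr p)
    \<le> ennreal (2 powr p * real CARD('n) powr (real CARD('n) + s * p) * 2 powr (- (real m * s * p)))
       * (\<integral>\<^sup>+ z. ennreal (norm (u y - u z) powr p / norm (y - z) powr (real CARD('n) + s * p))
            \<partial>lebesgue_on \<Omega>)"
proof -
  define n where "n = real CARD('n)"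
  define c where "c = (n / 2 ^ m) powr (n + s * p)"
  define v where "v = (\<lambda>z. u y - u z)"
  define R where "R = dcell m y"
  have n: "n > 0" by (simp add: n_def)
  have ic: "set_integrable lebesgue (dcell m y) (\<lambda>z. u y)"
    unfolding set_integrable_def
    by (simp add: integrable_indicator_iff emeasure_dcell)
  have ui: "set_integrable lebesgue (dcell m y) u"
    using Wsp_set_integrable[OF \<Omega> u p y] .
  have eq: "cell_avg m v y = u y - cell_avg m u y"
    unfolding v_def using ic ui by (simp add: cell_avg_diff cell_avg_const)
  have meas: "(\<lambda>z. indicator (dcell m y) z *\<^sub>R v z) \<in> borel_measurable lebesgue"
  proof -
    have [measurable]: "(\<lambda>z. indicator (dcell m y) z *\<^sub>R u z) \<in> borel_measurable lebesgue"
      using Wsp_measurable[OF \<Omega> u y] by simp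
    have "(\<lambda>z. indicator (dcell m y) z *\<^sub>R u y - indicator (dcell m y) z *\<^sub>R u z)
        \<in> borel_measurable lebesgue"
      by measurable
    then show ?thesis by (simp add: v_def scaleR_diff_right)
  qed
  have [measurable]: "u \<in> borel_measurable (lebesgue_on \<Omega>)"
    using u by (simp add: Wsp_def)
  have [measurable]: "(\<lambda>z. norm (y - z)) \<in> borel_measurable (lebesgue_on \<Omega>)"
    using \<Omega> by (intro continuous_imp_measurable_on_sets_lebesgue continuous_intros) auto
  have pw: "ennreal (norm (v z) powr p) * indicator R z
      \<le> ennreal c * (ennreal (norm (u y - u z) powr p / norm (y - z) powr (n + s * p)) * indicator \<Omega> z)" for z
  proof (cases "z \<in> R \<and> z \<noteq> y")
    case True
    then have z: "z \<in> R" "norm (y - z) > 0" "z \<in> \<Omega>"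
      using y by (auto simp: R_def)
    have "norm (y - z) \<le> n / 2 ^ m"
      using z unfolding n_def R_def by (intro norm_diff_dcell_le[of _ _ y]) auto
    then have "norm (y - z) powr (n + s * p) \<le> c"
      unfolding c_def using n s p by (intro powr_mono2) auto
    then have "norm (u y - u z) powr p * norm (y - z) powr (n + s * p) \<le> norm (u y - u z) powr p * c"
      by (intro mult_left_mono) auto
    then have "norm (u y - u z) powr p \<le> c * (norm (u y - u z) powr p / norm (y - z) powr (n + s * p))"
      using z by (simp add: field_simps)
    then show ?thesis
      using z by (simp add: v_def c_def ennreal_leI flip: ennreal_mult)
  next
    case False
    then show ?thesis using p by (auto simp: v_def)
  qed
  have "ennreal (norm (u y - cell_avg m u y) powr p)
     \<le> ennreal (2 powr p * 2 ^ (m * CARD('n))) * (\<integral>\<^sup>+z\<in>R. ennreal (norm (v z) powr p) \<partial>lebesgue)"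
    unfolding eq[symmetric] R_def using meas p by (intro cell_avg_powr_le) auto
  also have "(\<integral>\<^sup>+z\<in>R. ennreal (norm (v z) powr p) \<partial>lebesgue)
    \<le> (\<integral>\<^sup>+z. ennreal c * (ennreal (norm (u y - u z) powr p / norm (y - z) powr (n + s * p)) * indicator \<Omega> z) \<partial>lebesgue)"
    using pw by (intro nn_integral_mono) auto
  also have "\<dots> = (\<integral>\<^sup>+z. ennreal c * ennreal (norm (u y - u z) powr p / norm (y - z) powr (n + s * p)) \<partial>lebesgue_on \<Omega>)"
    using \<Omega> by (subst nn_integral_restrict_space) (auto simp: mult.assoc)
  also have "\<dots> = ennreal c * (\<integral>\<^sup>+z. ennreal (norm (u y - u z) powr p / norm (y - z) powr (n + s * p)) \<partial>lebesgue_on \<Omega>)"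
    by (intro nn_integral_cmult) measurable
  finally have "ennreal (norm (u y - cell_avg m u y) powr p)
     \<le> ennreal (2 powr p * 2 ^ (m * CARD('n))) * (ennreal c *
       (\<integral>\<^sup>+z. ennreal (norm (u y - u z) powr p / norm (y - z) powr (n + s * p)) \<partial>lebesgue_on \<Omega>))"
    by (simp add: mult_left_mono)
  also have "\<dots> = ennreal (2 powr p * 2 ^ (m * CARD('n)) * c) *
       (\<integral>\<^sup>+z. ennreal (norm (u y - u z) powr p / norm (y - z) powr (n + s * p)) \<partial>lebesgue_on \<Omega>)"
    by (simp add: ennreal_mult c_def mult.assoc)
  also have "2 powr p * 2 ^ (m * CARD('n)) * c
      = 2 powr p * n powr (n + s * p) * 2 powr (- (real m * s * p))"
  proof -
    have "(2::real) ^ (m * CARD('n)) = 2 powr (real m * n)"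
      by (simp add: n_def flip: powr_realpow)
    moreover have "c = n powr (n + s * p) * 2 powr (- (real m * (n + s * p)))"
      using n by (simp add: c_def powr_divide powr_minus_divide powr_powr flip: powr_realpow)
    moreover have "2 powr (real m * n) * 2 powr (- (real m * (n + s * p))) = 2 powr (- (real m * s * p))"
      by (simp add: algebra_simps flip: powr_add)
    ultimately show ?thesis by (simp add: mult.assoc mult.left_commute)
  qed
  finally show ?thesis by (simp add: n_def)
qed

lemma Wsp_error_measurable:
  fixes u :: "real ^ 'n \<Rightarrow> 'b :: euclidean_space"
  assumes \<Omega>: "open \<Omega>" and u: "u \<in> Wsp s p \<Omega>" and p: "1 < p" and Q: "dcell k a \<subseteq> \<Omega>"
  shows "(\<lambda>y. ennreal (norm (u y - cell_avg m u y) powr p) * indicator (dcell k a) y) \<in> borel_measurable lebesgue"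
proof -
  have [measurable]: "(\<lambda>z. indicator (dcell k a) z *\<^sub>R u z) \<in> borel_measurable lebesgue"
    using Wsp_measurable[OF \<Omega> u Q] by simp
  have [measurable]: "cell_avg m u \<in> borel_measurable lebesgue"
    using borel_measurable_cell_avg by (rule borel_measurable_lebesgueI)
  have "(\<lambda>y. ennreal (norm (indicator (dcell k a) y *\<^sub>R u y - indicator (dcell k a) y *\<^sub>R cell_avg m u y) powr p))
    \<in> borel_measurable lebesgue"
    by measurable
  moreover have "(\<lambda>y. ennreal (norm (indicator (dcell k a) y *\<^sub>R u y - indicator (dcell k a) y *\<^sub>R cell_avg m u y) powr p))
     = (\<lambda>y. ennreal (norm (u y - cell_avg m u y) powr p) * indicator (dcell k a) y)"
    using p by (auto split: split_indicator)
  ultimately show ?thesis by simp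
qed

text \<open>The type argument carries the dimension, which does not occur in the other arguments.\<close>

definition approx_const :: "'n itself \<Rightarrow> real \<Rightarrow> real \<Rightarrow> real" where
  "approx_const _ s p = 2 powr p * real CARD('n) powr (real CARD('n) + s * p)"

lemma approx_const_pos: "approx_const TYPE('n::finite) s p > 0"
  by (simp add: approx_const_def)

text \<open>This rate of approximation in \<open>L\<^sup>p\<close> is all the information about the Gagliardo seminorm that
  enters the later estimates.\<close>

lemma Wsp_approx_cell_avg:
  fixes u :: "real ^ 'n \<Rightarrow> 'b :: euclidean_space"
  assumes \<Omega>: "open \<Omega>" and u: "u \<in> Wsp s p \<Omega>" and p: "1 < p" and s: "0 < s"
    and Q: "dcell k a \<subseteq> \<Omega>" and m: "k \<le> m"
  shows "(\<integral>\<^sup>+y\<in>dcell k a. ennreal (norm (u y - cell_avg m u y) powr p) \<partial>lebesgue)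
    \<le> ennreal (approx_const TYPE('n) s p * 2 powr (- (real m * s * p))) * Wsp_pow s p \<Omega> u"
proof -
  let ?C = "approx_const TYPE('n) s p * 2 powr (- (real m * s * p))"
  let ?F = "\<lambda>y. \<integral>\<^sup>+ z. ennreal (norm (u y - u z) powr p / norm (y - z) powr (real CARD('n) + s * p))
            \<partial>lebesgue_on \<Omega>"
  note meas = Wsp_error_measurable[OF \<Omega> u p Q, of m]
  have "(\<integral>\<^sup>+y\<in>dcell k a. ennreal (norm (u y - cell_avg m u y) powr p) \<partial>lebesgue)
      \<le> ennreal ?C * (\<integral>\<^sup>+y. ?F y * indicator \<Omega> y \<partial>lebesgue)"
  proof (intro nn_integral_le_cmult meas)
    show "0 < ?C" by (simp add: approx_const_pos)
    fix y
    show "ennreal (norm (u y - cell_avg m u y) powr p) * indicator (dcell k a) y \<le> ennreal ?C * (?F y * indicator \<Omega> y)"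
    proof (cases "y \<in> dcell k a")
      case True
      then have "dcell m y \<subseteq> \<Omega>" "y \<in> \<Omega>" using dcell_subset[OF m True] Q by auto
      then show ?thesis using Wsp_cell_avg_diff_powr_le[OF \<Omega> u p s, of m y] True by (simp add: approx_const_def)
    qed simp
  qed
  also have "(\<integral>\<^sup>+y. ?F y * indicator \<Omega> y \<partial>lebesgue) = gagliardo_pow s p \<Omega> u"
    using \<Omega> by (simp add: gagliardo_pow_def nn_integral_restrict_space)
  also have "ennreal ?C * gagliardo_pow s p \<Omega> u \<le> ennreal ?C * Wsp_pow s p \<Omega> u"
    by (intro mult_left_mono) (auto simp: Wsp_pow_def add_increasing)
  finally show ?thesis .
qed

text \<open>The \<open>p\<close>-th powers of the errors have a convergent sum of integrals, so they tend to zero almost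
  everywhere. For these functions the differentiation theorem of Lebesgue is thus elementary.\<close>

lemma Wsp_cell_avg_tendsto_AE:
  fixes u :: "real ^ 'n \<Rightarrow> 'b :: euclidean_space"
  assumes \<Omega>: "open \<Omega>" and u: "u \<in> Wsp s p \<Omega>" and p: "1 < p" and s: "0 < s"
    and Q: "dcell k a \<subseteq> \<Omega>"
  shows "AE y in lebesgue. y \<in> dcell k a \<longrightarrow> (\<lambda>m. cell_avg m u y) \<longlonglongrightarrow> u y"
proof -
  define \<phi> where "\<phi> m y = ennreal (norm (u y - cell_avg (m + k) u y) powr p) * indicator (dcell k a) y" for m y
  have meas [measurable]: "\<phi> m \<in> borel_measurable lebesgue" for m
    unfolding \<phi>_def by (rule Wsp_error_measurable[OF \<Omega> u p Q])
  let ?W = "Wsp_norm s p \<Omega> u powr p"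
  let ?r = "2 powr (- (s * p))"
  have W: "Wsp_pow s p \<Omega> u = ennreal ?W" using Wsp_pow_eq[OF u p] by simp
  have r: "?r < 1" using s p by (simp add: powr_less_one)
  have le: "(\<integral>\<^sup>+y. \<phi> m y \<partial>lebesgue) \<le> ennreal (approx_const TYPE('n) s p * ?W * ?r ^ m)" for m
  proof -
    have "(\<integral>\<^sup>+y. \<phi> m y \<partial>lebesgue) \<le> ennreal (approx_const TYPE('n) s p * 2 powr (- (real (m + k) * s * p))) * ennreal ?W"
      unfolding \<phi>_def W[symmetric] by (intro Wsp_approx_cell_avg[OF \<Omega> u p s Q]) simp
    also have "\<dots> = ennreal (approx_const TYPE('n) s p * 2 powr (- (real (m + k) * s * p)) * ?W)"
      using approx_const_pos[where 'n='n, of s p] by (simp add: ennreal_mult)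
    also have "\<dots> \<le> ennreal (approx_const TYPE('n) s p * 2 powr (- (real m * s * p)) * ?W)"
      using approx_const_pos[where 'n='n, of s p] s p
      by (intro ennreal_leI mult_right_mono mult_left_mono powr_mono) (auto simp: algebra_simps)
    also have "2 powr (- (real m * s * p)) = ?r ^ m"
      by (simp add: powr_powr mult.commute mult.left_commute flip: powr_realpow)
    finally show ?thesis by (simp add: mult_ac)
  qed
  have "(\<integral>\<^sup>+y. (\<Sum>m. \<phi> m y) \<partial>lebesgue) = (\<Sum>m. \<integral>\<^sup>+y. \<phi> m y \<partial>lebesgue)"
    by (intro nn_integral_suminf) measurable
  also have "\<dots> \<le> (\<Sum>m. ennreal (approx_const TYPE('n) s p * ?W * ?r ^ m))"
    using le by (intro suminf_le) auto
  also have "\<dots> < \<infinity>"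
    using approx_const_pos[where 'n='n, of s p] r
    by (subst suminf_ennreal2) (auto intro!: summable_mult summable_geometric)
  finally have "AE y in lebesgue. (\<Sum>m. \<phi> m y) \<noteq> \<infinity>"
    by (intro nn_integral_PInf_AE) auto
  then show ?thesis
  proof eventually_elim
    case (elim y)
    show ?case
    proof
      assume y: "y \<in> dcell k a"
      have "summable (\<lambda>m. norm (u y - cell_avg (m + k) u y) powr p)"
        using elim y by (intro summable_suminf_not_top) (auto simp: \<phi>_def)
      then have "(\<lambda>m. norm (u y - cell_avg (m + k) u y) powr p) \<longlonglongrightarrow> 0"
        by (rule summable_LIMSEQ_zero)
      then have "(\<lambda>m. (norm (u y - cell_avg (m + k) u y) powr p) powr (1 / p)) \<longlonglongrightarrow> 0 powr (1 / p)"
        using p by (intro tendsto_powr2) (auto intro: tendsto_const)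
      then have "(\<lambda>m. norm (u y - cell_avg (m + k) u y)) \<longlonglongrightarrow> 0"
        using p by (simp add: powr_powr)
      then have "(\<lambda>m. u y - cell_avg (m + k) u y) \<longlonglongrightarrow> 0"
        by (rule tendsto_norm_zero_cancel)
      then have "(\<lambda>m. u y - (u y - cell_avg (m + k) u y)) \<longlonglongrightarrow> u y - 0"
        by (intro tendsto_intros)
      then have "(\<lambda>m. cell_avg (m + k) u y) \<longlonglongrightarrow> u y" by simp
      then show "(\<lambda>m. cell_avg m u y) \<longlonglongrightarrow> u y"
        by (rule LIMSEQ_offset)
    qed
  qed
qed

definition cell_inc :: "nat \<Rightarrow> (real ^ 'n \<Rightarrow> 'b :: euclidean_space) \<Rightarrow> real ^ 'n \<Rightarrow> 'b" where
  "cell_inc m u x = cell_avg (Suc m) u x - cell_avg m u x"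

lemma borel_measurable_cell_inc [measurable]: "cell_inc m u \<in> borel_measurable borel"
  unfolding cell_inc_def by measurable

lemma cell_inc_cong_cell: "y \<in> dcell (Suc m) x \<Longrightarrow> cell_inc m u y = cell_inc m u x"
  using dcell_mono[of m "Suc m" x] by (auto simp: cell_inc_def intro: cell_avg_cong_cell arg_cong2[of _ _ _ _ minus])

lemma nn_integral_lebesgue_cell_inc:
  "(\<integral>\<^sup>+y\<in>dcell k a. ennreal (norm (cell_inc m u y) powr p) \<partial>lborel)
   = (\<integral>\<^sup>+y\<in>dcell k a. ennreal (norm (cell_inc m u y) powr p) \<partial>lebesgue)"
  by (intro nn_integral_completion[symmetric]) measurable

lemma Wsp_cell_inc_bound:
  fixes u :: "real ^ 'n \<Rightarrow> 'b :: euclidean_space"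
  assumes \<Omega>: "open \<Omega>" and u: "u \<in> Wsp s p \<Omega>" and p: "1 < p" and s: "0 < s"
    and Q: "dcell k a \<subseteq> \<Omega>" and m: "k \<le> m"
  shows "(\<integral>\<^sup>+y\<in>dcell k a. ennreal (norm (cell_inc m u y) powr p) \<partial>lborel)
    \<le> ennreal (2 * 2 powr p * approx_const TYPE('n) s p * 2 powr (- (real m * s * p))) * Wsp_pow s p \<Omega> u"
proof -
  let ?K = "\<lambda>m. approx_const TYPE('n) s p * 2 powr (- (real m * s * p))"
  define \<phi> where "\<phi> m y = ennreal (norm (u y - cell_avg m u y) powr p) * indicator (dcell k a) y" for m y
  have meas [measurable]: "\<phi> m \<in> borel_measurable lebesgue" for m
    unfolding \<phi>_def by (rule Wsp_error_measurable[OF \<Omega> u p Q])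
  have I: "(\<integral>\<^sup>+y. \<phi> j y \<partial>lebesgue) \<le> ennreal (?K m) * Wsp_pow s p \<Omega> u" if "m \<le> j" for j
  proof -
    have "(\<integral>\<^sup>+y. \<phi> j y \<partial>lebesgue) \<le> ennreal (?K j) * Wsp_pow s p \<Omega> u"
      unfolding \<phi>_def using that m by (intro Wsp_approx_cell_avg[OF \<Omega> u p s Q]) simp
    also have "\<dots> \<le> ennreal (?K m) * Wsp_pow s p \<Omega> u"
      using that approx_const_pos[where 'n='n, of s p] s p
      by (intro ennreal_leI mult_right_mono mult_left_mono powr_mono) auto
    finally show ?thesis .
  qed
  have "(\<integral>\<^sup>+y\<in>dcell k a. ennreal (norm (cell_inc m u y) powr p) \<partial>lebesgue)
     \<le> (\<integral>\<^sup>+y. ennreal (2 powr p) * (\<phi> m y + \<phi> (Suc m) y) \<partial>lebesgue)"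
  proof (intro nn_integral_mono)
    fix y
    have "norm (cell_inc m u y) powr p \<le> 2 powr p * (norm (u y - cell_avg m u y) powr p + norm (u y - cell_avg (Suc m) u y) powr p)"
      using norm_diff_powr_le[of p "u y - cell_avg m u y" "u y - cell_avg (Suc m) u y"] p by (simp add: cell_inc_def)
    then show "ennreal (norm (cell_inc m u y) powr p) * indicator (dcell k a) y \<le> ennreal (2 powr p) * (\<phi> m y + \<phi> (Suc m) y)"
      by (auto simp: \<phi>_def ennreal_leI split: split_indicator simp flip: ennreal_plus ennreal_mult)
  qed
  also have "\<dots> = ennreal (2 powr p) * ((\<integral>\<^sup>+y. \<phi> m y \<partial>lebesgue) + (\<integral>\<^sup>+y. \<phi> (Suc m) y \<partial>lebesgue))"
    by (simp add: nn_integral_cmult nn_integral_add)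
  also have "\<dots> \<le> ennreal (2 powr p) * (ennreal (?K m) * Wsp_pow s p \<Omega> u + ennreal (?K m) * Wsp_pow s p \<Omega> u)"
    using I by (intro mult_left_mono add_mono) auto
  also have "\<dots> = ennreal (2 * 2 powr p * approx_const TYPE('n) s p * 2 powr (- (real m * s * p))) * Wsp_pow s p \<Omega> u"
  proof -
    have "ennreal (?K m) * Wsp_pow s p \<Omega> u + ennreal (?K m) * Wsp_pow s p \<Omega> u = ennreal (2 * ?K m) * Wsp_pow s p \<Omega> u"
      using approx_const_pos[where 'n='n, of s p] by (simp add: distrib_right[symmetric] mult.assoc flip: ennreal_plus)
    moreover have "ennreal (2 powr p) * (ennreal (2 * ?K m) * Wsp_pow s p \<Omega> u)
        = ennreal (2 powr p * (2 * ?K m)) * Wsp_pow s p \<Omega> u"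
      using approx_const_pos[where 'n='n, of s p] by (subst ennreal_mult) (auto simp: mult.assoc)
    moreover have "2 powr p * (2 * ?K m) = 2 * 2 powr p * approx_const TYPE('n) s p * 2 powr (- (real m * s * p))"
      by (simp add: mult_ac)
    ultimately show ?thesis by simp
  qed
  finally show ?thesis unfolding nn_integral_lebesgue_cell_inc .
qed

lemma cell_avg_tendsto_continuous:
  fixes u :: "real ^ 'n \<Rightarrow> 'b :: euclidean_space"
  assumes \<Omega>: "open \<Omega>" and u: "u \<in> Wsp s p \<Omega>" and p: "1 < p"
    and c: "continuous_on \<Omega> u" and x: "x \<in> \<Omega>"
  shows "(\<lambda>m. cell_avg m u x) \<longlonglongrightarrow> u x"
proof (rule LIMSEQ_I)
  fix e :: real assume e: "0 < e"
  have "isCont u x" using c \<Omega> x by (simp add: continuous_on_eq_continuous_at)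
  then obtain d where d: "d > 0" "\<And>z. dist z x < d \<Longrightarrow> dist (u z) (u x) < e / 4"
    using e unfolding continuous_at_eps_delta by (metis zero_less_divide_iff zero_less_numeral)
  obtain k1 where k1: "\<And>k. k \<ge> k1 \<Longrightarrow> dcell k x \<subseteq> \<Omega>" using dcell_subset_open[OF \<Omega> x] by auto
  obtain k2 where k2: "\<And>k. k \<ge> k2 \<Longrightarrow> dcell k x \<subseteq> ball x d" using dcell_subset_ball[OF d(1), of x] by auto
  have "norm (cell_avg m u x - u x) < e" if m: "m \<ge> max k1 k2" for m
  proof -
    define v where "v = (\<lambda>z. u z - u x)"
    have sub: "dcell m x \<subseteq> \<Omega>" "dcell m x \<subseteq> ball x d" using k1 k2 m by auto
    have ic: "set_integrable lebesgue (dcell m x) (\<lambda>z. u x)"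
      unfolding set_integrable_def by (simp add: integrable_indicator_iff emeasure_dcell)
    have ui: "set_integrable lebesgue (dcell m x) u"
      using Wsp_set_integrable[OF \<Omega> u p sub(1)] .
    have eq: "cell_avg m v x = cell_avg m u x - u x"
      unfolding v_def using ic ui by (simp add: cell_avg_diff cell_avg_const)
    have vi: "set_integrable lebesgue (dcell m x) v"
      unfolding v_def using ui ic by (rule set_integral_diff(1))
    have ve: "norm (v z) \<le> e / 4" if "z \<in> dcell m x" for z
      using d(2)[of z] sub(2) that by (auto simp: v_def dist_norm norm_minus_commute)
    have "ennreal (norm (cell_avg m v x) powr p)
      \<le> ennreal (2 powr p * 2 ^ (m * CARD('n))) * (\<integral>\<^sup>+z\<in>dcell m x. ennreal (norm (v z) powr p) \<partial>lebesgue)"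
      using vi p by (intro cell_avg_powr_le) (auto simp: set_integrable_def)
    also have "(\<integral>\<^sup>+z\<in>dcell m x. ennreal (norm (v z) powr p) \<partial>lebesgue)
      \<le> (\<integral>\<^sup>+z. ennreal ((e / 4) powr p) * indicator (dcell m x) z \<partial>lebesgue)"
      using ve p by (intro nn_integral_mono) (auto split: split_indicator intro!: ennreal_leI powr_mono2)
    also have "\<dots> = ennreal ((e / 4) powr p) * ennreal (1 / 2 ^ (m * CARD('n)))"
      by (subst nn_integral_cmult_indicator) (auto simp: emeasure_dcell)
    finally have "ennreal (norm (cell_avg m v x) powr p)
        \<le> ennreal (2 powr p * 2 ^ (m * CARD('n))) * (ennreal ((e / 4) powr p) * ennreal (1 / 2 ^ (m * CARD('n))))"
      by (simp add: mult_left_mono)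
    also have "\<dots> = ennreal ((2 * (e / 4)) powr p)"
      using e by (subst powr_mult) (auto simp flip: ennreal_mult)
    finally have "norm (cell_avg m v x) powr p \<le> (e / 2) powr p"
      using e by simp
    then have "norm (cell_avg m v x) \<le> e / 2"
      using p e by (meson powr_less_mono2 linorder_not_less norm_ge_zero less_trans zero_less_one half_gt_zero less_imp_le)
    then show ?thesis using eq e by simp
  qed
  then show "\<exists>no. \<forall>n\<ge>no. norm (cell_avg n u x - u x) < e" by blast
qed

section \<open>Uniform boundedness\<close>

text \<open>Sokal's proof of the uniform boundedness principle. If \<open>\<nu>\<close> exceeds \<open>20\<^sup>k\<close> at \<open>y\<^sub>k\<close>, add up norming
  functionals \<open>l\<^sub>k\<close> for \<open>y\<^sub>k\<close> with coefficients \<open>\<plusminus>10\<^sup>-\<^sup>k\<close>, where the sign of each term agrees with the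
  value at \<open>y\<^sub>k\<close> of the partial sum before it. At \<open>y\<^sub>k\<close> the sum up to \<open>k\<close> is then at least
  \<open>10\<^sup>-\<^sup>k \<nu>(y\<^sub>k) / 2\<close> in absolute value and the rest of the series is at most
  \<open>2/9 10\<^sup>-\<^sup>k \<nu>(y\<^sub>k)\<close>, so the limit functional is unbounded along the sequence.\<close>

lemma uniform_boundedness_seq:
  fixes \<nu> :: "'v \<Rightarrow> real" and x :: "nat \<Rightarrow> 'v" and F :: "('v \<Rightarrow> real) set"
  assumes xS: "\<And>j. x j \<in> S"
    and bnd: "\<And>l u. l \<in> F \<Longrightarrow> u \<in> S \<Longrightarrow> \<bar>l u\<bar> \<le> 2 * \<nu> u"
    and norming: "\<And>j. \<exists>l\<in>F. \<nu> (x j) \<le> 2 * l (x j)"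
    and test: "\<And>a l. (\<And>k. l k \<in> F) \<Longrightarrow> (\<And>k. \<bar>a k\<bar> \<le> (1 / 10) ^ k) \<Longrightarrow>
        Bseq (\<lambda>j. \<Sum>k. a k * l k (x j))"
  shows "\<exists>C. \<forall>j. \<nu> (x j) \<le> C"
proof (rule ccontr)
  assume "\<not> ?thesis"
  then have "\<forall>k. \<exists>j. 20 ^ k < \<nu> (x j)" by (meson linorder_not_less)
  then obtain jj where jj: "\<And>k. 20 ^ k < \<nu> (x (jj k))" by metis
  define y where "y k = x (jj k)" for k
  have yS: "y k \<in> S" for k by (simp add: y_def xS)
  have "\<forall>k. \<exists>l. l \<in> F \<and> \<nu> (y k) \<le> 2 * l (y k)"
    using norming by (auto simp: y_def)
  from choice[OF this] obtain l where l: "\<And>k. l k \<in> F" "\<And>k. \<nu> (y k) \<le> 2 * l k (y k)"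
    by blast
  define P where "P = rec_nat (\<lambda>u. 0) (\<lambda>k q u. q u + (if 0 \<le> q (y k) then 1 else -1) * (1 / 10) ^ k * l k u)"
  define a :: "nat \<Rightarrow> real" where "a k = (if 0 \<le> P k (y k) then 1 else -1) * (1 / 10) ^ k" for k
  have P0: "P 0 u = 0" and PS: "P (Suc k) u = P k u + a k * l k u" for k u
    by (simp_all add: P_def a_def)
  have P: "P k u = (\<Sum>i<k. a i * l i u)" for k u
    by (induction k) (simp_all add: P0 PS)
  have a: "\<bar>a k\<bar> = (1 / 10) ^ k" for k by (simp add: a_def abs_mult)
  have trm: "\<bar>a k * l k u\<bar> \<le> 2 * \<nu> u * (1 / 10) ^ k" if "u \<in> S" for k u
    using mult_left_mono[OF bnd[OF l(1) that, of k], of "(1 / 10) ^ k"]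
    by (simp add: abs_mult a mult_ac)
  have sm: "summable (\<lambda>k. \<bar>a k * l k u\<bar>)" if "u \<in> S" for u
    by (rule summable_comparison_test'[of "\<lambda>k. 2 * \<nu> u * (1 / 10) ^ k" 0])
       (use trm[OF that] in \<open>auto intro: summable_mult summable_geometric\<close>)
  have big: "2 ^ k / 4 \<le> \<bar>\<Sum>i. a i * l i (y k)\<bar>" for k
  proof -
    have \<nu>: "20 ^ k < \<nu> (y k)" using jj by (simp add: y_def)
    have l0: "0 \<le> l k (y k)"
      using l(2)[of k] \<nu> by (meson le_less_trans less_imp_le linorder_not_less mult_nonneg_nonpos zero_le_numeral zero_le_power)
    have main: "(1 / 10) ^ k * (\<nu> (y k) / 2) \<le> \<bar>P (Suc k) (y k)\<bar>"
    proof -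
      have "(1 / 10) ^ k * (\<nu> (y k) / 2) \<le> (1 / 10) ^ k * l k (y k)"
        using l(2)[of k] by (intro mult_left_mono) auto
      also have "\<dots> \<le> \<bar>P (Suc k) (y k)\<bar>"
      proof -
        have nn: "0 \<le> (1 / 10) ^ k * l k (y k)" using l0 by simp
        have eq: "P (Suc k) (y k) = (if 0 \<le> P k (y k) then P k (y k) + (1 / 10) ^ k * l k (y k)
            else P k (y k) - (1 / 10) ^ k * l k (y k))"
          by (simp add: PS a_def)
        show ?thesis
        proof (cases "0 \<le> P k (y k)")
          case True
          then have "P (Suc k) (y k) = P k (y k) + (1 / 10) ^ k * l k (y k)" using eq by (simp only: if_True)
          then show ?thesis using nn True by linarith
        next
          case False
          then have "P (Suc k) (y k) = P k (y k) - (1 / 10) ^ k * l k (y k)" using eq by (simp only: if_False)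
          then show ?thesis using nn False by linarith
        qed
      qed
      finally show ?thesis .
    qed
    have s2: "summable (\<lambda>i. \<bar>a (i + Suc k) * l (i + Suc k) (y k)\<bar>)"
      using sm[OF yS] by (rule summable_ignore_initial_segment)
    have "\<bar>\<Sum>i. a (i + Suc k) * l (i + Suc k) (y k)\<bar> \<le> (\<Sum>i. \<bar>a (i + Suc k) * l (i + Suc k) (y k)\<bar>)"
      by (rule summable_rabs[OF s2])
    also have "\<dots> \<le> (\<Sum>i. 2 * \<nu> (y k) * (1 / 10) ^ Suc k * (1 / 10) ^ i)"
    proof (intro suminf_le s2)
      show "\<bar>a (i + Suc k) * l (i + Suc k) (y k)\<bar> \<le> 2 * \<nu> (y k) * (1 / 10) ^ Suc k * (1 / 10) ^ i" for i
        using trm[OF yS, of "i + Suc k" k] by (simp add: power_add mult_ac)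
      show "summable (\<lambda>i. 2 * \<nu> (y k) * (1 / 10) ^ Suc k * (1 / 10) ^ i)"
        by (intro summable_mult summable_geometric) simp
    qed
    also have "\<dots> = 2 / 9 * (1 / 10) ^ k * \<nu> (y k)"
      by (subst suminf_mult) (auto simp: summable_geometric suminf_geometric)
    finally have tail: "\<bar>\<Sum>i. a (i + Suc k) * l (i + Suc k) (y k)\<bar> \<le> 2 / 9 * (1 / 10) ^ k * \<nu> (y k)" .
    have "(\<Sum>i. a i * l i (y k)) = (\<Sum>i. a (i + Suc k) * l (i + Suc k) (y k)) + P (Suc k) (y k)"
      unfolding P by (rule suminf_split_initial_segment[OF summable_rabs_cancel[OF sm[OF yS]]])
    then have "(1 / 10) ^ k * (\<nu> (y k) / 2) - 2 / 9 * (1 / 10) ^ k * \<nu> (y k) \<le> \<bar>\<Sum>i. a i * l i (y k)\<bar>"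
      using main tail by linarith
    moreover have "(1 / 10) ^ k * (\<nu> (y k) / 2) - 2 / 9 * (1 / 10) ^ k * \<nu> (y k) = 5 / 18 * ((1 / 10) ^ k * \<nu> (y k))"
      by (simp add: algebra_simps)
    moreover have "(1 / 10 :: real) ^ k * 20 ^ k \<le> (1 / 10) ^ k * \<nu> (y k)"
      using \<nu> by (intro mult_left_mono) auto
    moreover have "(1 / 10 :: real) ^ k * 20 ^ k = 2 ^ k"
      by (simp flip: power_mult_distrib)
    moreover have "(0::real) \<le> 2 ^ k" by simp
    ultimately show ?thesis by linarith
  qed
  have "Bseq (\<lambda>j. \<Sum>k. a k * l k (x j))"
    by (rule test) (auto simp: l a)
  then obtain B where B: "\<And>j. \<bar>\<Sum>k. a k * l k (x j)\<bar> \<le> B"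
    by (auto simp: Bseq_def)
  obtain k where "4 * B < 2 ^ k" using real_arch_pow[of 2 "4 * B"] by auto
  then show False using big[of k] B[of "jj k"] by (simp add: y_def)
qed

lemma cell_avg_inner_dual:
  fixes b :: "'b :: euclidean_space"
  assumes \<Omega>: "open \<Omega>" and p: "1 < p" and Q: "dcell k (x :: real ^ 'n) \<subseteq> \<Omega>"
  shows "(\<lambda>u. cell_avg k u x \<bullet> b) \<in> Wsp_dual s p \<Omega>"
  unfolding Wsp_dual_def
proof (intro CollectI conjI ballI allI exI)
  fix u v :: "real ^ 'n \<Rightarrow> 'b" assume u: "u \<in> Wsp s p \<Omega>" and v: "v \<in> Wsp s p \<Omega>"
  show "cell_avg k (\<lambda>x. u x + v x) x \<bullet> b = cell_avg k u x \<bullet> b + cell_avg k v x \<bullet> b"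
    using Wsp_set_integrable[OF \<Omega> u p Q] Wsp_set_integrable[OF \<Omega> v p Q]
    by (simp add: cell_avg_add inner_add_left)
next
  fix c and u :: "real ^ 'n \<Rightarrow> 'b"
  show "cell_avg k (\<lambda>x. c *\<^sub>R u x) x \<bullet> b = c * (cell_avg k u x \<bullet> b)"
    by (simp add: cell_avg_scaleR)
next
  fix u :: "real ^ 'n \<Rightarrow> 'b" assume u: "u \<in> Wsp s p \<Omega>"
  let ?A = "2 powr p * 2 ^ (k * CARD('n))"
  have "ennreal (norm (cell_avg k u x) powr p)
    \<le> ennreal ?A * (\<integral>\<^sup>+z\<in>dcell k x. ennreal (norm (u z) powr p) \<partial>lebesgue)"
    using Wsp_measurable[OF \<Omega> u Q] p by (intro cell_avg_powr_le) auto
  also have "\<dots> \<le> ennreal ?A * Wsp_pow s p \<Omega> u"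
    using Lp_pow_ge[OF \<Omega> Q, of u p] unfolding Wsp_pow_def
    by (intro mult_left_mono) (auto intro: order_trans simp: add_increasing2)
  also have "\<dots> = ennreal (?A * Wsp_norm s p \<Omega> u powr p)"
    by (simp add: Wsp_pow_eq[OF u p] ennreal_mult)
  finally have "norm (cell_avg k u x) powr p \<le> ?A * Wsp_norm s p \<Omega> u powr p"
    by simp
  then have "(norm (cell_avg k u x) powr p) powr (1 / p) \<le> (?A * Wsp_norm s p \<Omega> u powr p) powr (1 / p)"
    using p by (intro powr_mono2) auto
  then have "norm (cell_avg k u x) \<le> ?A powr (1 / p) * Wsp_norm s p \<Omega> u"
    using p Wsp_pow_eq(2)[OF u p] by (simp add: powr_powr powr_mult)
  then have "norm b * norm (cell_avg k u x) \<le> norm b * (?A powr (1 / p) * Wsp_norm s p \<Omega> u)"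
    by (intro mult_left_mono) auto
  then show "\<bar>cell_avg k u x \<bullet> b\<bar> \<le> norm b * ?A powr (1 / p) * Wsp_norm s p \<Omega> u"
    using Cauchy_Schwarz_ineq2[of "cell_avg k u x" b] by (simp add: mult_ac)
qed

lemma cell_avg_weak_tendsto:
  fixes f :: "nat \<Rightarrow> real ^ 'n \<Rightarrow> 'b :: euclidean_space"
  assumes "open \<Omega>" "1 < p" "dcell k x \<subseteq> \<Omega>" "Wsp_weakly_converges s p \<Omega> f g"
  shows "(\<lambda>j. cell_avg k (f j) x) \<longlonglongrightarrow> cell_avg k g x"
proof (subst tendsto_componentwise_iff, rule ballI)
  fix b :: 'b
  have "\<forall>L\<in>Wsp_dual s p \<Omega>. (\<lambda>j. L (f j)) \<longlonglongrightarrow> L g"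
    using assms(4) by (simp add: Wsp_weakly_converges_def)
  from bspec[OF this cell_avg_inner_dual[OF assms(1-3), of b s]]
  show "(\<lambda>j. cell_avg k (f j) x \<bullet> b) \<longlonglongrightarrow> cell_avg k g x \<bullet> b" .
qed

lemma powr_young_dual:
  fixes a b p :: real
  assumes "0 \<le> a" "0 \<le> b" "1 < p"
  shows "a powr (p - 1) * b \<le> a powr p + b powr p"
proof (cases "a = 0 \<or> b = 0")
  case False
  then have ab: "0 < a" "0 < b" using assms by auto
  define c where "c = max a b"
  have "a powr (p - 1) * b \<le> c powr (p - 1) * c"
    using assms unfolding c_def by (intro mult_mono powr_mono2) auto
  also have "\<dots> = c powr p"
    using ab by (simp add: powr_diff c_def)
  also have "\<dots> \<le> a powr p + b powr p"
    by (simp add: c_def max_def)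
  finally show ?thesis .
qed (use assms in auto)

definition cell_inc_energy :: "real \<Rightarrow> (real ^ 'n) set \<Rightarrow> nat \<Rightarrow> (real ^ 'n \<Rightarrow> 'b :: euclidean_space) \<Rightarrow> real" where
  "cell_inc_energy p Q m u = enn2real (\<integral>\<^sup>+y\<in>Q. ennreal (norm (cell_inc m u y) powr p) \<partial>lborel)"

lemma cell_inc_energy:
  fixes u :: "real ^ 'n \<Rightarrow> 'b :: euclidean_space"
  assumes \<Omega>: "open \<Omega>" and u: "u \<in> Wsp s p \<Omega>" and p: "1 < p" and s: "0 < s"
    and Q: "dcell k a \<subseteq> \<Omega>" and m: "k \<le> m"
  shows "(\<integral>\<^sup>+y\<in>dcell k a. ennreal (norm (cell_inc m u y) powr p) \<partial>lborel) = ennreal (cell_inc_energy p (dcell k a) m u)"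
    "2 powr (real m * s) * cell_inc_energy p (dcell k a) m u powr (1 / p)
      \<le> (2 * 2 powr p * approx_const TYPE('n) s p) powr (1 / p) * Wsp_norm s p \<Omega> u"
proof -
  let ?C = "2 * 2 powr p * approx_const TYPE('n) s p"
  let ?W = "Wsp_norm s p \<Omega> u"
  note K = approx_const_pos[where 'n='n, of s p]
  note W = Wsp_pow_eq[OF u p]
  have b: "(\<integral>\<^sup>+y\<in>dcell k a. ennreal (norm (cell_inc m u y) powr p) \<partial>lborel)
     \<le> ennreal (?C * 2 powr (- (real m * s * p)) * ?W powr p)"
    using Wsp_cell_inc_bound[OF assms] K by (simp add: W ennreal_mult)
  then have "(\<integral>\<^sup>+y\<in>dcell k a. ennreal (norm (cell_inc m u y) powr p) \<partial>lborel) < \<infinity>"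
    by (rule le_less_trans) simp
  then show eq: "(\<integral>\<^sup>+y\<in>dcell k a. ennreal (norm (cell_inc m u y) powr p) \<partial>lborel) = ennreal (cell_inc_energy p (dcell k a) m u)"
    by (simp add: cell_inc_energy_def)
  have "cell_inc_energy p (dcell k a) m u \<le> ?C * 2 powr (- (real m * s * p)) * ?W powr p"
    using b K unfolding eq by (subst (asm) ennreal_le_iff) auto
  then have "cell_inc_energy p (dcell k a) m u powr (1 / p) \<le> (?C * 2 powr (- (real m * s * p)) * ?W powr p) powr (1 / p)"
    using p by (intro powr_mono2) (auto simp: cell_inc_energy_def)
  also have "\<dots> = ?C powr (1 / p) * 2 powr (- (real m * s)) * ?W"
    using p K W(2) by (simp add: powr_mult powr_powr)
  finally have "2 powr (real m * s) * cell_inc_energy p (dcell k a) m u powr (1 / p)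
      \<le> 2 powr (real m * s) * (?C powr (1 / p) * 2 powr (- (real m * s)) * ?W)"
    by (intro mult_left_mono) auto
  also have "\<dots> = ?C powr (1 / p) * ?W * (2 powr (real m * s) * 2 powr (- (real m * s)))"
    by (simp add: mult_ac)
  also have "\<dots> = ?C powr (1 / p) * ?W"
    by (simp flip: powr_add)
  finally show "2 powr (real m * s) * cell_inc_energy p (dcell k a) m u powr (1 / p) \<le> ?C powr (1 / p) * ?W" .
qed

lemma cell_inc_add:
  assumes "open \<Omega>" "u \<in> Wsp s p \<Omega>" "v \<in> Wsp s p \<Omega>" "1 < p" "dcell k a \<subseteq> \<Omega>" "k \<le> m" "y \<in> dcell k a"
  shows "cell_inc m (\<lambda>x. u x + v x) y = cell_inc m u y + cell_inc m v y"
proof -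
  have "dcell m y \<subseteq> \<Omega>" "dcell (Suc m) y \<subseteq> \<Omega>"
    using dcell_subset[of k _ y a] assms by (meson le_SucI subset_trans)+
  then show ?thesis
    using Wsp_set_integrable[OF assms(1,2,4)] Wsp_set_integrable[OF assms(1,3,4)]
    by (simp add: cell_inc_def cell_avg_add)
qed

lemma cell_inc_scaleR: "cell_inc m (\<lambda>x. c *\<^sub>R u x) y = c *\<^sub>R cell_inc m u y"
  by (simp add: cell_inc_def cell_avg_scaleR scaleR_diff_right)

text \<open>Up to normalisation, \<open>\<phi> = norm (D f) powr (p - 2) *\<^sub>R D f\<close> with \<open>D = cell_inc m\<close> is the duality map of
  \<open>L\<^sup>p\<close>. The bound follows from \<open>powr_young_dual\<close> after scaling \<open>D u\<close> by a number \<open>t\<close> slightly above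
  its norm; the factor \<open>2\<close> is the price for using this in place of Hoelder's inequality.\<close>

lemma cell_inc_norming:
  fixes f :: "real ^ 'n \<Rightarrow> 'b :: euclidean_space"
  assumes \<Omega>: "open \<Omega>" and f: "f \<in> Wsp s p \<Omega>" and p: "1 < p" and s: "0 < s"
    and Q: "dcell k a \<subseteq> \<Omega>" and m: "k \<le> m"
  defines "E \<equiv> cell_inc_energy p (dcell k a) m"
  shows "\<exists>l. (\<forall>u\<in>Wsp s p \<Omega>. \<forall>v\<in>Wsp s p \<Omega>. l (\<lambda>x. u x + v x) = l u + l v) \<and>
     (\<forall>c. \<forall>u\<in>Wsp s p \<Omega>. l (\<lambda>x. c *\<^sub>R u x) = c * l u) \<and>
     (\<forall>u\<in>Wsp s p \<Omega>. \<bar>l u\<bar> \<le> 2 * E u powr (1 / p)) \<and> l f = E f powr (1 / p)"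
proof (cases "E f = 0")
  case True
  then show ?thesis by (intro exI[of _ "\<lambda>u. 0"]) auto
next
  case False
  define la where "la = E f powr (1 / p)"
  have Ef: "E f > 0" using False unfolding E_def cell_inc_energy_def by (simp add: enn2real_nonneg less_le)
  have la: "la > 0" "la powr p = E f"
    using Ef p by (auto simp: la_def powr_powr)
  define \<phi> where "\<phi> y = (norm (cell_inc m f y) / la) powr (p - 1) *\<^sub>R sgn (cell_inc m f y)" for y
  define l where "l u = (LINT y:dcell k a|lborel. \<phi> y \<bullet> cell_inc m u y)" for u :: "real ^ 'n \<Rightarrow> 'b"
  have sgnm [measurable]: "(\<lambda>y. sgn (cell_inc m f y)) \<in> borel_measurable borel"
    unfolding sgn_div_norm by measurable
  have [measurable]: "\<phi> \<in> borel_measurable borel" unfolding \<phi>_def by measurable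
  have norm\<phi>: "norm (\<phi> y) \<le> (norm (cell_inc m f y) / la) powr (p - 1)" for y
    by (simp add: \<phi>_def norm_sgn)
  have en: "(\<integral>\<^sup>+y\<in>dcell k a. ennreal (norm (cell_inc m u y) powr p) \<partial>lborel) = ennreal (E u)" "0 \<le> E u"
    if "u \<in> Wsp s p \<Omega>" for u :: "real ^ 'n \<Rightarrow> 'b"
    using cell_inc_energy(1)[OF \<Omega> that p s Q m] by (auto simp: E_def cell_inc_energy_def)
  have bound: "(\<integral>\<^sup>+y. ennreal (norm (indicator (dcell k a) y *\<^sub>R (\<phi> y \<bullet> cell_inc m u y))) \<partial>lborel) \<le> ennreal (2 * t)"
    if u: "u \<in> Wsp s p \<Omega>" and t: "t > 0" "E u powr (1 / p) \<le> t" for u :: "real ^ 'n \<Rightarrow> 'b" and t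
  proof -
    have Et: "E u \<le> t powr p"
    proof -
      have "(E u powr (1 / p)) powr p \<le> t powr p" using t p by (intro powr_mono2) auto
      then show ?thesis using p en(2)[OF u] by (simp add: powr_powr)
    qed
    have "\<bar>\<phi> y \<bullet> cell_inc m u y\<bar> \<le> t / la powr p * norm (cell_inc m f y) powr p + t / t powr p * norm (cell_inc m u y) powr p" for y
    proof -
      have "\<bar>\<phi> y \<bullet> cell_inc m u y\<bar> \<le> norm (\<phi> y) * norm (cell_inc m u y)"
        by (rule Cauchy_Schwarz_ineq2)
      also have "\<dots> \<le> (norm (cell_inc m f y) / la) powr (p - 1) * norm (cell_inc m u y)"
        using norm\<phi> by (intro mult_right_mono) auto
      also have "\<dots> = t * ((norm (cell_inc m f y) / la) powr (p - 1) * (norm (cell_inc m u y) / t))"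
        using t by simp
      also have "\<dots> \<le> t * ((norm (cell_inc m f y) / la) powr p + (norm (cell_inc m u y) / t) powr p)"
        using t la p by (intro mult_left_mono powr_young_dual) auto
      finally show ?thesis
        using la t by (simp add: powr_divide distrib_left)
    qed
    then have "(\<integral>\<^sup>+y. ennreal (norm (indicator (dcell k a) y *\<^sub>R (\<phi> y \<bullet> cell_inc m u y))) \<partial>lborel)
       \<le> (\<integral>\<^sup>+y. ennreal (t / la powr p) * (ennreal (norm (cell_inc m f y) powr p) * indicator (dcell k a) y)
          + ennreal (t / t powr p) * (ennreal (norm (cell_inc m u y) powr p) * indicator (dcell k a) y) \<partial>lborel)"
    proof (intro nn_integral_mono)
      fix y
      have "ennreal \<bar>\<phi> y \<bullet> cell_inc m u y\<bar> \<le> ennreal (t / la powr p * norm (cell_inc m f y) powr p + t / t powr p * norm (cell_inc m u y) powr p)"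
        by (intro ennreal_leI) fact
      also have "\<dots> = ennreal (t / la powr p) * ennreal (norm (cell_inc m f y) powr p) + ennreal (t / t powr p) * ennreal (norm (cell_inc m u y) powr p)"
        using t la(1) by (subst ennreal_plus) (auto simp flip: ennreal_mult)
      finally show "ennreal (norm (indicator (dcell k a) y *\<^sub>R (\<phi> y \<bullet> cell_inc m u y)))
        \<le> ennreal (t / la powr p) * (ennreal (norm (cell_inc m f y) powr p) * indicator (dcell k a) y)
          + ennreal (t / t powr p) * (ennreal (norm (cell_inc m u y) powr p) * indicator (dcell k a) y)"
        by (simp split: split_indicator)
    qed
    also have "\<dots> = ennreal (t / la powr p) * ennreal (E f) + ennreal (t / t powr p) * ennreal (E u)"
      unfolding en(1)[OF f, symmetric] en(1)[OF u, symmetric]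
      by (simp add: nn_integral_add nn_integral_cmult)
    also have "\<dots> = ennreal (t + t * (E u / t powr p))"
      using t la Ef en(2)[OF u] by (simp flip: ennreal_mult ennreal_plus)
    also have "\<dots> \<le> ennreal (2 * t)"
    proof (intro ennreal_leI)
      have "t * (E u / t powr p) \<le> t * 1"
        using Et t by (intro mult_left_mono) auto
      then show "t + t * (E u / t powr p) \<le> 2 * t" by simp
    qed
    finally show ?thesis .
  qed
  have int: "set_integrable lborel (dcell k a) (\<lambda>y. \<phi> y \<bullet> cell_inc m u y)" if u: "u \<in> Wsp s p \<Omega>" for u :: "real ^ 'n \<Rightarrow> 'b"
    unfolding set_integrable_def
  proof (rule integrableI_bounded)
    have "0 < 1 + E u powr (1 / p)" by (rule add_pos_nonneg) auto
    from bound[OF u this] show "(\<integral>\<^sup>+y. ennreal (norm (indicator (dcell k a) y *\<^sub>R (\<phi> y \<bullet> cell_inc m u y))) \<partial>lborel) < \<infinity>"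
      by (rule le_less_trans) auto
  qed measurable
  show ?thesis
  proof (intro exI[of _ l] conjI ballI allI)
    fix u v :: "real ^ 'n \<Rightarrow> 'b" assume u: "u \<in> Wsp s p \<Omega>" and v: "v \<in> Wsp s p \<Omega>"
    have "l (\<lambda>x. u x + v x) = (LINT y:dcell k a|lborel. \<phi> y \<bullet> cell_inc m u y + \<phi> y \<bullet> cell_inc m v y)"
      unfolding l_def using cell_inc_add[OF \<Omega> u v p Q m]
      by (intro set_lebesgue_integral_cong) (auto simp: inner_add_right)
    also have "\<dots> = l u + l v"
      unfolding l_def by (intro set_integral_add int u v)
    finally show "l (\<lambda>x. u x + v x) = l u + l v" .
  next
    fix c and u :: "real ^ 'n \<Rightarrow> 'b"
    show "l (\<lambda>x. c *\<^sub>R u x) = c * l u"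
      unfolding l_def by (simp add: cell_inc_scaleR)
  next
    fix u :: "real ^ 'n \<Rightarrow> 'b" assume u: "u \<in> Wsp s p \<Omega>"
    have *: "\<bar>l u\<bar> \<le> 2 * t" if t: "t > 0" "E u powr (1 / p) \<le> t" for t
    proof -
      have "ennreal (norm (l u)) \<le> (\<integral>\<^sup>+y. ennreal (norm (indicator (dcell k a) y *\<^sub>R (\<phi> y \<bullet> cell_inc m u y))) \<partial>lborel)"
        unfolding l_def set_lebesgue_integral_def using int[OF u]
        by (intro integral_norm_bound_ennreal) (simp add: set_integrable_def)
      also have "\<dots> \<le> ennreal (2 * t)" by (rule bound[OF u t])
      finally show ?thesis using t by simp
    qed
    show "\<bar>l u\<bar> \<le> 2 * E u powr (1 / p)"
    proof (rule field_le_epsilon)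
      fix e :: real assume "0 < e"
      then show "\<bar>l u\<bar> \<le> 2 * E u powr (1 / p) + e"
        using *[of "E u powr (1 / p) + e / 2"] by (simp add: add_nonneg_pos)
    qed
  next
    have eq: "\<phi> y \<bullet> cell_inc m f y = la / la powr p * norm (cell_inc m f y) powr p" for y
    proof (cases "cell_inc m f y = 0")
      case False
      have "sgn (cell_inc m f y) \<bullet> cell_inc m f y = norm (cell_inc m f y)"
        using False by (simp add: sgn_div_norm power2_norm_eq_inner[symmetric] power2_eq_square)
      then show ?thesis
        using False la by (simp add: \<phi>_def powr_divide powr_diff)
    qed (use p in \<open>auto simp: \<phi>_def\<close>)
    have "l f = enn2real (\<integral>\<^sup>+y. ennreal (la / la powr p) * (ennreal (norm (cell_inc m f y) powr p) * indicator (dcell k a) y) \<partial>lborel)"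
      unfolding l_def set_lebesgue_integral_def eq
      using la(1) by (subst integral_eq_nn_integral)
        (auto intro!: arg_cong[where f=enn2real] nn_integral_cong split: split_indicator simp flip: ennreal_mult)
    also have "\<dots> = enn2real (ennreal (la / la powr p) * ennreal (E f))"
      unfolding en(1)[OF f, symmetric] by (subst nn_integral_cmult) auto
    also have "\<dots> = la"
      using la Ef by (simp flip: ennreal_mult)
    finally show "l f = E f powr (1 / p)" by (simp add: la_def)
  qed
qed

text \<open>The seminorms \<open>N\<^sub>m u = 2\<^sup>m\<^sup>s \<parallel>cell_inc m u\<parallel>\<close> in \<open>L\<^sup>p\<close> of the cell are dominated by the norm of \<open>W\<^sup>s\<^sup>,\<^sup>p\<close>
  uniformly in \<open>m\<close>, and each of them is normed by an explicit functional. Hence the uniform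
  boundedness principle applies to their supremum \<open>\<nu>\<close>: an absolutely convergent series of such
  functionals is in the dual, so it converges along the weakly convergent sequence.\<close>

lemma weak_conv_cell_inc_bounded:
  fixes f :: "nat \<Rightarrow> real ^ 'n \<Rightarrow> 'b :: euclidean_space"
  assumes \<Omega>: "open \<Omega>" and p: "1 < p" and s: "0 < s"
    and Q: "dcell k a \<subseteq> \<Omega>" and wc: "Wsp_weakly_converges s p \<Omega> f g"
  shows "\<exists>C\<ge>0. \<forall>j. \<forall>m\<ge>k. (\<integral>\<^sup>+y\<in>dcell k a. ennreal (norm (cell_inc m (f j) y) powr p) \<partial>lborel)
            \<le> ennreal (C * 2 powr (- (real m * s * p)))"
proof -
  define N where "N m u = 2 powr (real m * s) * cell_inc_energy p (dcell k a) m u powr (1 / p)"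
    for m and u :: "real ^ 'n \<Rightarrow> 'b"
  define \<nu> where "\<nu> u = (SUP m\<in>{k..}. N m u)" for u
  define c where "c = (2 * 2 powr p * approx_const TYPE('n) s p) powr (1 / p)"
  have fW: "f j \<in> Wsp s p \<Omega>" for j using wc by (simp add: Wsp_weakly_converges_def)
  have N_le: "N m u \<le> c * Wsp_norm s p \<Omega> u" if "u \<in> Wsp s p \<Omega>" "k \<le> m" for m u
    unfolding N_def c_def by (rule cell_inc_energy(2)[OF \<Omega> that(1) p s Q that(2)])
  have N_nn: "0 \<le> N m u" for m u by (simp add: N_def)
  have bdd: "bdd_above ((\<lambda>m. N m u) ` {k..})" if "u \<in> Wsp s p \<Omega>" for u
    using N_le[OF that] by (auto simp: bdd_above_def)
  have N_\<nu>: "N m u \<le> \<nu> u" if "u \<in> Wsp s p \<Omega>" "k \<le> m" for m u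
    unfolding \<nu>_def using that bdd by (intro cSUP_upper) auto
  have \<nu>_nn: "0 \<le> \<nu> u" if "u \<in> Wsp s p \<Omega>" for u
    using N_\<nu>[OF that, of k] N_nn[of k u] by linarith
  have \<nu>_le: "\<nu> u \<le> c * Wsp_norm s p \<Omega> u" if "u \<in> Wsp s p \<Omega>" for u
    unfolding \<nu>_def using N_le[OF that] by (intro cSUP_least) auto
  define F where "F = {l. (\<forall>u\<in>Wsp s p \<Omega>. \<forall>v\<in>Wsp s p \<Omega>. l (\<lambda>x. u x + v x) = l u + l v) \<and>
     (\<forall>c. \<forall>u\<in>Wsp s p \<Omega>. l (\<lambda>x. c *\<^sub>R u x) = c * l u) \<and> (\<forall>u\<in>Wsp s p \<Omega>. \<bar>l u\<bar> \<le> 2 * \<nu> u)}"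
  have "\<exists>C. \<forall>j. \<nu> (f j) \<le> C"
  proof (rule uniform_boundedness_seq[where S="Wsp s p \<Omega>" and F=F])
    show "\<exists>l\<in>F. \<nu> (f j) \<le> 2 * l (f j)" for j
    proof -
      obtain m where m: "k \<le> m" "\<nu> (f j) \<le> 2 * N m (f j)"
      proof (cases "\<nu> (f j) = 0")
        case True
        then show ?thesis using that[of k] N_nn[of k] by simp
      next
        case False
        then have "\<nu> (f j) / 2 < \<nu> (f j)" using \<nu>_nn[OF fW, of j] by simp
        have "\<exists>m\<ge>k. \<nu> (f j) / 2 < N m (f j)"
        proof (rule ccontr)
          assume "\<not> ?thesis"
          then have "\<And>m. m \<in> {k..} \<Longrightarrow> N m (f j) \<le> \<nu> (f j) / 2" by (meson atLeast_iff linorder_not_less)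
          then have "(SUP m\<in>{k..}. N m (f j)) \<le> \<nu> (f j) / 2" by (intro cSUP_least) auto
          then show False using \<open>\<nu> (f j) / 2 < \<nu> (f j)\<close> unfolding \<nu>_def by linarith
        qed
        then obtain m where "k \<le> m" "\<nu> (f j) / 2 < N m (f j)" by blast
        then show ?thesis using that[of m] by simp
      qed
      from cell_inc_norming[OF \<Omega> fW p s Q m(1), of j] obtain l where l:
        "\<forall>u\<in>Wsp s p \<Omega>. \<forall>v\<in>Wsp s p \<Omega>. l (\<lambda>x. u x + v x) = l u + l v"
        "\<forall>c. \<forall>u\<in>Wsp s p \<Omega>. l (\<lambda>x. c *\<^sub>R u x) = c * l u"
        "\<forall>u\<in>Wsp s p \<Omega>. \<bar>l u\<bar> \<le> 2 * cell_inc_energy p (dcell k a) m u powr (1 / p)"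
        "l (f j) = cell_inc_energy p (dcell k a) m (f j) powr (1 / p)"
        by (elim exE conjE)
      define l' where "l' u = 2 powr (real m * s) * l u" for u
      have "l' \<in> F"
        unfolding F_def
      proof (intro CollectI conjI ballI allI)
        fix u v :: "real ^ 'n \<Rightarrow> 'b" assume u: "u \<in> Wsp s p \<Omega>" and v: "v \<in> Wsp s p \<Omega>"
        show "l' (\<lambda>x. u x + v x) = l' u + l' v"
          unfolding l'_def bspec[OF bspec[OF l(1) u] v] by (rule distrib_left)
      next
        fix c and u :: "real ^ 'n \<Rightarrow> 'b" assume u: "u \<in> Wsp s p \<Omega>"
        show "l' (\<lambda>x. c *\<^sub>R u x) = c * l' u"
          unfolding l'_def bspec[OF spec[OF l(2)] u] by (rule mult.left_commute)
      next
        fix u :: "real ^ 'n \<Rightarrow> 'b" assume u: "u \<in> Wsp s p \<Omega>"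
        have "\<bar>l' u\<bar> \<le> 2 powr (real m * s) * (2 * cell_inc_energy p (dcell k a) m u powr (1 / p))"
          unfolding l'_def using bspec[OF l(3) u] by (simp add: abs_mult)
        also have "\<dots> = 2 * N m u" by (simp add: N_def)
        also have "\<dots> \<le> 2 * \<nu> u" using N_\<nu>[OF u m(1)] by simp
        finally show "\<bar>l' u\<bar> \<le> 2 * \<nu> u" .
      qed
      moreover have "\<nu> (f j) \<le> 2 * l' (f j)"
        using m(2) unfolding l'_def l(4) N_def .
      ultimately show ?thesis by blast
    qed
    show "Bseq (\<lambda>j. \<Sum>i. a i * l i (f j))" if l: "\<And>i. l i \<in> F" and a: "\<And>i. \<bar>a i\<bar> \<le> (1 / 10) ^ i" for a l
    proof -
      have sm: "summable (\<lambda>i. a i * l i u)" and Lb: "\<bar>\<Sum>i. a i * l i u\<bar> \<le> 20 / 9 * \<nu> u" if u: "u \<in> Wsp s p \<Omega>" for u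
      proof -
        have t: "\<bar>a i * l i u\<bar> \<le> 2 * \<nu> u * (1 / 10) ^ i" for i
        proof -
          have "\<bar>a i\<bar> * \<bar>l i u\<bar> \<le> (1 / 10) ^ i * (2 * \<nu> u)"
            using a l[of i] u by (intro mult_mono) (auto simp: F_def)
          then show ?thesis by (simp add: abs_mult mult_ac)
        qed
        have g: "summable (\<lambda>i. 2 * \<nu> u * (1 / 10) ^ i)" by (intro summable_mult summable_geometric) simp
        have sa: "summable (\<lambda>i. \<bar>a i * l i u\<bar>)"
          by (rule summable_comparison_test'[OF g, of 0]) (use t in auto)
        then show "summable (\<lambda>i. a i * l i u)" by (rule summable_rabs_cancel)
        have "\<bar>\<Sum>i. a i * l i u\<bar> \<le> (\<Sum>i. \<bar>a i * l i u\<bar>)" by (rule summable_rabs[OF sa])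
        also have "\<dots> \<le> (\<Sum>i. 2 * \<nu> u * (1 / 10) ^ i)" by (intro suminf_le t sa g)
        also have "\<dots> = 20 / 9 * \<nu> u" by (subst suminf_mult) (auto simp: summable_geometric suminf_geometric)
        finally show "\<bar>\<Sum>i. a i * l i u\<bar> \<le> 20 / 9 * \<nu> u" .
      qed
      have "(\<lambda>u. \<Sum>i. a i * l i u) \<in> Wsp_dual s p \<Omega>"
        unfolding Wsp_dual_def
      proof (intro CollectI conjI ballI allI exI)
        fix u v :: "real ^ 'n \<Rightarrow> 'b" assume u: "u \<in> Wsp s p \<Omega>" and v: "v \<in> Wsp s p \<Omega>"
        have "l i (\<lambda>x. u x + v x) = l i u + l i v" for i
          using l[of i] u v unfolding F_def by blast
        then have "(\<Sum>i. a i * l i (\<lambda>x. u x + v x)) = (\<Sum>i. a i * l i u + a i * l i v)"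
          by (simp only: distrib_left)
        also have "\<dots> = (\<Sum>i. a i * l i u) + (\<Sum>i. a i * l i v)"
          by (rule suminf_add[symmetric]) (use sm u v in auto)
        finally show "(\<Sum>i. a i * l i (\<lambda>x. u x + v x)) = (\<Sum>i. a i * l i u) + (\<Sum>i. a i * l i v)" .
      next
        fix r and u :: "real ^ 'n \<Rightarrow> 'b" assume u: "u \<in> Wsp s p \<Omega>"
        have "l i (\<lambda>x. r *\<^sub>R u x) = r * l i u" for i
          using l[of i] u unfolding F_def by blast
        then have "(\<Sum>i. a i * l i (\<lambda>x. r *\<^sub>R u x)) = (\<Sum>i. r * (a i * l i u))"
          by (simp only: mult.left_commute)
        also have "\<dots> = r * (\<Sum>i. a i * l i u)"
          by (rule suminf_mult[OF sm[OF u]])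
        finally show "(\<Sum>i. a i * l i (\<lambda>x. r *\<^sub>R u x)) = r * (\<Sum>i. a i * l i u)" .
      next
        fix u :: "real ^ 'n \<Rightarrow> 'b" assume u: "u \<in> Wsp s p \<Omega>"
        show "\<bar>\<Sum>i. a i * l i u\<bar> \<le> 20 / 9 * c * Wsp_norm s p \<Omega> u"
          using Lb[OF u] \<nu>_le[OF u] by simp
      qed
      then have "convergent (\<lambda>j. \<Sum>i. a i * l i (f j))"
        using wc by (auto simp: Wsp_weakly_converges_def convergent_def)
      then show ?thesis by (rule convergent_imp_Bseq)
    qed
  qed (auto simp: fW F_def)
  then obtain C where C: "\<And>j. \<nu> (f j) \<le> C" by blast
  have C0: "0 \<le> C" using C[of 0] \<nu>_nn[OF fW, of 0] by linarith
  have "(\<integral>\<^sup>+y\<in>dcell k a. ennreal (norm (cell_inc m (f j) y) powr p) \<partial>lborel)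
            \<le> ennreal (C powr p * 2 powr (- (real m * s * p)))" if m: "k \<le> m" for j m
  proof -
    let ?E = "cell_inc_energy p (dcell k a) m (f j)"
    have E0: "0 \<le> ?E" by (simp add: cell_inc_energy_def)
    have "N m (f j) \<le> C" using N_\<nu>[OF fW m, of j] C[of j] by linarith
    then have "(2 powr (real m * s) * ?E powr (1 / p)) powr p \<le> C powr p"
      unfolding N_def using p by (intro powr_mono2) auto
    then have "2 powr (real m * s * p) * ?E \<le> C powr p"
      using p E0 by (simp add: powr_mult powr_powr)
    then have "?E \<le> C powr p * 2 powr (- (real m * s * p))"
      by (simp add: powr_minus field_simps)
    then show ?thesis
      unfolding cell_inc_energy(1)[OF \<Omega> fW p s Q m] by (rule ennreal_leI)
  qed
  then show ?thesis by (intro exI[of _ "C powr p"]) auto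
qed

section \<open>Energy on slices\<close>

text \<open>In the application \<open>h m\<close> is constant on cells of level \<open>m + 1\<close>. The factor \<open>2 ^ (Suc m * n)\<close> is the
  inverse measure of such a cell, so that integration over the cell recovers the value of
  \<open>h m powr p\<close>. The factor \<open>2 powr (m * \<tau>)\<close> is the decay that a finite energy forces on these values.\<close>

definition slice_density ::
  "'n \<Rightarrow> real \<Rightarrow> real \<Rightarrow> (nat \<Rightarrow> real ^ 'n \<Rightarrow> real) \<Rightarrow> real ^ 'n \<Rightarrow> real ^ 'n \<Rightarrow> ennreal" where
  "slice_density i \<tau> p h x y = (\<Sum>m. ennreal (2 powr (real m * \<tau>) * 2 ^ (Suc m * CARD('n)))
      * (ennreal (h m y powr p) * indicator (layer i (Suc m) x) y))"

definition slice_energy ::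
  "'n \<Rightarrow> real \<Rightarrow> real \<Rightarrow> (nat \<Rightarrow> real ^ 'n \<Rightarrow> real) \<Rightarrow> (real ^ 'n) set \<Rightarrow> real ^ 'n \<Rightarrow> ennreal" where
  "slice_energy i \<tau> p h R x = (\<integral>\<^sup>+y\<in>R. slice_density i \<tau> p h x y \<partial>lborel)"

lemma measurable_layer_pair [measurable]:
  "(\<lambda>z. indicator (layer i m (fst z)) (snd z) :: ennreal) \<in> borel_measurable (lborel \<Otimes>\<^sub>M lborel)"
proof -
  have [measurable]: "(\<lambda>z. (snd z :: real ^ 'a) $ i) \<in> borel_measurable (lborel \<Otimes>\<^sub>M lborel :: ((real ^ 'a) \<times> (real ^ 'a)) measure)"
    "(\<lambda>z. (fst z :: real ^ 'a) $ i) \<in> borel_measurable (lborel \<Otimes>\<^sub>M lborel :: ((real ^ 'a) \<times> (real ^ 'a)) measure)"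
    by (rule measurable_compose[OF measurable_snd] measurable_compose[OF measurable_fst], simp)+
  have "(\<lambda>z. if \<lfloor>2 ^ m * (snd z :: real ^ 'a) $ i\<rfloor> = \<lfloor>2 ^ m * (fst z :: real ^ 'a) $ i\<rfloor> then 1 else 0 :: ennreal)
      \<in> borel_measurable (lborel \<Otimes>\<^sub>M lborel)"
    by measurable
  moreover have "(\<lambda>z. if \<lfloor>2 ^ m * (snd z :: real ^ 'a) $ i\<rfloor> = \<lfloor>2 ^ m * (fst z :: real ^ 'a) $ i\<rfloor> then 1 else 0 :: ennreal)
     = (\<lambda>z. indicator (layer i m (fst z)) (snd z))"
    by (auto simp: layer_def indicator_def)
  ultimately show ?thesis by simp
qed

lemma measurable_slice_density [measurable]:
  assumes [measurable]: "\<And>m. h m \<in> borel_measurable borel"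
  shows "(\<lambda>z. slice_density i \<tau> p h (fst z) (snd z)) \<in> borel_measurable (lborel \<Otimes>\<^sub>M lborel)"
    "slice_density i \<tau> p h x \<in> borel_measurable borel"
proof -
  show 1: "(\<lambda>z. slice_density i \<tau> p h (fst z) (snd z)) \<in> borel_measurable (lborel \<Otimes>\<^sub>M lborel)"
    unfolding slice_density_def by measurable
  show "slice_density i \<tau> p h x \<in> borel_measurable borel"
    unfolding slice_density_def by measurable
qed

lemma slice_energy_ge:
  fixes y :: "real ^ 'n"
  assumes h [measurable]: "\<And>m. h m \<in> borel_measurable borel"
    and const: "\<And>z. z \<in> dcell (Suc m) y \<Longrightarrow> h m z = h m y"
    and y: "y \<in> layer i (Suc m) x" and R: "dcell (Suc m) y \<subseteq> R"
  shows "ennreal (2 powr (real m * \<tau>) * h m y powr p) \<le> slice_energy i \<tau> p h R x"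
proof -
  let ?c = "2 powr (real m * \<tau>) * 2 ^ (Suc m * CARD('n))"
  have lay: "dcell (Suc m) y \<subseteq> layer i (Suc m) x"
    using dcell_subset_layer[of "Suc m" y i] y by (auto simp: layer_def)
  have "ennreal (2 powr (real m * \<tau>) * h m y powr p)
      = ennreal (?c * h m y powr p) * ennreal (1 / 2 ^ (Suc m * CARD('n)))"
    by (simp flip: ennreal_mult)
  also have "\<dots> = (\<integral>\<^sup>+z. ennreal (?c * h m y powr p) * indicator (dcell (Suc m) y) z \<partial>lborel)"
    by (subst nn_integral_cmult_indicator) (auto simp: emeasure_dcell)
  also have "\<dots> \<le> slice_energy i \<tau> p h R x"
    unfolding slice_energy_def
  proof (intro nn_integral_mono)
    fix z
    show "ennreal (?c * h m y powr p) * indicator (dcell (Suc m) y) z \<le> slice_density i \<tau> p h x z * indicator R z"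
    proof (cases "z \<in> dcell (Suc m) y")
      case True
      have "(\<Sum>j\<in>{m}. ennreal (2 powr (real j * \<tau>) * 2 ^ (Suc j * CARD('n)))
          * (ennreal (h j z powr p) * indicator (layer i (Suc j) x) z)) \<le> slice_density i \<tau> p h x z"
        unfolding slice_density_def by (rule sum_le_suminf) auto
      then have "ennreal ?c * (ennreal (h m z powr p) * indicator (layer i (Suc m) x) z) \<le> slice_density i \<tau> p h x z"
        by simp
      moreover have "z \<in> layer i (Suc m) x" "z \<in> R" using True lay R by auto
      ultimately show ?thesis using True const[OF True] by (simp add: ennreal_mult)
    qed simp
  qed
  finally show ?thesis .
qed

lemma measurable_slice_energy:
  assumes [measurable]: "\<And>m. h m \<in> borel_measurable borel" "R \<in> sets borel"
  shows "slice_energy i \<tau> p h R \<in> borel_measurable lborel"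
proof -
  have "(\<lambda>z. slice_density i \<tau> p h (fst z) (snd z) * indicator R (snd z)) \<in> borel_measurable (lborel \<Otimes>\<^sub>M lborel)"
    by measurable
  from lborel.borel_measurable_nn_integral_fst[OF this]
  show ?thesis unfolding slice_energy_def[abs_def] by simp
qed

text \<open>By Tonelli the integration over \<open>x\<close> comes first. It runs over a slab of thickness \<open>2\<^sup>-\<^sup>m\<^sup>-\<^sup>1\<close>, which
  reduces the weight \<open>2 ^ (Suc m * n)\<close> to \<open>2 ^ (Suc m * (n - 1))\<close>: restriction to a slice costs the
  \<open>n - 1\<close> dimensions of the slice.\<close>

lemma slice_energy_integral:
  assumes h [measurable]: "\<And>m. h m \<in> borel_measurable borel"
  shows "(\<integral>\<^sup>+x\<in>dcell k a. slice_energy i \<tau> p h (dcell k (a :: real ^ 'n)) x \<partial>lborel)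
    \<le> (\<Sum>m. ennreal (2 powr (real m * \<tau>) * 2 ^ (Suc m * (CARD('n) - 1)))
         * (\<integral>\<^sup>+y\<in>dcell k a. ennreal (h m y powr p) \<partial>lborel))"
proof -
  let ?Q = "dcell k a"
  let ?c = "\<lambda>m. 2 powr (real m * \<tau>) * 2 ^ (Suc m * CARD('n))"
  have "(\<integral>\<^sup>+x\<in>?Q. slice_energy i \<tau> p h ?Q x \<partial>lborel)
     = (\<integral>\<^sup>+x. (\<integral>\<^sup>+y. slice_density i \<tau> p h x y * indicator ?Q y * indicator ?Q x \<partial>lborel) \<partial>lborel)"
    unfolding slice_energy_def by (intro nn_integral_cong nn_integral_multc[symmetric]) measurable
  also have "\<dots> = (\<integral>\<^sup>+y. (\<integral>\<^sup>+x. slice_density i \<tau> p h x y * indicator ?Q y * indicator ?Q x \<partial>lborel) \<partial>lborel)"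
  proof -
    have "(\<lambda>z. slice_density i \<tau> p h (fst z) (snd z) * indicator ?Q (snd z) * indicator ?Q (fst z))
        \<in> borel_measurable (lborel \<Otimes>\<^sub>M lborel)"
      by measurable
    then have "(\<lambda>(x, y). slice_density i \<tau> p h x y * indicator ?Q y * indicator ?Q x)
        \<in> borel_measurable (lborel \<Otimes>\<^sub>M lborel)"
      by (simp add: case_prod_beta')
    from lborel_pair.Fubini'[OF this] show ?thesis by simp
  qed
  also have "\<dots> \<le> (\<integral>\<^sup>+y. (\<Sum>m. ennreal (?c m / 2 ^ Suc m) * (ennreal (h m y powr p) * indicator ?Q y)) \<partial>lborel)"
  proof (intro nn_integral_mono)
    fix y :: "real ^ 'n"
    have "(\<integral>\<^sup>+x. slice_density i \<tau> p h x y * indicator ?Q y * indicator ?Q x \<partial>lborel)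
       = (\<integral>\<^sup>+x. (\<Sum>m. ennreal (?c m) * (ennreal (h m y powr p) * indicator ?Q y) * indicator (?Q \<inter> layer i (Suc m) y) x) \<partial>lborel)"
    proof (intro nn_integral_cong)
      fix x :: "real ^ 'n"
      have "slice_density i \<tau> p h x y * indicator ?Q y * indicator ?Q x
          = (\<Sum>m. ennreal (?c m) * (ennreal (h m y powr p) * indicator (layer i (Suc m) x) y) * indicator ?Q y * indicator ?Q x)"
        unfolding slice_density_def by (simp only: ennreal_suminf_multc)
      also have "\<dots> = (\<Sum>m. ennreal (?c m) * (ennreal (h m y powr p) * indicator ?Q y) * indicator (?Q \<inter> layer i (Suc m) y) x)"
        using mem_layer_sym[of y i _ x] by (intro suminf_cong) (auto simp: indicator_def)
      finally show "slice_density i \<tau> p h x y * indicator ?Q y * indicator ?Q x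
          = (\<Sum>m. ennreal (?c m) * (ennreal (h m y powr p) * indicator ?Q y) * indicator (?Q \<inter> layer i (Suc m) y) x)" .
    qed
    also have "\<dots> = (\<Sum>m. \<integral>\<^sup>+x. ennreal (?c m) * (ennreal (h m y powr p) * indicator ?Q y) * indicator (?Q \<inter> layer i (Suc m) y) x \<partial>lborel)"
      by (intro nn_integral_suminf) measurable
    also have "\<dots> = (\<Sum>m. ennreal (?c m) * (ennreal (h m y powr p) * indicator ?Q y) * emeasure lborel (?Q \<inter> layer i (Suc m) y))"
      by (intro suminf_cong nn_integral_cmult_indicator) measurable
    also have "\<dots> \<le> (\<Sum>m. ennreal (?c m) * (ennreal (h m y powr p) * indicator ?Q y) * ennreal (1 / 2 ^ Suc m))"
      by (intro suminf_le mult_left_mono emeasure_slab_le) auto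
    also have "\<dots> = (\<Sum>m. ennreal (?c m / 2 ^ Suc m) * (ennreal (h m y powr p) * indicator ?Q y))"
    proof (intro suminf_cong)
      fix m
      have "ennreal (?c m / 2 ^ Suc m) = ennreal (?c m) * ennreal (1 / 2 ^ Suc m)"
        by (subst ennreal_mult[symmetric]) auto
      then show "ennreal (?c m) * (ennreal (h m y powr p) * indicator ?Q y) * ennreal (1 / 2 ^ Suc m)
         = ennreal (?c m / 2 ^ Suc m) * (ennreal (h m y powr p) * indicator ?Q y)"
        by (simp only: mult_ac)
    qed
    finally show "(\<integral>\<^sup>+x. slice_density i \<tau> p h x y * indicator ?Q y * indicator ?Q x \<partial>lborel)
       \<le> (\<Sum>m. ennreal (?c m / 2 ^ Suc m) * (ennreal (h m y powr p) * indicator ?Q y))" .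
  qed
  also have "\<dots> = (\<Sum>m. \<integral>\<^sup>+y. ennreal (?c m / 2 ^ Suc m) * (ennreal (h m y powr p) * indicator ?Q y) \<partial>lborel)"
    by (intro nn_integral_suminf) measurable
  also have "\<dots> = (\<Sum>m. ennreal (?c m / 2 ^ Suc m) * (\<integral>\<^sup>+y\<in>?Q. ennreal (h m y powr p) \<partial>lborel))"
    by (intro suminf_cong nn_integral_cmult) measurable
  also have "(\<lambda>m. ?c m / 2 ^ Suc m) = (\<lambda>m. 2 powr (real m * \<tau>) * 2 ^ (Suc m * (CARD('n) - 1)))"
  proof
    fix m
    have "Suc m * CARD('n) = Suc m * (CARD('n) - 1) + Suc m"
      by (metis One_nat_def Suc_pred mult_Suc_right add.commute zero_less_card_finite)
    then have "(2::real) ^ (Suc m * CARD('n)) = 2 ^ (Suc m * (CARD('n) - 1)) * 2 ^ Suc m"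
      by (simp only: power_add)
    then show "?c m / 2 ^ Suc m = 2 powr (real m * \<tau>) * 2 ^ (Suc m * (CARD('n) - 1))"
      by (simp del: mult_Suc power_Suc)
  qed
  finally show ?thesis .
qed

lemma geometric_limit:
  fixes a :: "nat \<Rightarrow> 'b :: banach"
  assumes a: "\<And>m. k \<le> m \<Longrightarrow> norm (a (Suc m) - a m) \<le> B * r ^ m" and r: "0 < r" "r < 1"
  shows "convergent a" "norm (lim a - a k) \<le> B * r ^ k / (1 - r)"
proof -
  define d where "d j = a (Suc (j + k)) - a (j + k)" for j
  have d: "norm (d j) \<le> B * r ^ k * r ^ j" for j
    using a[of "j + k"] by (simp add: d_def power_add mult_ac)
  have g: "summable (\<lambda>j. B * r ^ k * r ^ j)"
    using r by (intro summable_mult summable_geometric) auto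
  have sn: "summable (\<lambda>j. norm (d j))"
    by (rule summable_comparison_test'[OF g, of 0]) (use d in auto)
  have sd: "summable d" using sn by (rule summable_norm_cancel)
  have "(\<Sum>j<m. d j) = a (m + k) - a k" for m
    by (induction m) (simp_all add: d_def)
  then have "(\<lambda>m. a (m + k) - a k) \<longlonglongrightarrow> suminf d"
    using summable_LIMSEQ[OF sd] by (simp only:)
  then have "(\<lambda>m. (a (m + k) - a k) + a k) \<longlonglongrightarrow> suminf d + a k"
    by (intro tendsto_add tendsto_const)
  then have "(\<lambda>m. a (m + k)) \<longlonglongrightarrow> suminf d + a k" by simp
  then have *: "a \<longlonglongrightarrow> suminf d + a k" by (rule LIMSEQ_offset)
  then show "convergent a" by (auto simp: convergent_def)
  have "norm (suminf d) \<le> (\<Sum>j. norm (d j))" by (rule summable_norm[OF sn])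
  also have "\<dots> \<le> (\<Sum>j. B * r ^ k * r ^ j)" by (intro suminf_le d sn g)
  also have "\<dots> = B * r ^ k / (1 - r)"
    using r by (subst suminf_mult) (auto simp: summable_geometric suminf_geometric)
  finally show "norm (lim a - a k) \<le> B * r ^ k / (1 - r)"
    using limI[OF *] by simp
qed

text \<open>Morrey's inequality on a slice: a finite energy makes the increments decay like
  \<open>2 powr (- (m * \<tau> / p))\<close>, so they sum to a quantity comparable to the first one. The energy may be
  taken over the cell of \<open>y\<close> alone, which gives the bound its local form.\<close>

lemma slice_limit:
  fixes y :: "real ^ 'n" and a :: "nat \<Rightarrow> real ^ 'n \<Rightarrow> 'b :: banach"
  assumes h: "\<And>m. h m \<in> borel_measurable borel" "\<And>m y. 0 \<le> h m y"
    and const: "\<And>m y z. z \<in> dcell (Suc m) y \<Longrightarrow> h m z = h m y"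
    and inc: "\<And>m. k \<le> m \<Longrightarrow> norm (a (Suc m) y - a m y) \<le> h m y"
    and y: "y $ i = x $ i" and R: "dcell k y \<subseteq> R"
    and v: "slice_energy i \<tau> p h R x \<le> ennreal v" "0 \<le> v" and p: "0 < p" "0 < \<tau>"
  shows "convergent (\<lambda>m. a m y)"
    "norm (lim (\<lambda>m. a m y) - a k y) \<le> 1 / (1 - 2 powr (- (\<tau> / p))) * 2 powr (- (real k * \<tau> / p)) * v powr (1 / p)"
proof -
  let ?r = "2 powr (- (\<tau> / p))"
  have r: "0 < ?r" "?r < 1" using p by (auto simp: powr_less_one)
  have rm: "?r ^ m = 2 powr (- (real m * \<tau> / p))" for m
    by (simp add: powr_powr mult_ac flip: powr_realpow)
  have b: "norm (a (Suc m) y - a m y) \<le> v powr (1 / p) * ?r ^ m" if m: "k \<le> m" for m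
  proof -
    have sub: "dcell (Suc m) y \<subseteq> R" using dcell_mono[of k "Suc m" y] m R by auto
    have lay: "y \<in> layer i (Suc m) x" using y by (simp add: layer_def)
    have "ennreal (2 powr (real m * \<tau>) * h m y powr p) \<le> slice_energy i \<tau> p h R x"
      by (rule slice_energy_ge[OF h(1) const lay sub])
    then have "ennreal (2 powr (real m * \<tau>) * h m y powr p) \<le> ennreal v"
      using v(1) by (rule order_trans)
    then have "2 powr (real m * \<tau>) * h m y powr p \<le> v" using v by simp
    then have "h m y powr p \<le> v * 2 powr (- (real m * \<tau>))"
      by (simp add: powr_minus field_simps)
    then have "(h m y powr p) powr (1 / p) \<le> (v * 2 powr (- (real m * \<tau>))) powr (1 / p)"
      using p by (intro powr_mono2) auto
    then have "h m y \<le> v powr (1 / p) * 2 powr (- (real m * \<tau> / p))"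
      using p h(2)[of m y] v by (simp add: powr_powr powr_mult)
    then show ?thesis using inc[OF m] by (simp add: rm)
  qed
  show "convergent (\<lambda>m. a m y)"
    by (rule geometric_limit(1)[of k "\<lambda>m. a m y", OF b r])
  have "norm (lim (\<lambda>m. a m y) - a k y) \<le> v powr (1 / p) * ?r ^ k / (1 - ?r)"
    by (rule geometric_limit(2)[of k "\<lambda>m. a m y", OF b r])
  also have "v powr (1 / p) * ?r ^ k / (1 - ?r) = 1 / (1 - ?r) * ?r ^ k * v powr (1 / p)"
    by (simp add: divide_inverse)
  finally show "norm (lim (\<lambda>m. a m y) - a k y) \<le> 1 / (1 - ?r) * 2 powr (- (real k * \<tau> / p)) * v powr (1 / p)"
    unfolding rm .
qed

section \<open>Sets of zero Hausdorff measure\<close>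

lemma hausdorff_measure_eq_0I:
  assumes "\<And>\<delta> \<epsilon>. 0 < \<delta> \<Longrightarrow> 0 < \<epsilon> \<Longrightarrow> \<exists>U :: nat \<Rightarrow> 'a :: metric_space set. A \<subseteq> (\<Union>i. U i) \<and>
      (\<forall>i. bounded (U i) \<and> diameter (U i) \<le> \<delta>) \<and> (\<Sum>i. ennreal (diam_pow d (U i))) \<le> ennreal \<epsilon>"
  shows "hausdorff_measure d A = 0"
proof -
  have "hausdorff_premeasure d \<delta> A \<le> 0" if \<delta>: "0 < \<delta>" for \<delta>
  proof (rule ennreal_le_epsilon)
    fix e :: real assume "0 < e"
    then obtain U :: "nat \<Rightarrow> 'a set" where U: "A \<subseteq> (\<Union>i. U i)" "\<forall>i. bounded (U i) \<and> diameter (U i) \<le> \<delta>"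
      "(\<Sum>i. ennreal (diam_pow d (U i))) \<le> ennreal e"
      using assms[OF \<delta>] by blast
    then have "hausdorff_premeasure d \<delta> A \<le> (\<Sum>i. ennreal (diam_pow d (U i)))"
      unfolding hausdorff_premeasure_def by (intro Inf_lower) blast
    then show "hausdorff_premeasure d \<delta> A \<le> 0 + ennreal e" using U(3) by simp
  qed
  then show ?thesis
    unfolding hausdorff_measure_def by (auto simp: SUP_eq_iff le_zero_eq intro!: antisym SUP_least)
qed

lemma hausdorff_measure_eq_0D:
  fixes A :: "'a :: metric_space set"
  assumes "hausdorff_measure d A = 0" "0 < \<delta>" "0 < \<epsilon>"
  shows "\<exists>U :: nat \<Rightarrow> 'a set. A \<subseteq> (\<Union>i. U i) \<and>
      (\<forall>i. bounded (U i) \<and> diameter (U i) \<le> \<delta>) \<and> (\<Sum>i. ennreal (diam_pow d (U i))) < ennreal \<epsilon>"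
proof -
  have "hausdorff_premeasure d \<delta> A \<le> hausdorff_measure d A"
    unfolding hausdorff_measure_def using assms(2) by (intro SUP_upper) auto
  then have "hausdorff_premeasure d \<delta> A < ennreal \<epsilon>"
    using assms by simp
  then show ?thesis
    unfolding hausdorff_premeasure_def Inf_less_iff by blast
qed

lemma hausdorff_measure_countable_UN:
  fixes A :: "nat \<Rightarrow> 'a :: metric_space set"
  assumes "\<And>l. hausdorff_measure d (A l) = 0"
  shows "hausdorff_measure d (\<Union>l. A l) = 0"
proof (rule hausdorff_measure_eq_0I)
  fix \<delta> \<epsilon> :: real assume \<delta>: "0 < \<delta>" and \<epsilon>: "0 < \<epsilon>"
  have "\<forall>l. \<exists>U :: nat \<Rightarrow> 'a set. A l \<subseteq> (\<Union>i. U i) \<and>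
      (\<forall>i. bounded (U i) \<and> diameter (U i) \<le> \<delta>) \<and> (\<Sum>i. ennreal (diam_pow d (U i))) < ennreal (\<epsilon> * (1 / 2) ^ Suc l)"
    using hausdorff_measure_eq_0D[OF assms \<delta>] \<epsilon> by simp
  from choice[OF this] obtain U :: "nat \<Rightarrow> nat \<Rightarrow> 'a set" where U: "\<And>l. A l \<subseteq> (\<Union>i. U l i)"
    "\<And>l i. bounded (U l i)" "\<And>l i. diameter (U l i) \<le> \<delta>"
    "\<And>l. (\<Sum>i. ennreal (diam_pow d (U l i))) < ennreal (\<epsilon> * (1 / 2) ^ Suc l)" by blast
  define V where "V j = (case prod_decode j of (l, i) \<Rightarrow> U l i)" for j
  show "\<exists>V :: nat \<Rightarrow> 'a set. (\<Union>l. A l) \<subseteq> (\<Union>i. V i) \<and>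
      (\<forall>i. bounded (V i) \<and> diameter (V i) \<le> \<delta>) \<and> (\<Sum>i. ennreal (diam_pow d (V i))) \<le> ennreal \<epsilon>"
  proof (intro exI[of _ V] conjI allI)
    show "(\<Union>l. A l) \<subseteq> (\<Union>i. V i)"
    proof safe
      fix z l assume "z \<in> A l"
      then obtain i where "z \<in> U l i" using U(1) by blast
      then have "z \<in> V (prod_encode (l, i))" by (simp add: V_def)
      then show "z \<in> (\<Union>i. V i)" by blast
    qed
    show "bounded (V i)" "diameter (V i) \<le> \<delta>" for i
      by (auto simp: V_def U split: prod.split)
    have "(\<Sum>j. ennreal (diam_pow d (V j))) = (\<Sum>j. (\<lambda>(l, i). ennreal (diam_pow d (U l i))) (prod_decode j))"
      by (intro suminf_cong) (auto simp: V_def split: prod.split)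
    also have "\<dots> = (\<Sum>l. \<Sum>i. ennreal (diam_pow d (U l i)))"
      by (rule suminf_ennreal_2dimen) simp
    also have "\<dots> \<le> (\<Sum>l. ennreal (\<epsilon> * (1 / 2) ^ Suc l))"
      using U(4) by (intro suminf_le less_imp_le) auto
    also have "\<dots> = ennreal \<epsilon>"
      using \<epsilon> sums_mult[OF power_half_series, of \<epsilon>] by (intro suminf_ennreal_eq) auto
    finally show "(\<Sum>i. ennreal (diam_pow d (V i))) \<le> ennreal \<epsilon>" .
  qed
qed

lemma hausdorff_measure_countable_Union:
  assumes "countable \<A>" "\<And>A. A \<in> \<A> \<Longrightarrow> hausdorff_measure d A = 0" "\<A> \<noteq> {}"
  shows "hausdorff_measure d (\<Union>\<A>) = 0"
proof -
  have "\<Union>\<A> = (\<Union>l. from_nat_into \<A> l)"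
    using range_from_nat_into[OF assms(3,1)] by simp
  moreover have "hausdorff_measure d (from_nat_into \<A> l) = 0" for l
    using from_nat_into[OF assms(3)] assms(2) by blast
  ultimately show ?thesis using hausdorff_measure_countable_UN[of d "from_nat_into \<A>"] by simp
qed

lemma hausdorff_measure_singleton:
  assumes "0 < d"
  shows "hausdorff_measure d {c :: 'a :: metric_space} = 0"
proof (rule hausdorff_measure_eq_0I)
  fix \<delta> \<epsilon> :: real assume "0 < \<delta>" "0 < \<epsilon>"
  then show "\<exists>U :: nat \<Rightarrow> 'a set. {c} \<subseteq> (\<Union>i. U i) \<and>
      (\<forall>i. bounded (U i) \<and> diameter (U i) \<le> \<delta>) \<and> (\<Sum>i. ennreal (diam_pow d (U i))) \<le> ennreal \<epsilon>"
    using assms by (intro exI[of _ "\<lambda>i. {c}"]) (auto simp: diam_pow_def diameter_def)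
qed

lemma hausdorff_dim_le:
  assumes d: "0 \<le> d" "d < p" and H: "\<And>q. d < q \<Longrightarrow> q < p \<Longrightarrow> hausdorff_measure q A = 0"
  shows "hausdorff_dim A \<le> ennreal d"
proof (rule ennreal_le_epsilon)
  fix e :: real assume e: "0 < e"
  define q where "q = min (d + e) ((d + p) / 2)"
  have q: "d < q" "q < p" "q \<le> d + e" using d e by (auto simp: q_def min_def)
  have "hausdorff_dim A \<le> ennreal q"
    unfolding hausdorff_dim_def using H[OF q(1,2)] d q by (intro Inf_lower) auto
  also have "\<dots> \<le> ennreal d + ennreal e"
    using q d e by (simp flip: ennreal_plus)
  finally show "hausdorff_dim A \<le> ennreal d + ennreal e" .
qed

lemma diam_le:
  fixes U :: "'b :: metric_space set"
  assumes "\<And>u w. u \<in> U \<Longrightarrow> w \<in> U \<Longrightarrow> dist u w \<le> d" "0 \<le> d"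
  shows "bounded U" "diameter U \<le> d" "0 < q \<Longrightarrow> diam_pow q U \<le> d powr q"
proof -
  show "bounded U" using assms(1) by (auto simp: bounded_two_points)
  show D: "diameter U \<le> d"
    using assms by (auto simp: diameter_def intro!: cSUP_least)
  show "diam_pow q U \<le> d powr q" if "0 < q"
    using D that diameter_ge_0[OF \<open>bounded U\<close>] by (auto simp: diam_pow_def intro: powr_mono2)
qed

lemma powr_interpolate:
  fixes X Y a :: real
  assumes "0 \<le> X" "0 \<le> Y" "0 \<le> a" "a \<le> 1"
  shows "X powr a * Y powr (1 - a) \<le> X + Y"
proof -
  define c where "c = max X Y"
  have "X powr a * Y powr (1 - a) \<le> c powr a * c powr (1 - a)"
    using assms unfolding c_def by (intro mult_mono powr_mono2) auto
  also have "\<dots> = c" using assms by (simp add: c_def flip: powr_add)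
  also have "\<dots> \<le> X + Y" using assms by (simp add: c_def)
  finally show ?thesis .
qed

text \<open>The slice is covered by the cells of level \<open>k\<close> in its layer. With \<open>e = q / p\<close> and \<open>\<nu>(R)\<close> the
  measure of a cell \<open>R\<close>, the \<open>q\<close>-th power of the diameter of its image is at most a constant times
  \<open>2\<^sup>-\<^sup>k\<^sup>\<tau>\<^sup>e \<nu>(R)\<^sup>e = X\<^sup>e Y\<^sup>1\<^sup>-\<^sup>e \<le> X + Y\<close>, where \<open>X = 2\<^sup>-\<^sup>k\<^sup>\<sigma> \<nu>(R)\<close>, \<open>Y = 2\<^sup>-\<^sup>k\<^sup>\<sigma> 2\<^sup>-\<^sup>k\<^sup>(\<^sup>n\<^sup>-\<^sup>1\<^sup>)\<close> and
  \<open>\<sigma> = \<tau> e - (n - 1) (1 - e)\<close>, which is positive by the hypothesis on \<open>\<tau> q\<close>. Both sums over the layer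
  are of order \<open>2\<^sup>-\<^sup>k\<^sup>\<sigma>\<close>: the first because \<open>\<nu>\<close> is finite, the second because \<open>2\<^sup>-\<^sup>k\<^sup>(\<^sup>n\<^sup>-\<^sup>1\<^sup>)\<close> is \<open>2\<^sup>k\<close>
  times the volume of \<open>R\<close> and the layer has volume at most \<open>2\<^sup>-\<^sup>k\<close>.\<close>

lemma hausdorff_measure_slice_image:
  fixes F :: "real ^ 'n \<Rightarrow> 'b :: metric_space" and \<nu> :: "(real ^ 'n) measure"
  assumes \<nu>: "finite_measure \<nu>" "sets \<nu> = sets borel"
    and F: "\<And>k y z. k0 \<le> k \<Longrightarrow> y \<in> dcell k0 a \<Longrightarrow> y $ i = c \<Longrightarrow> z \<in> dcell k y \<Longrightarrow> z $ i = c \<Longrightarrow>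
        dist (F y) (F z) \<le> C * 2 powr (- (real k * \<tau> / p)) * measure \<nu> (dcell k y) powr (1 / p)"
    and C: "0 \<le> C" and q: "0 < q" "q < p" "(real CARD('n) - 1) * (p - q) < \<tau> * q" and \<tau>: "0 < \<tau>"
  shows "hausdorff_measure q (F ` {y \<in> dcell k0 a. y $ i = c}) = 0"
proof (cases "{y \<in> dcell k0 a. y $ i = c} = {}")
  case True
  have "hausdorff_measure q ({} :: 'b set) = 0"
  proof (rule hausdorff_measure_eq_0I)
    fix \<delta> \<epsilon> :: real assume "0 < \<delta>" "0 < \<epsilon>"
    then show "\<exists>U :: nat \<Rightarrow> 'b set. {} \<subseteq> (\<Union>i. U i) \<and>
      (\<forall>i. bounded (U i) \<and> diameter (U i) \<le> \<delta>) \<and> (\<Sum>i. ennreal (diam_pow q (U i))) \<le> ennreal \<epsilon>"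
      by (intro exI[of _ "\<lambda>i. {}"]) (auto simp: diam_pow_def diameter_def)
  qed
  then show ?thesis unfolding True by simp
next
  case False
  then obtain x where x: "x \<in> dcell k0 a" "x $ i = c" by blast
  interpret \<nu>: finite_measure \<nu> by fact
  note [measurable_cong] = \<nu>(2)
  let ?n = "real CARD('n)"
  define M where "M = measure \<nu> (space \<nu>)"
  define e where "e = q / p"
  define \<sigma> where "\<sigma> = \<tau> * e - (?n - 1) * (1 - e)"
  have p: "0 < p" using q by simp
  have e: "0 < e" "e < 1" using q p by (auto simp: e_def)
  have \<sigma>: "0 < \<sigma>"
  proof -
    have "p * \<sigma> = \<tau> * q - (?n - 1) * (p - q)"
      using p by (simp add: \<sigma>_def e_def field_simps)
    then have "0 < p * \<sigma>" using q by simp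
    then show ?thesis using p by (simp add: zero_less_mult_iff)
  qed
  have M0: "0 \<le> M" by (simp add: M_def)
  have \<nu>M: "measure \<nu> S \<le> M" for S unfolding M_def by (rule \<nu>.bounded_measure)
  \<comment> \<open>Numbering the cells by \<open>to_nat\<close> of their index gives disjoint pieces indexed by \<open>nat\<close>, the
    index type of the coverings in the definition of the Hausdorff measure.\<close>
  define P where "P k j = {y \<in> dcell k0 a \<inter> layer i k x. to_nat (cell_index k y) = j}" for k j
  define U where "U k j = F ` {y \<in> P k j. y $ i = c}" for k j
  have P_cell: "P k j = dcell k y" if "k0 \<le> k" "y \<in> P k j" for k j y
  proof -
    have "dcell k y \<subseteq> dcell k0 a" using that by (intro dcell_subset) (auto simp: P_def)
    moreover have "dcell k y \<subseteq> layer i k x"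
      using dcell_subset_layer[of k y i] that(2) by (auto simp: P_def layer_def)
    moreover have "to_nat (cell_index k z) = j \<longleftrightarrow> z \<in> dcell k y" for z
      using that(2) by (auto simp: P_def dcell_def)
    ultimately show ?thesis by (auto simp: P_def)
  qed
  have P_sets [measurable]: "P k j \<in> sets borel" for k j
  proof -
    have "{y. to_nat (cell_index k (y :: real ^ 'n)) = j} \<in> sets borel" by measurable
    moreover have "P k j = dcell k0 a \<inter> layer i k x \<inter> {y. to_nat (cell_index k y) = j}" by (auto simp: P_def)
    ultimately show ?thesis by simp
  qed
  have P_disj: "disjoint_family (P k)" for k by (auto simp: disjoint_family_on_def P_def)
  have U_dist: "dist u w \<le> C * 2 powr (- (real k * \<tau> / p)) * measure \<nu> (P k j) powr (1 / p)"
    if "k0 \<le> k" "u \<in> U k j" "w \<in> U k j" for k j u w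
  proof -
    from that obtain y z where yz: "y \<in> P k j" "y $ i = c" "u = F y" "z \<in> P k j" "z $ i = c" "w = F z"
      by (auto simp: U_def)
    have "y \<in> dcell k0 a" using yz by (simp add: P_def)
    moreover have "z \<in> dcell k y" using P_cell[OF that(1) yz(1)] yz(4) by simp
    ultimately show ?thesis
      using F[OF that(1), of y z] yz P_cell[OF that(1) yz(1)] by simp
  qed
  have U_bd: "bounded (U k j)" "diameter (U k j) \<le> C * 2 powr (- (real k * \<tau> / p)) * M powr (1 / p)"
    if k: "k0 \<le> k" for k j
  proof -
    have D: "bounded (U k j)" "diameter (U k j) \<le> C * 2 powr (- (real k * \<tau> / p)) * measure \<nu> (P k j) powr (1 / p)"
      using diam_le[OF U_dist[OF k, of _ j]] C by auto
    show "bounded (U k j)" by fact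
    show "diameter (U k j) \<le> C * 2 powr (- (real k * \<tau> / p)) * M powr (1 / p)"
      using D(2) by (rule order_trans) (use C \<nu>M p in \<open>auto intro!: mult_left_mono powr_mono2\<close>)
  qed
  have U_pow: "ennreal (diam_pow q (U k j))
      \<le> ennreal (C powr q * 2 powr (- (real k * \<sigma>))) * (emeasure \<nu> (P k j) + ennreal (2 ^ k) * emeasure lborel (P k j))"
    if k: "k0 \<le> k" for k j
  proof (cases "U k j = {}")
    case True
    then show ?thesis by (simp add: diam_pow_def)
  next
    case False
    then obtain y where y: "y \<in> P k j" by (auto simp: U_def)
    let ?N = "measure \<nu> (P k j)"
    let ?X = "2 powr (- (real k * \<sigma>)) * ?N" and ?Y = "2 powr (- (real k * (?n - 1 + \<sigma>)))"
    have "diam_pow q (U k j) \<le> (C * 2 powr (- (real k * \<tau> / p)) * ?N powr (1 / p)) powr q"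
      using diam_le(3)[OF U_dist[OF k, of _ j]] C q by auto
    also have "\<dots> = C powr q * (2 powr (- (real k * \<tau> * e)) * ?N powr e)"
      using C p by (simp add: powr_mult powr_powr e_def mult_ac)
    also have "2 powr (- (real k * \<tau> * e)) * ?N powr e = ?X powr e * ?Y powr (1 - e)"
    proof -
      have "?X powr e * ?Y powr (1 - e)
          = (2 powr (- (real k * \<sigma>) * e) * 2 powr (- (real k * (?n - 1 + \<sigma>)) * (1 - e))) * ?N powr e"
        by (simp add: powr_mult powr_powr mult_ac)
      also have "2 powr (- (real k * \<sigma>) * e) * 2 powr (- (real k * (?n - 1 + \<sigma>)) * (1 - e))
          = 2 powr (- (real k * \<tau> * e))"
        unfolding powr_add[symmetric] \<sigma>_def by (simp add: algebra_simps)
      finally show ?thesis by simp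
    qed
    also have "C powr q * (?X powr e * ?Y powr (1 - e)) \<le> C powr q * (?X + ?Y)"
      using e by (intro mult_left_mono powr_interpolate) auto
    also have "?Y = 2 powr (- (real k * \<sigma>)) * (2 ^ k * (1 / 2 ^ (k * CARD('n))))"
    proof -
      have "2 ^ k * (1 / 2 ^ (k * CARD('n))) = 2 powr (real k) * 2 powr (- (real k * ?n))"
        by (simp add: powr_minus divide_inverse flip: powr_realpow)
      then show ?thesis by (simp add: algebra_simps flip: powr_add)
    qed
    finally have "diam_pow q (U k j) \<le> C powr q * 2 powr (- (real k * \<sigma>)) * (?N + 2 ^ k * (1 / 2 ^ (k * CARD('n))))"
      by (simp add: algebra_simps)
    then have "ennreal (diam_pow q (U k j)) \<le> ennreal (C powr q * 2 powr (- (real k * \<sigma>))) *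
        (ennreal ?N + ennreal (2 ^ k) * ennreal (1 / 2 ^ (k * CARD('n))))"
      by (simp add: ennreal_leI flip: ennreal_mult ennreal_plus)
    also have "ennreal (1 / 2 ^ (k * CARD('n))) = emeasure lborel (P k j)"
      using P_cell[OF k y] by (simp add: emeasure_dcell)
    also have "ennreal ?N = emeasure \<nu> (P k j)" by (simp add: \<nu>.emeasure_eq_measure)
    finally show ?thesis .
  qed
  have sum: "(\<Sum>j. ennreal (diam_pow q (U k j))) \<le> ennreal (C powr q * 2 powr (- (real k * \<sigma>)) * (M + 1))"
    if k: "k0 \<le> k" for k
  proof -
    have "(\<Sum>j. ennreal (diam_pow q (U k j)))
      \<le> (\<Sum>j. ennreal (C powr q * 2 powr (- (real k * \<sigma>))) * (emeasure \<nu> (P k j) + ennreal (2 ^ k) * emeasure lborel (P k j)))"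
      by (intro suminf_le U_pow k) auto
    also have "\<dots> = ennreal (C powr q * 2 powr (- (real k * \<sigma>))) *
        ((\<Sum>j. emeasure \<nu> (P k j)) + ennreal (2 ^ k) * (\<Sum>j. emeasure lborel (P k j)))"
      by (simp only: ennreal_suminf_cmult suminf_add[OF summableI summableI, symmetric])
    also have "(\<Sum>j. emeasure \<nu> (P k j)) = emeasure \<nu> (\<Union>j. P k j)"
      by (intro suminf_emeasure P_disj) (auto simp: \<nu>(2))
    also have "\<dots> \<le> ennreal M"
      by (simp add: \<nu>.emeasure_eq_measure \<nu>M ennreal_leI)
    also have "(\<Sum>j. emeasure lborel (P k j)) = emeasure lborel (\<Union>j. P k j)"
      by (intro suminf_emeasure P_disj) auto
    also have "\<dots> \<le> emeasure lborel (dcell k0 a \<inter> layer i k x)"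
      by (intro emeasure_mono) (auto simp: P_def)
    also have "\<dots> \<le> ennreal (1 / 2 ^ k)" by (rule emeasure_slab_le)
    also have "ennreal (2 ^ k) * ennreal (1 / 2 ^ k) = 1"
      by (simp flip: ennreal_mult)
    also have "ennreal (C powr q * 2 powr (- (real k * \<sigma>))) * (ennreal M + 1)
        = ennreal (C powr q * 2 powr (- (real k * \<sigma>)) * (M + 1))"
      using M0 by (simp add: ennreal_mult)
    finally show ?thesis by (simp add: mult_left_mono add_mono)
  qed
  show ?thesis
  proof (rule hausdorff_measure_eq_0I)
    fix \<delta> \<epsilon> :: real assume \<delta>: "0 < \<delta>" and \<epsilon>: "0 < \<epsilon>"
    have lim: "(\<lambda>k. B * 2 powr (- (real k * t))) \<longlonglongrightarrow> 0" if "0 < t" for B t :: real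
    proof -
      have "(\<lambda>k. B * (2 powr (- t)) ^ k) \<longlonglongrightarrow> B * 0"
        using that by (intro tendsto_mult tendsto_const LIMSEQ_realpow_zero) (auto simp: powr_less_one)
      moreover have "(2 powr (- t)) ^ k = 2 powr (- (real k * t))" for k
        by (simp add: powr_powr mult_ac flip: powr_realpow)
      ultimately show ?thesis by simp
    qed
    have "eventually (\<lambda>k. (C * M powr (1 / p)) * 2 powr (- (real k * (\<tau> / p))) < \<delta>) sequentially"
      "eventually (\<lambda>k. (C powr q * (M + 1)) * 2 powr (- (real k * \<sigma>)) < \<epsilon>) sequentially"
      by (rule order_tendstoD(2)[OF lim \<delta>] order_tendstoD(2)[OF lim \<epsilon>]; use \<tau> p \<sigma> in simp)+
    with eventually_ge_at_top[of k0]
    have "eventually (\<lambda>k. k0 \<le> k \<and> (C * M powr (1 / p)) * 2 powr (- (real k * (\<tau> / p))) < \<delta>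
        \<and> (C powr q * (M + 1)) * 2 powr (- (real k * \<sigma>)) < \<epsilon>) sequentially"
      by eventually_elim auto
    then obtain k where k: "k0 \<le> k" "(C * M powr (1 / p)) * 2 powr (- (real k * (\<tau> / p))) < \<delta>"
        "(C powr q * (M + 1)) * 2 powr (- (real k * \<sigma>)) < \<epsilon>"
      by (auto dest: eventually_happens)
    show "\<exists>U :: nat \<Rightarrow> 'b set. F ` {y \<in> dcell k0 a. y $ i = c} \<subseteq> (\<Union>i. U i) \<and>
      (\<forall>i. bounded (U i) \<and> diameter (U i) \<le> \<delta>) \<and> (\<Sum>i. ennreal (diam_pow q (U i))) \<le> ennreal \<epsilon>"
    proof (intro exI[of _ "U k"] conjI allI)
      show "F ` {y \<in> dcell k0 a. y $ i = c} \<subseteq> (\<Union>i. U k i)"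
      proof safe
        fix y assume "y \<in> dcell k0 a" "c = y $ i"
        then have "y \<in> P k (to_nat (cell_index k y))" "y $ i = c" using x by (simp_all add: P_def layer_def)
        then have "F y \<in> U k (to_nat (cell_index k y))" by (auto simp: U_def)
        then show "F y \<in> (\<Union>j. U k j)" by blast
      qed
      show "bounded (U k j)" for j using U_bd(1)[OF k(1)] .
      show "diameter (U k j) \<le> \<delta>" for j
        using U_bd(2)[OF k(1), of j] k(2) by (simp add: mult_ac)
      show "(\<Sum>i. ennreal (diam_pow q (U k i))) \<le> ennreal \<epsilon>"
        using sum[OF k(1)] by (rule order_trans) (use k(3) in \<open>auto intro!: ennreal_leI simp: mult_ac\<close>)
    qed
  qed
qed

section \<open>Weakly convergent sequences of continuous maps\<close>

definition avg_lim :: "(real ^ 'n \<Rightarrow> 'b :: euclidean_space) \<Rightarrow> real ^ 'n \<Rightarrow> 'b" where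
  "avg_lim u y = lim (\<lambda>m. cell_avg m u y)"

text \<open>Cells of level below \<open>k\<close> may leave the domain, so their increments are replaced by zero.\<close>

definition norm_from :: "nat \<Rightarrow> (nat \<Rightarrow> 'a \<Rightarrow> 'b :: real_normed_vector) \<Rightarrow> nat \<Rightarrow> 'a \<Rightarrow> real" where
  "norm_from k D m y = (if m < k then 0 else norm (D m y))"

lemma ennreal_suminf_finite_imp_tendsto_0:
  fixes u :: "nat \<Rightarrow> ennreal"
  assumes "(\<Sum>j. u j) \<noteq> \<infinity>"
  shows "u \<longlonglongrightarrow> 0"
proof -
  have "u j \<le> (\<Sum>j. u j)" for j using sum_le_suminf[of u "{j}"] by simp
  then have fin: "u j < \<infinity>" for j using assms by (metis infinity_ennreal_def le_less_trans less_top)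
  then have u: "u = (\<lambda>j. ennreal (enn2real (u j)))" by (auto simp: less_top)
  have "summable (\<lambda>j. enn2real (u j))"
    using assms u by (intro summable_suminf_not_top) auto
  then have "(\<lambda>j. enn2real (u j)) \<longlonglongrightarrow> 0" by (rule summable_LIMSEQ_zero)
  then have "(\<lambda>j. ennreal (enn2real (u j))) \<longlonglongrightarrow> ennreal 0" by (rule tendsto_ennrealI)
  then show ?thesis using u by simp
qed

text \<open>The bound at index \<open>i\<close> holds for all \<open>l \<le> i\<close>. With a summable \<open>e\<close>, every \<open>S l\<close> is therefore
  summable along \<open>r\<close>, apart from finitely many terms.\<close>

lemma diagonal_subseq_le:
  fixes S :: "nat \<Rightarrow> nat \<Rightarrow> ennreal"
  assumes "\<And>l. S l \<longlonglongrightarrow> 0" and e: "\<And>i. 0 < e i"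
  shows "\<exists>r. strict_mono r \<and> (\<forall>i. \<forall>l\<le>i. S l (r i) \<le> e i)"
proof -
  have "\<exists>J. \<forall>j\<ge>J. \<forall>l\<le>i. S l j \<le> e i" for i
  proof -
    have "eventually (\<lambda>j. S l j < e i) sequentially" for l
      using order_tendstoD(2)[OF assms(1) e] by simp
    then have "eventually (\<lambda>j. \<forall>l\<in>{..i}. S l j < e i) sequentially"
      by (intro eventually_ball_finite) auto
    then show ?thesis by (auto simp: eventually_sequentially intro: less_imp_le)
  qed
  then obtain J where J: "\<And>i j l. j \<ge> J i \<Longrightarrow> l \<le> i \<Longrightarrow> S l j \<le> e i" by metis
  define r where "r = rec_nat (J 0) (\<lambda>i q. max (Suc q) (J (Suc i)))"
  have r: "r 0 = J 0" "r (Suc i) = max (Suc (r i)) (J (Suc i))" for i by (simp_all add: r_def)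
  have "strict_mono r" by (rule strict_monoI_Suc) (simp add: r(2))
  moreover have "J i \<le> r i" for i by (cases i) (auto simp: r)
  ultimately show ?thesis using J by blast
qed

text \<open>A geometric series with ratio \<open>2 powr (\<tau> + (n - 1) - s * p)\<close>.\<close>

lemma slice_weights_summable:
  assumes "\<tau> < s * p - (real CARD('n :: finite) - 1)"
  shows "summable (\<lambda>m. 2 powr (real m * \<tau>) * 2 ^ (Suc m * (CARD('n) - 1)) * (C * 2 powr (- (real m * s * p))))"
proof -
  let ?n = "real CARD('n) - 1"
  let ?r = "2 powr (\<tau> + ?n - s * p)"
  have n: "real (CARD('n) - 1) = ?n" by (simp add: of_nat_diff Suc_le_eq)
  have "2 powr (real m * \<tau>) * 2 ^ (Suc m * (CARD('n) - 1)) * (C * 2 powr (- (real m * s * p)))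
      = C * 2 powr ?n * ?r ^ m" for m
  proof -
    have "(2::real) ^ (Suc m * (CARD('n) - 1)) = 2 powr (real (Suc m * (CARD('n) - 1)))"
      by (subst powr_realpow) auto
    also have "real (Suc m * (CARD('n) - 1)) = (real m + 1) * ?n"
      unfolding of_nat_mult n by simp
    finally have 1: "(2::real) ^ (Suc m * (CARD('n) - 1)) = 2 powr ((real m + 1) * ?n)" .
    have 2: "?r ^ m = 2 powr (real m * (\<tau> + ?n - s * p))"
      by (simp add: powr_powr mult.commute flip: powr_realpow)
    have "2 powr (real m * \<tau>) * 2 powr ((real m + 1) * ?n) * 2 powr (- (real m * s * p))
       = 2 powr ?n * 2 powr (real m * (\<tau> + ?n - s * p))"
      unfolding powr_add[symmetric] by (simp add: algebra_simps)
    then show ?thesis unfolding 1 2 by (simp add: mult_ac)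
  qed
  moreover have "summable (\<lambda>m. C * 2 powr ?n * ?r ^ m)"
    using assms by (intro summable_mult summable_geometric) (auto simp: powr_less_one)
  ultimately show ?thesis by (simp only:)
qed

lemma slice_weights_suminf_finite:
  assumes "\<tau> < s * p - (real CARD('n :: finite) - 1)" "0 \<le> C"
  shows "(\<Sum>m. ennreal (2 powr (real m * \<tau>) * 2 ^ (Suc m * (CARD('n) - 1))) * ennreal (C * 2 powr (- (real m * s * p)))) < \<infinity>"
proof -
  have "(\<Sum>m. ennreal (2 powr (real m * \<tau>) * 2 ^ (Suc m * (CARD('n) - 1))) * ennreal (C * 2 powr (- (real m * s * p))))
     = (\<Sum>m. ennreal (2 powr (real m * \<tau>) * 2 ^ (Suc m * (CARD('n) - 1)) * (C * 2 powr (- (real m * s * p)))))"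
    using assms(2) by (intro suminf_cong ennreal_mult[symmetric]) auto
  also have "\<dots> < \<infinity>"
    using assms(2) slice_weights_summable[OF assms(1), of C] by (subst suminf_ennreal2) auto
  finally show ?thesis .
qed

lemma cell_value_le:
  fixes y :: "real ^ 'n"
  assumes "\<And>z. z \<in> dcell m y \<Longrightarrow> h z = h y" "dcell m y \<subseteq> Q"
  shows "h y \<le> ennreal (2 ^ (m * CARD('n))) * (\<integral>\<^sup>+z\<in>Q. h z \<partial>lborel)"
proof -
  have "h y * ennreal (1 / 2 ^ (m * CARD('n))) = (\<integral>\<^sup>+z. h y * indicator (dcell m y) z \<partial>lborel)"
    by (subst nn_integral_cmult_indicator) (auto simp: emeasure_dcell)
  also have "\<dots> \<le> (\<integral>\<^sup>+z\<in>Q. h z \<partial>lborel)"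
  proof (intro nn_integral_mono)
    fix z
    show "h y * indicator (dcell m y) z \<le> h z * indicator Q z"
    proof (cases "z \<in> dcell m y")
      case True
      then have "h z = h y" "z \<in> Q" using assms by blast+
      then show ?thesis using True by simp
    qed simp
  qed
  finally have "ennreal (2 ^ (m * CARD('n))) * (h y * ennreal (1 / 2 ^ (m * CARD('n))))
     \<le> ennreal (2 ^ (m * CARD('n))) * (\<integral>\<^sup>+z\<in>Q. h z \<partial>lborel)"
    by (rule mult_left_mono) simp
  moreover have "ennreal (2 ^ (m * CARD('n))) * (h y * ennreal (1 / 2 ^ (m * CARD('n)))) = h y"
  proof -
    have "ennreal (2 ^ (m * CARD('n))) * ennreal (1 / 2 ^ (m * CARD('n))) = 1"
      by (simp flip: ennreal_mult)
    then show ?thesis by (metis mult.left_commute mult.right_neutral)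
  qed
  ultimately show ?thesis by simp
qed

text \<open>A chosen point of each cell, which makes the set of cells countable.\<close>

definition cell_point :: "nat \<Rightarrow> int ^ 'n \<Rightarrow> real ^ 'n" where
  "cell_point k z = (\<chi> i. real_of_int (z $ i) / 2 ^ k)"

lemma dcell_cell_point: "dcell k (cell_point k (cell_index k x)) = dcell k x"
  by (simp add: dcell_def cell_index_def cell_point_def)

locale weak_limit =
  fixes \<Omega> :: "(real ^ 'n) set" and s p :: real
    and f :: "nat \<Rightarrow> real ^ 'n \<Rightarrow> 'b :: euclidean_space" and g :: "real ^ 'n \<Rightarrow> 'b"
  assumes open_dom: "open \<Omega>" and s: "0 < s" and p: "1 < p"
    and sp: "real CARD('n) - 1 < s * p"
    and cont: "\<And>j. continuous_on \<Omega> (f j)"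
    and weak: "Wsp_weakly_converges s p \<Omega> f g"
begin

text \<open>The critical exponent: slice energies are finite almost everywhere for every \<open>\<tau> < gap\<close>.\<close>

definition gap :: real where "gap = s * p - (real CARD('n) - 1)"

lemma gap_pos: "0 < gap" using sp by (simp add: gap_def)

lemma f_Wsp: "f j \<in> Wsp s p \<Omega>" and g_Wsp: "g \<in> Wsp s p \<Omega>"
  using weak by (auto simp: Wsp_weakly_converges_def)

definition lim_inc :: "nat \<Rightarrow> nat \<Rightarrow> real ^ 'n \<Rightarrow> real" where
  "lim_inc k = norm_from k (\<lambda>m. cell_inc m g)"

definition diff_inc :: "nat \<Rightarrow> nat \<Rightarrow> nat \<Rightarrow> real ^ 'n \<Rightarrow> real" where
  "diff_inc k j = norm_from k (\<lambda>m y. cell_inc m (f j) y - cell_inc m g y)"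

lemma inc_measurable [measurable]: "lim_inc k m \<in> borel_measurable borel" "diff_inc k j m \<in> borel_measurable borel"
  by (cases "m < k"; simp add: lim_inc_def diff_inc_def norm_from_def [abs_def])+

lemma inc_nonneg: "0 \<le> lim_inc k m y" "0 \<le> diff_inc k j m y"
  by (auto simp: lim_inc_def diff_inc_def norm_from_def)

lemma inc_cong_cell:
  assumes "z \<in> dcell (Suc m) y"
  shows "lim_inc k m z = lim_inc k m y" "diff_inc k j m z = diff_inc k j m y"
  using cell_inc_cong_cell[OF assms, of g] cell_inc_cong_cell[OF assms, of "f j"]
  by (auto simp: lim_inc_def diff_inc_def norm_from_def)

lemma lim_inc_bound:
  assumes "dcell k a \<subseteq> \<Omega>"
  shows "\<exists>C\<ge>0. \<forall>m. (\<integral>\<^sup>+y\<in>dcell k a. ennreal (lim_inc k m y powr p) \<partial>lborel) \<le> ennreal (C * 2 powr (- (real m * s * p)))"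
proof -
  let ?C = "2 * 2 powr p * approx_const TYPE('n) s p * Wsp_norm s p \<Omega> g powr p"
  note K = approx_const_pos[where 'n='n, of s p]
  have "(\<integral>\<^sup>+y\<in>dcell k a. ennreal (lim_inc k m y powr p) \<partial>lborel) \<le> ennreal (?C * 2 powr (- (real m * s * p)))" for m
  proof (cases "m < k")
    case True
    then show ?thesis using p by (simp add: lim_inc_def norm_from_def)
  next
    case False
    then have "(\<integral>\<^sup>+y\<in>dcell k a. ennreal (lim_inc k m y powr p) \<partial>lborel)
      \<le> ennreal (2 * 2 powr p * approx_const TYPE('n) s p * 2 powr (- (real m * s * p))) * Wsp_pow s p \<Omega> g"
      using Wsp_cell_inc_bound[OF open_dom g_Wsp p s assms, of m] by (simp add: lim_inc_def norm_from_def)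
    also have "\<dots> = ennreal (?C * 2 powr (- (real m * s * p)))"
      using K by (simp add: Wsp_pow_eq[OF g_Wsp p] mult_ac flip: ennreal_mult)
    finally show ?thesis .
  qed
  then show ?thesis using K by (intro exI[of _ ?C]) auto
qed

lemma diff_inc_bound:
  assumes "dcell k a \<subseteq> \<Omega>"
  shows "\<exists>C\<ge>0. \<forall>j m. (\<integral>\<^sup>+y\<in>dcell k a. ennreal (diff_inc k j m y powr p) \<partial>lborel) \<le> ennreal (C * 2 powr (- (real m * s * p)))"
proof -
  obtain Cg where Cg: "Cg \<ge> 0" "\<And>m. (\<integral>\<^sup>+y\<in>dcell k a. ennreal (lim_inc k m y powr p) \<partial>lborel) \<le> ennreal (Cg * 2 powr (- (real m * s * p)))"
    using lim_inc_bound[OF assms] by blast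
  obtain Cf where Cf: "Cf \<ge> 0" "\<And>j m. k \<le> m \<Longrightarrow> (\<integral>\<^sup>+y\<in>dcell k a. ennreal (norm (cell_inc m (f j) y) powr p) \<partial>lborel)
      \<le> ennreal (Cf * 2 powr (- (real m * s * p)))"
    using weak_conv_cell_inc_bounded[OF open_dom p s assms weak] by blast
  have "(\<integral>\<^sup>+y\<in>dcell k a. ennreal (diff_inc k j m y powr p) \<partial>lborel) \<le> ennreal (2 powr p * (Cf + Cg) * 2 powr (- (real m * s * p)))" for j m
  proof (cases "m < k")
    case True
    then show ?thesis using p by (simp add: diff_inc_def norm_from_def)
  next
    case False
    have "(\<integral>\<^sup>+y\<in>dcell k a. ennreal (diff_inc k j m y powr p) \<partial>lborel)
       \<le> (\<integral>\<^sup>+y. ennreal (2 powr p) * (ennreal (norm (cell_inc m (f j) y) powr p) * indicator (dcell k a) y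
            + ennreal (lim_inc k m y powr p) * indicator (dcell k a) y) \<partial>lborel)"
    proof (intro nn_integral_mono)
      fix y
      have "ennreal (diff_inc k j m y powr p) \<le> ennreal (2 powr p * (norm (cell_inc m (f j) y) powr p + lim_inc k m y powr p))"
        using False norm_diff_powr_le[of p "cell_inc m (f j) y" "cell_inc m g y"] p
        by (intro ennreal_leI) (simp add: diff_inc_def lim_inc_def norm_from_def)
      also have "\<dots> = ennreal (2 powr p) * (ennreal (norm (cell_inc m (f j) y) powr p) + ennreal (lim_inc k m y powr p))"
        by (simp add: ennreal_mult)
      finally show "ennreal (diff_inc k j m y powr p) * indicator (dcell k a) y \<le>
          ennreal (2 powr p) * (ennreal (norm (cell_inc m (f j) y) powr p) * indicator (dcell k a) y
            + ennreal (lim_inc k m y powr p) * indicator (dcell k a) y)"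
        by (simp split: split_indicator)
    qed
    also have "\<dots> = ennreal (2 powr p) * ((\<integral>\<^sup>+y\<in>dcell k a. ennreal (norm (cell_inc m (f j) y) powr p) \<partial>lborel)
        + (\<integral>\<^sup>+y\<in>dcell k a. ennreal (lim_inc k m y powr p) \<partial>lborel))"
      by (simp add: nn_integral_cmult nn_integral_add)
    also have "\<dots> \<le> ennreal (2 powr p) * (ennreal (Cf * 2 powr (- (real m * s * p))) + ennreal (Cg * 2 powr (- (real m * s * p))))"
      using False by (intro mult_left_mono add_mono Cf Cg) auto
    also have "\<dots> = ennreal (2 powr p * (Cf + Cg) * 2 powr (- (real m * s * p)))"
      using Cf(1) Cg(1) by (simp add: algebra_simps flip: ennreal_mult ennreal_plus)
    finally show ?thesis .
  qed
  then show ?thesis using Cf(1) Cg(1) by (intro exI[of _ "2 powr p * (Cf + Cg)"]) auto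
qed

lemma cell_avg_cell_tendsto:
  assumes "dcell k a \<subseteq> \<Omega>" "y \<in> dcell k a" "k \<le> m"
  shows "(\<lambda>j. cell_avg m (f j) y) \<longlonglongrightarrow> cell_avg m g y"
  using dcell_subset[OF assms(3,2)] assms(1)
  by (intro cell_avg_weak_tendsto[OF open_dom p _ weak]) auto

text \<open>Weak convergence gives pointwise convergence of the increments. They are constant on cells, so
  the bound on their integrals is also a pointwise bound, uniform in \<open>j\<close>, and dominated convergence
  applies.\<close>

lemma diff_inc_integral_tendsto:
  assumes Q: "dcell k a \<subseteq> \<Omega>"
  shows "(\<lambda>j. \<integral>\<^sup>+y\<in>dcell k a. ennreal (diff_inc k j m y powr p) \<partial>lborel) \<longlonglongrightarrow> 0"
proof (cases "m < k")
  case True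
  then show ?thesis using p by (simp add: diff_inc_def norm_from_def)
next
  case False
  obtain C where C: "C \<ge> 0" "\<And>j m. (\<integral>\<^sup>+y\<in>dcell k a. ennreal (diff_inc k j m y powr p) \<partial>lborel) \<le> ennreal (C * 2 powr (- (real m * s * p)))"
    using diff_inc_bound[OF Q] by blast
  define B where "B = 2 ^ (Suc m * CARD('n)) * (C * 2 powr (- (real m * s * p)))"
  have B: "ennreal (diff_inc k j m y powr p) \<le> ennreal B" if y: "y \<in> dcell k a" for j y
  proof -
    have "dcell (Suc m) y \<subseteq> dcell k a" using False y by (intro dcell_subset) auto
    then have "ennreal (diff_inc k j m y powr p) \<le> ennreal (2 ^ (Suc m * CARD('n))) * (\<integral>\<^sup>+z\<in>dcell k a. ennreal (diff_inc k j m z powr p) \<partial>lborel)"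
      by (intro cell_value_le arg_cong[where f="\<lambda>t. ennreal (t powr p)"] inc_cong_cell(2))
    also have "\<dots> \<le> ennreal (2 ^ (Suc m * CARD('n))) * ennreal (C * 2 powr (- (real m * s * p)))"
      by (intro mult_left_mono C) simp
    also have "\<dots> = ennreal B"
      using C(1) unfolding B_def by (intro ennreal_mult[symmetric]) auto
    finally show ?thesis .
  qed
  have "(\<lambda>j. \<integral>\<^sup>+y. ennreal (diff_inc k j m y powr p) * indicator (dcell k a) y \<partial>lborel)
      \<longlonglongrightarrow> (\<integral>\<^sup>+y. 0 \<partial>(lborel :: (real ^ 'n) measure))"
  proof (rule nn_integral_dominated_convergence[where w="\<lambda>y. ennreal B * indicator (dcell k a) y"])
    show "AE y in lborel. ennreal (diff_inc k j m y powr p) * indicator (dcell k a) y \<le> ennreal B * indicator (dcell k a) y" for j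
      using B by (intro AE_I2) (auto split: split_indicator)
    show "(\<integral>\<^sup>+y. ennreal B * indicator (dcell k a) y \<partial>lborel) < \<infinity>"
      by (subst nn_integral_cmult_indicator) (auto simp: emeasure_dcell ennreal_mult_less_top)
    show "AE y in lborel. (\<lambda>j. ennreal (diff_inc k j m y powr p) * indicator (dcell k a) y) \<longlonglongrightarrow> 0"
    proof (intro AE_I2)
      fix y
      show "(\<lambda>j. ennreal (diff_inc k j m y powr p) * indicator (dcell k a) y) \<longlonglongrightarrow> 0"
      proof (cases "y \<in> dcell k a")
        case True
        have "(\<lambda>j. cell_inc m (f j) y) \<longlonglongrightarrow> cell_inc m g y"
          unfolding cell_inc_def using False by (intro tendsto_diff cell_avg_cell_tendsto[OF Q True]) auto
        then have "(\<lambda>j. cell_inc m (f j) y - cell_inc m g y) \<longlonglongrightarrow> cell_inc m g y - cell_inc m g y"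
          by (intro tendsto_diff tendsto_const)
        then have "(\<lambda>j. norm (cell_inc m (f j) y - cell_inc m g y)) \<longlonglongrightarrow> 0"
          using tendsto_norm_zero_iff by fastforce
        then have "(\<lambda>j. norm (cell_inc m (f j) y - cell_inc m g y) powr p) \<longlonglongrightarrow> 0 powr p"
          using p by (intro tendsto_powr2 tendsto_const) auto
        then have "(\<lambda>j. ennreal (norm (cell_inc m (f j) y - cell_inc m g y) powr p)) \<longlonglongrightarrow> ennreal 0"
          using p by (intro tendsto_ennrealI) simp
        then show ?thesis using True False by (simp add: diff_inc_def norm_from_def)
      qed simp
    qed
  qed (use inc_measurable in \<open>auto intro!: measurable\<close>)
  then show ?thesis by simp
qed

text \<open>Dominated convergence for the sum over \<open>m\<close>; the dominating series converges because \<open>\<tau>\<close> is below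
  the critical exponent.\<close>

lemma diff_inc_weighted_tendsto:
  assumes Q: "dcell k a \<subseteq> \<Omega>" and \<tau>: "\<tau> < gap"
  shows "(\<lambda>j. \<Sum>m. ennreal (2 powr (real m * \<tau>) * 2 ^ (Suc m * (CARD('n) - 1)))
         * (\<integral>\<^sup>+y\<in>dcell k a. ennreal (diff_inc k j m y powr p) \<partial>lborel)) \<longlonglongrightarrow> 0"
proof -
  obtain C where C: "C \<ge> 0" "\<And>j m. (\<integral>\<^sup>+y\<in>dcell k a. ennreal (diff_inc k j m y powr p) \<partial>lborel) \<le> ennreal (C * 2 powr (- (real m * s * p)))"
    using diff_inc_bound[OF Q] by blast
  let ?c = "\<lambda>m. ennreal (2 powr (real m * \<tau>) * 2 ^ (Suc m * (CARD('n) - 1)))"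
  have "(\<lambda>j. \<integral>\<^sup>+m. ?c m * (\<integral>\<^sup>+y\<in>dcell k a. ennreal (diff_inc k j m y powr p) \<partial>lborel) \<partial>count_space UNIV)
      \<longlonglongrightarrow> (\<integral>\<^sup>+m. 0 \<partial>count_space (UNIV :: nat set))"
  proof (rule nn_integral_dominated_convergence[where w="\<lambda>m. ?c m * ennreal (C * 2 powr (- (real m * s * p)))"])
    show "AE m in count_space UNIV. ?c m * (\<integral>\<^sup>+y\<in>dcell k a. ennreal (diff_inc k j m y powr p) \<partial>lborel)
        \<le> ?c m * ennreal (C * 2 powr (- (real m * s * p)))" for j
      by (intro AE_I2 mult_left_mono C) simp
    show "(\<integral>\<^sup>+m. ?c m * ennreal (C * 2 powr (- (real m * s * p))) \<partial>count_space UNIV) < \<infinity>"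
      unfolding nn_integral_count_space_nat
      using slice_weights_suminf_finite[where 'n='n, of \<tau> s p C] \<tau> C(1) by (simp add: gap_def)
    show "AE m in count_space UNIV. (\<lambda>j. ?c m * (\<integral>\<^sup>+y\<in>dcell k a. ennreal (diff_inc k j m y powr p) \<partial>lborel)) \<longlonglongrightarrow> 0"
    proof (intro AE_I2)
      fix m
      have "(\<lambda>j. ?c m * (\<integral>\<^sup>+y\<in>dcell k a. ennreal (diff_inc k j m y powr p) \<partial>lborel)) \<longlonglongrightarrow> ?c m * 0"
        by (intro ennreal_tendsto_cmult diff_inc_integral_tendsto[OF Q]) simp
      then show "(\<lambda>j. ?c m * (\<integral>\<^sup>+y\<in>dcell k a. ennreal (diff_inc k j m y powr p) \<partial>lborel)) \<longlonglongrightarrow> 0" by simp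
    qed
  qed auto
  then show ?thesis by (simp add: nn_integral_count_space_nat)
qed

lemma slice_energy_g_finite:
  assumes Q: "dcell k a \<subseteq> \<Omega>" and \<tau>: "\<tau> < gap"
  shows "AE x in lborel. x \<in> dcell k a \<longrightarrow> slice_energy i \<tau> p (lim_inc k) (dcell k a) x \<noteq> \<infinity>"
proof -
  obtain C where C: "C \<ge> 0" "\<And>m. (\<integral>\<^sup>+y\<in>dcell k a. ennreal (lim_inc k m y powr p) \<partial>lborel) \<le> ennreal (C * 2 powr (- (real m * s * p)))"
    using lim_inc_bound[OF Q] by blast
  have "(\<integral>\<^sup>+x\<in>dcell k a. slice_energy i \<tau> p (lim_inc k) (dcell k a) x \<partial>lborel)
     \<le> (\<Sum>m. ennreal (2 powr (real m * \<tau>) * 2 ^ (Suc m * (CARD('n) - 1)))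
         * (\<integral>\<^sup>+y\<in>dcell k a. ennreal (lim_inc k m y powr p) \<partial>lborel))"
    by (intro slice_energy_integral inc_measurable)
  also have "\<dots> \<le> (\<Sum>m. ennreal (2 powr (real m * \<tau>) * 2 ^ (Suc m * (CARD('n) - 1))) * ennreal (C * 2 powr (- (real m * s * p))))"
    by (intro suminf_le mult_left_mono C) auto
  also have "\<dots> < \<infinity>"
    using slice_weights_suminf_finite[where 'n='n, of \<tau> s p C] \<tau> C(1) by (simp add: gap_def)
  finally have "(\<integral>\<^sup>+x\<in>dcell k a. slice_energy i \<tau> p (lim_inc k) (dcell k a) x \<partial>lborel) \<noteq> \<infinity>" by simp
  moreover have "(\<lambda>x. slice_energy i \<tau> p (lim_inc k) (dcell k a) x * indicator (dcell k a) x) \<in> borel_measurable lborel"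
    by (intro borel_measurable_times_ennreal measurable_slice_energy inc_measurable sets_dcell borel_measurable_indicator) simp
  ultimately have "AE x in lborel. slice_energy i \<tau> p (lim_inc k) (dcell k a) x * indicator (dcell k a) x \<noteq> \<infinity>"
    by (intro nn_integral_PInf_AE)
  then show ?thesis by eventually_elim (auto split: split_indicator)
qed

text \<open>The integrals of the slice energies of \<open>f j - g\<close> tend to zero, hence they are summable along a
  subsequence, and then the energies tend to zero almost everywhere. There are countably many cells,
  so one subsequence serves all of them.\<close>

lemma common_subsequence:
  assumes \<tau>: "\<tau> < gap"
  shows "\<exists>r. strict_mono r \<and> (\<forall>k a i. dcell k a \<subseteq> \<Omega> \<longrightarrow>
    (AE x in lborel. x \<in> dcell k a \<longrightarrow> (\<lambda>j. slice_energy i \<tau> p (diff_inc k (r j)) (dcell k a) x) \<longlonglongrightarrow> 0))"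
proof -
  define E where "E k a j = (\<Sum>m. ennreal (2 powr (real m * \<tau>) * 2 ^ (Suc m * (CARD('n) - 1)))
         * (\<integral>\<^sup>+y\<in>dcell k a. ennreal (diff_inc k j m y powr p) \<partial>lborel))" for k a j
  define S where "S l j = (case from_nat l of (k, z) \<Rightarrow>
      if dcell k (cell_point k z) \<subseteq> \<Omega> then E k (cell_point k z) j else 0)" for l j
  have "S l \<longlonglongrightarrow> 0" for l
  proof -
    obtain k :: nat and z :: "int ^ 'n" where kz: "from_nat l = (k, z)" by (cases "from_nat l :: nat \<times> (int ^ 'n)")
    show ?thesis
      using diff_inc_weighted_tendsto[OF _ \<tau>, of k "cell_point k z"]
      by (cases "dcell k (cell_point k z) \<subseteq> \<Omega>") (auto simp: S_def[abs_def] kz E_def)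
  qed
  then obtain r where r: "strict_mono r" "\<And>i l. l \<le> i \<Longrightarrow> S l (r i) \<le> ennreal ((1 / 2) ^ i)"
    using diagonal_subseq_le[of S "\<lambda>i. ennreal ((1 / 2) ^ i)"] by auto
  have "AE x in lborel. x \<in> dcell k a \<longrightarrow> (\<lambda>j. slice_energy i \<tau> p (diff_inc k (r j)) (dcell k a) x) \<longlonglongrightarrow> 0"
    if Q: "dcell k a \<subseteq> \<Omega>" for k a i
  proof -
    define l where "l = to_nat (k, cell_index k a)"
    have Sl: "S l j = E k a j" for j
      using Q unfolding S_def l_def E_def by (simp add: dcell_cell_point)
    define u where "u j x = slice_energy i \<tau> p (diff_inc k (r (j + l))) (dcell k a) x * indicator (dcell k a) x" for j x
    have [measurable]: "u j \<in> borel_measurable lborel" for j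
      unfolding u_def
      by (intro borel_measurable_times_ennreal measurable_slice_energy inc_measurable sets_dcell borel_measurable_indicator) simp
    have "(\<integral>\<^sup>+x. u j x \<partial>lborel) \<le> ennreal ((1 / 2) ^ j)" for j
    proof -
      have "(\<integral>\<^sup>+x. u j x \<partial>lborel) \<le> E k a (r (j + l))"
        unfolding u_def E_def by (intro slice_energy_integral inc_measurable)
      also have "\<dots> \<le> ennreal ((1 / 2) ^ (j + l))" using r(2)[of l "j + l"] by (simp add: Sl)
      also have "\<dots> \<le> ennreal ((1 / 2) ^ j)" by (intro ennreal_leI power_decreasing) auto
      finally show ?thesis .
    qed
    then have "(\<Sum>j. \<integral>\<^sup>+x. u j x \<partial>lborel) \<le> (\<Sum>j. ennreal ((1 / 2) ^ j))"
      by (intro suminf_le) auto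
    also have "\<dots> < \<infinity>"
      by (subst suminf_ennreal2) (auto intro: summable_geometric)
    also have "(\<Sum>j. \<integral>\<^sup>+x. u j x \<partial>lborel) = (\<integral>\<^sup>+x. (\<Sum>j. u j x) \<partial>lborel)"
      by (intro nn_integral_suminf[symmetric]) measurable
    finally have "AE x in lborel. (\<Sum>j. u j x) \<noteq> \<infinity>"
      by (intro nn_integral_PInf_AE) auto
    then show ?thesis
    proof eventually_elim
      case (elim x)
      then have "(\<lambda>j. u j x) \<longlonglongrightarrow> 0" by (rule ennreal_suminf_finite_imp_tendsto_0)
      then show ?case unfolding u_def by (auto intro: LIMSEQ_offset)
    qed
  qed
  then show ?thesis using r(1) by blast
qed

end

section \<open>Slices of uniform convergence\<close>

context weak_limit
begin

text \<open>Rational exponents keep the number of conditions countable. The exponent \<open>gap / 2\<close> stands for any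
  fixed one strictly between \<open>0\<close> and \<open>gap\<close>.\<close>

definition good_slice :: "(nat \<Rightarrow> nat) \<Rightarrow> nat \<Rightarrow> real ^ 'n \<Rightarrow> 'n \<Rightarrow> real ^ 'n \<Rightarrow> bool" where
  "good_slice r k a i x \<longleftrightarrow>
     (\<forall>q. 0 < real_of_rat q \<and> real_of_rat q < gap \<longrightarrow>
        slice_energy i (real_of_rat q) p (lim_inc k) (dcell k a) x \<noteq> \<infinity>) \<and>
     (\<lambda>j. slice_energy i (gap / 2) p (diff_inc k (r j)) (dcell k a) x) \<longlonglongrightarrow> 0"

lemma good_slice_subsequence:
  "\<exists>r. strict_mono r \<and> (\<forall>k a. dcell k a \<subseteq> \<Omega> \<longrightarrow>
     (AE x in lborel. x \<in> dcell k a \<longrightarrow> (\<forall>i. good_slice r k a i x)))"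
proof -
  obtain r where r: "strict_mono r" "\<And>k a i. dcell k a \<subseteq> \<Omega> \<Longrightarrow>
      AE x in lborel. x \<in> dcell k a \<longrightarrow> (\<lambda>j. slice_energy i (gap / 2) p (diff_inc k (r j)) (dcell k a) x) \<longlonglongrightarrow> 0"
    using common_subsequence[of "gap / 2"] gap_pos by auto
  have "AE x in lborel. x \<in> dcell k a \<longrightarrow> (\<forall>i. good_slice r k a i x)" if Q: "dcell k a \<subseteq> \<Omega>" for k a
  proof -
    have "AE x in lborel. \<forall>i. x \<in> dcell k a \<longrightarrow>
        (\<lambda>j. slice_energy i (gap / 2) p (diff_inc k (r j)) (dcell k a) x) \<longlonglongrightarrow> 0"
      unfolding AE_all_countable using r(2)[OF Q] by simp
    moreover have "AE x in lborel. \<forall>q. \<forall>i. real_of_rat q < gap \<longrightarrow> x \<in> dcell k a \<longrightarrow>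
        slice_energy i (real_of_rat q) p (lim_inc k) (dcell k a) x \<noteq> \<infinity>"
      unfolding AE_all_countable using slice_energy_g_finite[OF Q] by auto
    ultimately show ?thesis by eventually_elim (auto simp: good_slice_def)
  qed
  then show ?thesis using r(1) by blast
qed

lemma avg_lim_on_slice:
  assumes fin: "slice_energy i \<tau> p (lim_inc k) R x \<le> ennreal v" "0 \<le> v" and \<tau>: "0 < \<tau>"
    and y: "y $ i = x $ i" "dcell k' y \<subseteq> R" "k \<le> k'"
  shows "convergent (\<lambda>m. cell_avg m g y)"
    "norm (avg_lim g y - cell_avg k' g y) \<le> 1 / (1 - 2 powr (- (\<tau> / p))) * 2 powr (- (real k' * \<tau> / p)) * v powr (1 / p)"
proof -
  have inc: "norm (cell_avg (Suc m) g y - cell_avg m g y) \<le> lim_inc k m y" if "k' \<le> m" for m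
    using that y(3) by (simp add: lim_inc_def norm_from_def cell_inc_def)
  have p0: "0 < p" using p by simp
  note * = slice_limit[where h="lim_inc k" and a="\<lambda>m. cell_avg m g" and k=k', OF inc_measurable(1) inc_nonneg(1) inc_cong_cell(1) inc y(1,2) fin p0 \<tau>]
  show "convergent (\<lambda>m. cell_avg m g y)" by (rule *(1))
  show "norm (avg_lim g y - cell_avg k' g y) \<le> 1 / (1 - 2 powr (- (\<tau> / p))) * 2 powr (- (real k' * \<tau> / p)) * v powr (1 / p)"
    unfolding avg_lim_def by (rule *(2))
qed

lemma good_slice_convergent:
  assumes good: "good_slice r k a i x" and y: "y \<in> dcell k a" "y $ i = x $ i"
  shows "(\<lambda>m. cell_avg m g y) \<longlonglongrightarrow> avg_lim g y"
proof -
  obtain q where q: "0 < real_of_rat q" "real_of_rat q < gap"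
    using of_rat_dense[OF gap_pos] by auto
  let ?V = "slice_energy i (real_of_rat q) p (lim_inc k) (dcell k a) x"
  have "?V \<noteq> \<infinity>" using good q by (simp add: good_slice_def)
  then have V: "?V \<le> ennreal (enn2real ?V)" by (simp add: less_top)
  have "convergent (\<lambda>m. cell_avg m g y)"
    by (rule avg_lim_on_slice(1)[OF V _ q(1) y(2) _ order_refl]) (simp_all add: dcell_eq[OF y(1)])
  then show ?thesis unfolding avg_lim_def by (simp add: convergent_LIMSEQ_iff)
qed

text \<open>The estimate of \<open>slice_limit\<close> for \<open>f j - g\<close>: on the slice the difference deviates from its average
  over the whole cell by a quantity that depends only on the slice energy, and the average itself
  tends to zero by weak convergence.\<close>

lemma good_slice_uniform_limit:
  assumes Q: "dcell k a \<subseteq> \<Omega>" and good: "good_slice r k a i x" and r: "strict_mono r"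
  shows "uniform_limit {y \<in> dcell k a. y $ i = x $ i} (\<lambda>j. f (r j)) (avg_lim g) sequentially"
proof (rule uniform_limitI)
  fix e :: real assume e: "0 < e"
  define \<tau> where "\<tau> = gap / 2"
  have \<tau>: "0 < \<tau>" using gap_pos by (simp add: \<tau>_def)
  define V where "V j = slice_energy i \<tau> p (diff_inc k (r j)) (dcell k a) x" for j
  define K where "K = 1 / (1 - 2 powr (- (\<tau> / p))) * 2 powr (- (real k * \<tau> / p))"
  have V0: "V \<longlonglongrightarrow> 0" using good by (simp add: good_slice_def V_def[abs_def] \<tau>_def)
  have "(\<lambda>j. enn2real (V j)) \<longlonglongrightarrow> 0"
    by (rule tendsto_enn2real) (use V0 in auto)
  then have "(\<lambda>j. enn2real (V j) powr (1 / p)) \<longlonglongrightarrow> 0 powr (1 / p)"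
    using p by (intro tendsto_powr2 tendsto_const) auto
  then have "(\<lambda>j. K * enn2real (V j) powr (1 / p)) \<longlonglongrightarrow> K * 0"
    using p by (intro tendsto_mult tendsto_const) simp
  then have ev1: "eventually (\<lambda>j. K * enn2real (V j) powr (1 / p) < e / 2) sequentially"
    using e by (intro order_tendstoD(2)) auto
  have "(\<lambda>j. cell_avg k (f j) a - cell_avg k g a) \<longlonglongrightarrow> cell_avg k g a - cell_avg k g a"
    using Q by (intro tendsto_diff tendsto_const cell_avg_cell_tendsto) auto
  then have "(\<lambda>j. cell_avg k (f (r j)) a - cell_avg k g a) \<longlonglongrightarrow> 0"
    using LIMSEQ_subseq_LIMSEQ[OF _ r] by (fastforce simp: o_def)
  then have "(\<lambda>j. norm (cell_avg k (f (r j)) a - cell_avg k g a)) \<longlonglongrightarrow> 0"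
    by (rule tendsto_norm_zero)
  then have ev2: "eventually (\<lambda>j. norm (cell_avg k (f (r j)) a - cell_avg k g a) < e / 2) sequentially"
    using e by (intro order_tendstoD(2)) auto
  have ev3: "eventually (\<lambda>j. V j < 1) sequentially"
    using V0 by (intro order_tendstoD(2)) auto
  show "eventually (\<lambda>j. \<forall>y\<in>{y \<in> dcell k a. y $ i = x $ i}. dist (f (r j) y) (avg_lim g y) < e) sequentially"
    using ev1 ev2 ev3
  proof eventually_elim
    case (elim j)
    have "V j < top" using elim(3) by (rule less_trans) simp
    then have Vle: "slice_energy i \<tau> p (diff_inc k (r j)) (dcell k a) x \<le> ennreal (enn2real (V j))"
      by (simp add: V_def)
    show ?case
    proof
      fix y assume "y \<in> {y \<in> dcell k a. y $ i = x $ i}"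
      then have y: "y \<in> dcell k a" "y $ i = x $ i" by auto
      have inc: "norm ((cell_avg (Suc m) (f (r j)) y - cell_avg (Suc m) g y) - (cell_avg m (f (r j)) y - cell_avg m g y)) \<le> diff_inc k (r j) m y"
        if "k \<le> m" for m
        using that by (simp add: diff_inc_def norm_from_def cell_inc_def algebra_simps)
      have sub: "dcell k y \<subseteq> dcell k a" by (simp add: dcell_eq[OF y(1)])
      have p0: "0 < p" using p by simp
      have bd: "norm (lim (\<lambda>m. cell_avg m (f (r j)) y - cell_avg m g y) - (cell_avg k (f (r j)) y - cell_avg k g y)) \<le> K * enn2real (V j) powr (1 / p)"
        unfolding K_def
        by (rule slice_limit(2)[where h="diff_inc k (r j)" and a="\<lambda>m y. cell_avg m (f (r j)) y - cell_avg m g y" and k=k,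
              OF inc_measurable(2) inc_nonneg(2) inc_cong_cell(2) inc y(2) sub Vle _ p0 \<tau>]) simp_all
      have "(\<lambda>m. cell_avg m (f (r j)) y) \<longlonglongrightarrow> f (r j) y"
        using Q y(1) by (intro cell_avg_tendsto_continuous[OF open_dom f_Wsp p cont]) auto
      then have "(\<lambda>m. cell_avg m (f (r j)) y - cell_avg m g y) \<longlonglongrightarrow> f (r j) y - avg_lim g y"
        by (intro tendsto_diff good_slice_convergent[OF good y])
      then have "lim (\<lambda>m. cell_avg m (f (r j)) y - cell_avg m g y) = f (r j) y - avg_lim g y"
        by (rule limI)
      moreover have "cell_avg k (f (r j)) y = cell_avg k (f (r j)) a" "cell_avg k g y = cell_avg k g a"
        using y(1) by (auto intro: cell_avg_cong_cell)
      ultimately have "norm ((f (r j) y - avg_lim g y) - (cell_avg k (f (r j)) a - cell_avg k g a)) < e / 2"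
        using bd elim(1) by simp
      then have "norm (f (r j) y - avg_lim g y) < e / 2 + e / 2"
        using elim(2) norm_triangle_sub[of "f (r j) y - avg_lim g y" "cell_avg k (f (r j)) a - cell_avg k g a"] by linarith
      then show "dist (f (r j) y) (avg_lim g y) < e" by (simp add: dist_norm)
    qed
  qed
qed

text \<open>An exponent \<open>\<tau> < gap\<close> with \<open>(n - 1) * (p - q) < \<tau> * q\<close> exists exactly because \<open>n - 1 < s * q\<close>.
  The measure required by \<open>hausdorff_measure_slice_image\<close> is the energy, as a function of the cell.\<close>

lemma good_slice_hausdorff_null:
  assumes good: "good_slice r k a i x" and q: "(real CARD('n) - 1) / s < q" "q < p"
  shows "hausdorff_measure q (avg_lim g ` {y \<in> dcell k a. y $ i = x $ i}) = 0"
proof -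
  let ?n = "real CARD('n) - 1"
  have n: "0 \<le> ?n" by (simp add: Suc_le_eq)
  have q0: "0 < q" using q(1) n s by (meson divide_nonneg_pos le_less_trans)
  have "?n < s * q" using q(1) s by (simp add: field_simps)
  then have "?n * p < s * q * p" using p by (intro mult_strict_right_mono) auto
  then have "?n * (p - q) / q < gap"
    using q0 by (simp add: gap_def field_simps)
  moreover have "0 \<le> ?n * (p - q) / q" using n q q0 by simp
  ultimately obtain t where t: "?n * (p - q) / q < real_of_rat t" "real_of_rat t < gap" "0 < real_of_rat t"
    using of_rat_dense[of "?n * (p - q) / q" gap] by (meson le_less_trans)
  define \<tau> where "\<tau> = real_of_rat t"
  have \<tau>: "0 < \<tau>" "?n * (p - q) < \<tau> * q" using t q0 by (auto simp: \<tau>_def field_simps)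
  define W where "W y = slice_density i \<tau> p (lim_inc k) x y * indicator (dcell k a) y" for y
  define \<nu> where "\<nu> = density lborel W"
  have [measurable]: "W \<in> borel_measurable borel"
    unfolding W_def by (intro borel_measurable_times_ennreal measurable_slice_density(2) inc_measurable) measurable
  have em: "emeasure \<nu> R = slice_energy i \<tau> p (lim_inc k) R x" if "R \<subseteq> dcell k a" "R \<in> sets borel" for R
  proof -
    have "emeasure \<nu> R = (\<integral>\<^sup>+y. W y * indicator R y \<partial>lborel)"
      unfolding \<nu>_def using that by (intro emeasure_density) auto
    also have "\<dots> = slice_energy i \<tau> p (lim_inc k) R x"
      unfolding slice_energy_def W_def using that(1) by (intro nn_integral_cong) (auto split: split_indicator)
    finally show ?thesis .
  qed
  have "emeasure \<nu> (space \<nu>) = emeasure \<nu> (dcell k a)"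
    unfolding \<nu>_def by (simp add: emeasure_density W_def mult.assoc flip: indicator_inter_arith)
  also have "\<dots> \<noteq> \<infinity>"
    using good t by (simp add: em good_slice_def \<tau>_def)
  finally have fin: "finite_measure \<nu>" by (intro finite_measureI) auto
  interpret \<nu>: finite_measure \<nu> by fact
  define K where "K = 1 / (1 - 2 powr (- (\<tau> / p)))"
  have K0: "0 \<le> K" using \<tau> p by (simp add: K_def powr_less_one less_imp_le)
  show ?thesis
  proof (rule hausdorff_measure_slice_image[OF fin, where C="2 * K" and \<tau>=\<tau> and p=p])
    fix k' y z assume k': "k \<le> k'" and y: "y \<in> dcell k a" "y $ i = x $ i" and z: "z \<in> dcell k' y" "z $ i = x $ i"
    let ?R = "dcell k' y"
    have R: "?R \<subseteq> dcell k a" using k' y by (intro dcell_subset)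
    have V: "slice_energy i \<tau> p (lim_inc k) ?R x \<le> ennreal (measure \<nu> ?R)"
      using em[OF R] by (simp add: \<nu>.emeasure_eq_measure)
    have *: "norm (avg_lim g w - cell_avg k' g y) \<le> K * 2 powr (- (real k' * \<tau> / p)) * measure \<nu> ?R powr (1 / p)"
      if "w \<in> ?R" "w $ i = x $ i" for w
    proof -
      have "dcell k' w \<subseteq> ?R" "cell_avg k' g w = cell_avg k' g y"
        using that by (auto simp: dcell_eq cell_avg_cong_cell)
      then show ?thesis
        using avg_lim_on_slice(2)[OF V _ \<tau>(1) that(2) _ k'] by (simp add: K_def)
    qed
    have "dist (avg_lim g y) (avg_lim g z) \<le> norm (avg_lim g y - cell_avg k' g y) + norm (avg_lim g z - cell_avg k' g y)"
      using dist_triangle2[of "avg_lim g y" "avg_lim g z" "cell_avg k' g y"] by (simp add: dist_norm)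
    also have "\<dots> \<le> 2 * (K * 2 powr (- (real k' * \<tau> / p)) * measure \<nu> ?R powr (1 / p))"
      using *[of y] *[OF z] y(2) by simp
    finally show "dist (avg_lim g y) (avg_lim g z) \<le> 2 * K * 2 powr (- (real k' * \<tau> / p)) * measure \<nu> ?R powr (1 / p)"
      by (simp add: mult_ac)
  qed (use \<tau> q q0 K0 in \<open>auto simp: \<nu>_def\<close>)
qed

end

section \<open>Separation by boxes\<close>

text \<open>By invariance of domain the image of the open box and the complement of the image of the closed
  box are open, and \<open>C\<close> would be split by them.\<close>

lemma box_not_crossed:
  fixes F :: "'a :: euclidean_space \<Rightarrow> 'a"
  assumes F: "continuous_on \<Omega> F" "inj_on F \<Omega>" and box: "cbox \<alpha> \<beta> \<subseteq> \<Omega>"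
    and x: "x \<in> box \<alpha> \<beta>" "x' \<in> \<Omega>" "x' \<notin> cbox \<alpha> \<beta>"
    and C: "connected C" "F x \<in> C" "F x' \<in> C"
  shows "\<exists>z \<in> cbox \<alpha> \<beta> - box \<alpha> \<beta>. F z \<in> C"
proof (rule ccontr)
  assume no: "\<not> ?thesis"
  have sub: "box \<alpha> \<beta> \<subseteq> \<Omega>" using box box_subset_cbox by blast
  have U: "open (F ` box \<alpha> \<beta>)"
    using F sub by (intro invariance_of_domain) (auto intro: continuous_on_subset inj_on_subset)
  have "compact (F ` cbox \<alpha> \<beta>)"
    using F(1) box by (intro compact_continuous_image) (auto intro: continuous_on_subset)
  then have V: "open (- F ` cbox \<alpha> \<beta>)" using compact_imp_closed by blast
  have "C \<subseteq> F ` box \<alpha> \<beta> \<union> - F ` cbox \<alpha> \<beta>" using no by auto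
  moreover have "F ` box \<alpha> \<beta> \<inter> - F ` cbox \<alpha> \<beta> \<inter> C = {}" using box_subset_cbox by blast
  moreover have "F ` box \<alpha> \<beta> \<inter> C \<noteq> {}" using x C by blast
  moreover have "- F ` cbox \<alpha> \<beta> \<inter> C \<noteq> {}"
  proof -
    have "F x' \<notin> F ` cbox \<alpha> \<beta>" using F(2) x box by (auto dest: inj_onD)
    then show ?thesis using C by blast
  qed
  ultimately show False using connectedD[OF C(1) U V] by blast
qed

lemma AE_dense_meets_open:
  fixes G :: "(real ^ 'n) set"
  assumes "AE x in lborel. x \<in> Q \<longrightarrow> x \<in> G" "G \<subseteq> closure D" "open A" "A \<noteq> {}" "A \<subseteq> Q"
  shows "\<exists>d\<in>D. d \<in> A"
proof -
  have "AE x in lebesgue. x \<in> Q \<longrightarrow> x \<in> G" using assms(1) by (rule AE_completion)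
  then obtain N where N: "negligible N" "{x. \<not> (x \<in> Q \<longrightarrow> x \<in> G)} \<subseteq> N"
    unfolding eventually_ae_filter_negligible by blast
  have "\<not> A \<subseteq> N" using open_not_negligible[OF assms(3,4)] N(1) negligible_subset by blast
  then obtain z where "z \<in> A" "z \<in> G" using N(2) assms(5) by blast
  then have "A \<inter> closure D \<noteq> {}" using assms(2) by blast
  then show ?thesis using open_Int_closure_eq_empty[OF assms(3), of D] by blast
qed

text \<open>A point without dyadic coordinates is interior to its cell. The part of the cell on either side of
  the hyperplane through \<open>x\<close> therefore contains an open box, which meets the dense set.\<close>

lemma dense_face:
  fixes x :: "real ^ 'n"
  assumes AE: "AE z in lborel. z \<in> dcell k x \<longrightarrow> z \<in> G" and D: "G \<subseteq> closure D" "D \<subseteq> dcell k x"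
    and x: "\<And>i. 2 ^ k * x $ i \<notin> \<int>"
  shows "\<exists>d\<in>D. d $ i < x $ i" "\<exists>d\<in>D. x $ i < d $ i"
proof -
  define lo hi :: "real ^ 'n" where "lo = (\<chi> i. \<lfloor>2 ^ k * x $ i\<rfloor> / 2 ^ k)"
    and "hi = (\<chi> i. (\<lfloor>2 ^ k * x $ i\<rfloor> + 1) / 2 ^ k)"
  have lt: "lo $ j < x $ j" "x $ j < hi $ j" for j
  proof -
    have "\<lfloor>2 ^ k * x $ j\<rfloor> \<noteq> 2 ^ k * x $ j" using x[of j] by (metis Ints_of_int)
    then have "\<lfloor>2 ^ k * x $ j\<rfloor> < 2 ^ k * x $ j" by (simp add: less_le)
    moreover have "2 ^ k * x $ j < \<lfloor>2 ^ k * x $ j\<rfloor> + 1" by linarith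
    ultimately show "lo $ j < x $ j" "x $ j < hi $ j"
      by (simp_all add: lo_def hi_def divide_less_eq less_divide_eq mult.commute)
  qed
  have in_cell: "z \<in> dcell k x" if "\<And>j. lo $ j < z $ j" "\<And>j. z $ j < hi $ j" for z
    using that by (auto simp: dcell_bounds lo_def hi_def intro: less_imp_le)
  define A where "A = box lo (\<chi> j. if j = i then x $ i else hi $ j)"
  define B where "B = box (\<chi> j. if j = i then x $ i else lo $ j) hi"
  have "(\<chi> j. (lo $ j + (if j = i then x $ i else hi $ j)) / 2) \<in> A"
    using lt lt[THEN less_trans] by (auto simp: A_def mem_box_cart)
  moreover have "A \<subseteq> dcell k x"
  proof
    fix z assume "z \<in> A"
    then have z: "lo $ j < z $ j" "z $ j < (if j = i then x $ i else hi $ j)" for j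
      by (simp_all add: A_def mem_box_cart)
    have "z $ j < hi $ j" for j using z(2)[of j] lt(2)[of j] by (cases "j = i") auto
    with z(1) show "z \<in> dcell k x" by (rule in_cell)
  qed
  ultimately obtain d where "d \<in> D" "d \<in> A"
    using AE_dense_meets_open[OF AE D(1), of A] by (auto simp: A_def)
  then have "d $ j < (if j = i then x $ i else hi $ j)" for j by (simp add: A_def mem_box_cart)
  from this[of i] show "\<exists>d\<in>D. d $ i < x $ i" using \<open>d \<in> D\<close> by auto
  have "(\<chi> j. ((if j = i then x $ i else lo $ j) + hi $ j) / 2) \<in> B"
    using lt lt[THEN less_trans] by (auto simp: B_def mem_box_cart)
  moreover have "B \<subseteq> dcell k x"
  proof
    fix z assume "z \<in> B"
    then have z: "(if j = i then x $ i else lo $ j) < z $ j" "z $ j < hi $ j" for j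
      by (simp_all add: B_def mem_box_cart)
    have "lo $ j < z $ j" for j using z(1)[of j] lt(1)[of j] by (cases "j = i") auto
    then show "z \<in> dcell k x" using z(2) by (rule in_cell)
  qed
  ultimately obtain d' where "d' \<in> D" "d' \<in> B"
    using AE_dense_meets_open[OF AE D(1), of B] by (auto simp: B_def)
  then have "(if j = i then x $ i else lo $ j) < d' $ j" for j by (simp add: B_def mem_box_cart)
  from this[of i] show "\<exists>d\<in>D. x $ i < d $ i" using \<open>d' \<in> D\<close> by auto
qed

lemma uniform_limit_avoids:
  fixes F :: "nat \<Rightarrow> 'a :: topological_space \<Rightarrow> 'b :: heine_borel"
  assumes K: "compact K" and c: "\<And>j. continuous_on K (F j)"
    and u: "uniform_limit K F G sequentially" and y: "y \<notin> G ` K"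
  shows "\<exists>e>0. eventually (\<lambda>j. \<forall>z\<in>K. F j z \<notin> ball y e) sequentially"
proof -
  have "continuous_on K G"
    using c u by (intro uniform_limit_theorem[of _ F]) auto
  then have "closed (G ` K)" using K by (intro compact_imp_closed compact_continuous_image)
  then obtain d where d: "d > 0" "\<And>w. w \<in> G ` K \<Longrightarrow> d \<le> dist y w"
    using separate_point_closed[OF _ y] by blast
  have "eventually (\<lambda>j. \<forall>z\<in>K. dist (F j z) (G z) < d / 2) sequentially"
    using u d(1) by (intro uniform_limitD) auto
  then have "eventually (\<lambda>j. \<forall>z\<in>K. F j z \<notin> ball y (d / 2)) sequentially"
  proof eventually_elim
    case (elim j)
    show ?case
    proof
      fix z assume z: "z \<in> K"
      have "d \<le> dist y (F j z) + dist (F j z) (G z)"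
        using d(2)[of "G z"] z dist_triangle[of y "G z" "F j z"] by auto
      then show "F j z \<notin> ball y (d / 2)" using elim z by fastforce
    qed
  qed
  then show ?thesis using d(1) by (intro exI[of _ "d / 2"]) auto
qed

text \<open>The points of \<open>D\<close> supply the faces of a box inside the cell that contains \<open>x\<close> but not \<open>x'\<close>. The
  limit map is continuous on the faces, so its image of the boundary is compact and a ball around
  \<open>y\<close> is missed by \<open>F j\<close> on the boundary for large \<open>j\<close>, in contradiction to \<open>box_not_crossed\<close>.\<close>

lemma values_separated:
  fixes F :: "nat \<Rightarrow> real ^ 'n \<Rightarrow> real ^ 'n"
  assumes Q: "dcell k x \<subseteq> \<Omega>"
    and F: "\<And>j. continuous_on \<Omega> (F j)" "\<And>j. inj_on (F j) \<Omega>"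
    and lim: "\<And>i d. d \<in> D \<Longrightarrow> uniform_limit {z \<in> dcell k x. z $ i = d $ i} F H sequentially"
    and AE: "AE z in lborel. z \<in> dcell k x \<longrightarrow> z \<in> G" and D: "G \<subseteq> closure D" "D \<subseteq> dcell k x"
    and x: "\<And>i. 2 ^ k * x $ i \<notin> \<int>" and x': "x' \<in> \<Omega>" "x' \<notin> dcell k x"
    and conv: "(\<lambda>j. F j x) \<longlonglongrightarrow> y" "(\<lambda>j. F j x') \<longlonglongrightarrow> y"
    and y: "\<And>i d. d \<in> D \<Longrightarrow> y \<notin> H ` {z \<in> dcell k x. z $ i = d $ i}"
  shows False
proof -
  obtain dl du where dl: "\<And>i. dl i \<in> D" "\<And>i. dl i $ i < x $ i" and du: "\<And>i. du i \<in> D" "\<And>i. x $ i < du i $ i"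
    using dense_face[OF AE D x] by metis
  define \<alpha> \<beta> :: "real ^ 'n" where "\<alpha> = (\<chi> i. dl i $ i)" and "\<beta> = (\<chi> i. du i $ i)"
  have sub: "cbox \<alpha> \<beta> \<subseteq> dcell k x"
  proof
    fix z assume z: "z \<in> cbox \<alpha> \<beta>"
    have "\<lfloor>2 ^ k * x $ i\<rfloor> / 2 ^ k \<le> z $ i \<and> z $ i < (\<lfloor>2 ^ k * x $ i\<rfloor> + 1) / 2 ^ k" for i
    proof -
      have "dl i \<in> dcell k x" "du i \<in> dcell k x" using dl du D by auto
      then have "\<lfloor>2 ^ k * x $ i\<rfloor> / 2 ^ k \<le> dl i $ i" "du i $ i < (\<lfloor>2 ^ k * x $ i\<rfloor> + 1) / 2 ^ k"
        by (auto simp: dcell_bounds)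
      moreover have "dl i $ i \<le> z $ i" "z $ i \<le> du i $ i" using z by (auto simp: mem_box_cart \<alpha>_def \<beta>_def)
      ultimately show ?thesis by linarith
    qed
    then show "z \<in> dcell k x" by (simp add: dcell_bounds)
  qed
  define K where "K = cbox \<alpha> \<beta> - box \<alpha> \<beta>"
  define sl where "sl i d = {z \<in> dcell k x. z $ i = d $ i}" for i and d :: "real ^ 'n"
  have K_sub: "K \<subseteq> (\<Union>i\<in>UNIV. sl i (dl i) \<union> sl i (du i))"
  proof
    fix z assume z: "z \<in> K"
    then have "z \<in> dcell k x" using sub by (auto simp: K_def)
    moreover obtain i where "z $ i = \<alpha> $ i \<or> z $ i = \<beta> $ i"
      using z unfolding K_def mem_box_cart Diff_iff by (metis order_le_less)
    ultimately show "z \<in> (\<Union>i\<in>UNIV. sl i (dl i) \<union> sl i (du i))"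
      by (auto simp: sl_def \<alpha>_def \<beta>_def)
  qed
  have "uniform_limit (\<Union>i\<in>UNIV. sl i (dl i) \<union> sl i (du i)) F H sequentially"
    using dl(1) du(1) lim unfolding sl_def
    by (intro uniform_limit_on_UNION uniform_limit_on_Un) auto
  then have u: "uniform_limit K F H sequentially" using K_sub by (rule uniform_limit_on_subset)
  have "compact K" unfolding K_def by (intro compact_diff compact_cbox open_box)
  moreover have "continuous_on K (F j)" for j
    by (rule continuous_on_subset[OF F(1)]) (use sub Q in \<open>auto simp: K_def\<close>)
  moreover have "y \<notin> H ` K"
  proof
    assume "y \<in> H ` K"
    then obtain z where z: "z \<in> K" "y = H z" by blast
    then obtain i where "z \<in> sl i (dl i) \<or> z \<in> sl i (du i)" using K_sub by blast
    then show False using y[OF dl(1)] y[OF du(1)] z(2) unfolding sl_def by blast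
  qed
  ultimately obtain e where e: "e > 0" "eventually (\<lambda>j. \<forall>z\<in>K. F j z \<notin> ball y e) sequentially"
    using uniform_limit_avoids[OF _ _ u] by blast
  have "eventually (\<lambda>j. F j x \<in> ball y e) sequentially" "eventually (\<lambda>j. F j x' \<in> ball y e) sequentially"
    using conv e(1) by (auto simp: tendsto_iff dist_commute)
  with e(2) have "eventually (\<lambda>j. False) sequentially"
  proof eventually_elim
    case (elim j)
    have "\<exists>z \<in> cbox \<alpha> \<beta> - box \<alpha> \<beta>. F j z \<in> ball y e"
    proof (rule box_not_crossed[OF F])
      show "cbox \<alpha> \<beta> \<subseteq> \<Omega>" using sub Q by blast
      show "x \<in> box \<alpha> \<beta>" using dl du by (simp add: mem_box_cart \<alpha>_def \<beta>_def)
      show "x' \<notin> cbox \<alpha> \<beta>" using x' sub by blast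
    qed (use x' elim connected_ball in auto)
    then show False using elim(1) by (auto simp: K_def)
  qed
  then show False by simp
qed

lemma AE_not_dyadic: "AE x in lebesgue. \<forall>k i. 2 ^ k * (x :: real ^ 'n) $ i \<notin> \<int>"
proof -
  have "AE x in lebesgue. 2 ^ k * (x :: real ^ 'n) $ i \<noteq> real_of_int z" for k i z
  proof -
    have "negligible {x :: real ^ 'n. axis i 1 \<bullet> x = real_of_int z / 2 ^ k}"
      by (intro negligible_hyperplane) (simp add: axis_eq_0_iff)
    moreover have "{x :: real ^ 'n. \<not> 2 ^ k * x $ i \<noteq> real_of_int z} \<subseteq> {x. axis i 1 \<bullet> x = real_of_int z / 2 ^ k}"
      by (auto simp: inner_axis' field_simps)
    ultimately show ?thesis unfolding eventually_ae_filter_negligible by blast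
  qed
  then have "AE x in lebesgue. \<forall>k i z. 2 ^ k * (x :: real ^ 'n) $ i \<noteq> real_of_int z"
    unfolding AE_all_countable by blast
  then show ?thesis by eventually_elim (auto elim: Ints_cases)
qed

section \<open>Injectivity outside a small set\<close>

theorem theorem1p1:
  fixes \<Omega> :: "(real ^ 'n) set"
    and s p :: real
    and f :: "nat \<Rightarrow> real ^ 'n \<Rightarrow> real ^ 'n"
    and g :: "real ^ 'n \<Rightarrow> real ^ 'n"
  assumes "CARD('n) \<ge> 2"
    and "open \<Omega>"
    and "0 < s" "s < 1"
    and "1 < p"
    and "s * p > real CARD('n) - 1"
    and "\<And>j. f j \<in> Wsp s p \<Omega>"
    and "\<And>j. \<exists>h. homeomorphism \<Omega> (f j ` \<Omega>) (f j) h"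
    and "Wsp_weakly_converges s p \<Omega> f g"
  shows "\<exists>(g_hat :: real ^ 'n \<Rightarrow> real ^ 'n) (\<Gamma> :: (real ^ 'n) set).
           (AE x in lebesgue_on \<Omega>. g_hat x = g x) \<and>
           hausdorff_dim \<Gamma> \<le> ennreal ((real CARD('n) - 1) / s) \<and>
           (\<forall>y \<in> g_hat ` \<Omega> - \<Gamma>. \<exists>!x. x \<in> \<Omega> \<and> g_hat x = y)"
proof -
  have cont: "continuous_on \<Omega> (f j)" and inj: "inj_on (f j) \<Omega>" for j
  proof -
    obtain h where "homeomorphism \<Omega> (f j ` \<Omega>) (f j) h" using assms(8) by blast
    then show "continuous_on \<Omega> (f j)" "inj_on (f j) \<Omega>"
      by (auto simp: homeomorphism_def inj_on_def) (metis)
  qed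
  interpret weak_limit \<Omega> s p f g
    using assms cont by unfold_locales auto
  obtain r where r: "strict_mono r" "\<And>k a. dcell k a \<subseteq> \<Omega> \<Longrightarrow>
     AE x in lborel. x \<in> dcell k a \<longrightarrow> (\<forall>i. good_slice r k a i x)"
    using good_slice_subsequence by blast
  define pt :: "nat \<times> (int ^ 'n) \<Rightarrow> real ^ 'n" where "pt c = cell_point (fst c) (snd c)" for c
  define Q where "Q c = dcell (fst c) (pt c)" for c
  define I where "I = {c. Q c \<subseteq> \<Omega>}"
  define G where "G c = {x \<in> Q c. \<forall>i. good_slice r (fst c) (pt c) i x}" for c
  have "\<forall>c. \<exists>D. countable D \<and> D \<subseteq> G c \<and> G c \<subseteq> closure D"
    using separable by metis
  then obtain D where D: "\<And>c. countable (D c)" "\<And>c. D c \<subseteq> G c" "\<And>c. G c \<subseteq> closure (D c)"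
    by metis
  define slice where "slice c i d = {y \<in> Q c. y $ i = d $ i}" for c i and d :: "real ^ 'n"
  define \<A> where "\<A> = insert {0} ((\<lambda>(c, d, i). avg_lim g ` slice c i d) ` (SIGMA c:I. D c \<times> UNIV))"
  define \<Gamma> where "\<Gamma> = \<Union>\<A>"
  \<comment> \<open>Points interior to all their cells, whose slices are all good and at which the averages of \<open>g\<close>
    tend to \<open>g\<close>.\<close>
  define P where "P x \<longleftrightarrow> (\<forall>k i. 2 ^ k * x $ i \<notin> \<int>) \<and>
      (\<forall>c. c \<in> I \<longrightarrow> x \<in> Q c \<longrightarrow> (\<forall>i. good_slice r (fst c) (pt c) i x) \<and> (\<lambda>m. cell_avg m g x) \<longlonglongrightarrow> g x)"
    for x
  define g_hat where "g_hat x = (if P x then g x else 0)" for x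
  have "AE x in lebesgue. P x"
  proof -
    have "AE x in lebesgue. c \<in> I \<longrightarrow> x \<in> Q c \<longrightarrow> (\<forall>i. good_slice r (fst c) (pt c) i x) \<and> (\<lambda>m. cell_avg m g x) \<longlonglongrightarrow> g x" for c
    proof (cases "c \<in> I")
      case True
      then have sub: "dcell (fst c) (pt c) \<subseteq> \<Omega>" by (simp add: I_def Q_def)
      from AE_completion[OF r(2)[OF sub]] Wsp_cell_avg_tendsto_AE[OF open_dom g_Wsp p s sub]
      show ?thesis by eventually_elim (auto simp: Q_def)
    qed simp
    then have "AE x in lebesgue. \<forall>c. c \<in> I \<longrightarrow> x \<in> Q c \<longrightarrow> (\<forall>i. good_slice r (fst c) (pt c) i x) \<and> (\<lambda>m. cell_avg m g x) \<longlonglongrightarrow> g x"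
      unfolding AE_all_countable by blast
    with AE_not_dyadic show ?thesis by eventually_elim (auto simp: P_def)
  qed
  then have AE_g: "AE x in lebesgue_on \<Omega>. g_hat x = g x"
    using open_dom by (subst AE_restrict_space_iff) (auto simp: g_hat_def elim: AE_mp)
  have dim: "hausdorff_dim \<Gamma> \<le> ennreal ((real CARD('n) - 1) / s)"
  proof (rule hausdorff_dim_le[where p=p])
    show "0 \<le> (real CARD('n) - 1) / s" using s assms(1) by simp
    show "(real CARD('n) - 1) / s < p" using s sp by (simp add: field_simps)
    fix q assume q: "(real CARD('n) - 1) / s < q" "q < p"
    have "0 < q" using q(1) \<open>0 \<le> (real CARD('n) - 1) / s\<close> by linarith
    show "hausdorff_measure q \<Gamma> = 0"
      unfolding \<Gamma>_def
    proof (rule hausdorff_measure_countable_Union)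
      show "countable \<A>" unfolding \<A>_def using D(1) by (intro countable_insert countable_image countable_SIGMA) auto
      show "hausdorff_measure q A = 0" if "A \<in> \<A>" for A
      proof (cases "A = {0}")
        case True
        then show ?thesis using hausdorff_measure_singleton[OF \<open>0 < q\<close>] by simp
      next
        case False
        then have "A \<in> (\<lambda>(c, d, i). avg_lim g ` slice c i d) ` (SIGMA c:I. D c \<times> UNIV)"
          using that by (simp add: \<A>_def)
        then obtain t where t: "t \<in> (SIGMA c:I. D c \<times> UNIV)" "A = (\<lambda>(c, d, i). avg_lim g ` slice c i d) t"
          by (rule imageE)
        obtain c d i where "t = (c, d, i)" by (rule prod_cases3)
        with t have A: "c \<in> I" "d \<in> D c" "A = avg_lim g ` slice c i d" by simp_all
        have "d \<in> G c" using A(2) D(2)[of c] by blast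
        then have "good_slice r (fst c) (pt c) i d" unfolding G_def by blast
        from good_slice_hausdorff_null[OF this q] show ?thesis by (simp add: A(3) slice_def Q_def)
      qed
    qed (simp add: \<A>_def)
  qed
  have conv: "(\<lambda>j. f (r j) x) \<longlonglongrightarrow> g x" if x: "x \<in> \<Omega>" "P x" for x
  proof -
    obtain k where k: "dcell k x \<subseteq> \<Omega>" using dcell_subset_open[OF open_dom x(1)] by blast
    define c where "c = (k, cell_index k x)"
    have Qc: "Q c = dcell k x" by (simp add: Q_def pt_def c_def dcell_cell_point)
    then have "c \<in> I" "x \<in> Q c" using k by (auto simp: I_def)
    then have gx: "\<And>i. good_slice r (fst c) (pt c) i x" "(\<lambda>m. cell_avg m g x) \<longlonglongrightarrow> g x"
      using x(2) unfolding P_def by blast+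
    have "avg_lim g x = g x" unfolding avg_lim_def by (rule limI[OF gx(2)])
    moreover have "uniform_limit {y \<in> dcell (fst c) (pt c). y $ i = x $ i} (\<lambda>j. f (r j)) (avg_lim g) sequentially" for i
      using \<open>c \<in> I\<close> by (intro good_slice_uniform_limit gx r) (simp add: I_def Q_def)
    then have "(\<lambda>j. f (r j) x) \<longlonglongrightarrow> avg_lim g x"
      by (rule tendsto_uniform_limitI) (use \<open>x \<in> Q c\<close> in \<open>simp add: Q_def\<close>)
    ultimately show ?thesis by simp
  qed
  have unique: "x = x'" if x: "x \<in> \<Omega>" "P x" and x': "x' \<in> \<Omega>" "P x'" and eq: "g x = g x'" and y: "g x \<notin> \<Gamma>" for x x'
  proof (rule ccontr)
    assume ne: "x \<noteq> x'"
    \<comment> \<open>A cell around \<open>x\<close> that is contained in the domain and too small to contain \<open>x'\<close>.\<close>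
    obtain k1 where k1: "\<And>k. k \<ge> k1 \<Longrightarrow> dcell k x \<subseteq> \<Omega>" using dcell_subset_open[OF open_dom x(1)] by blast
    obtain k2 where k2: "\<And>k. k \<ge> k2 \<Longrightarrow> dcell k x \<subseteq> ball x (dist x x')" using dcell_subset_ball[of "dist x x'" x] ne by auto
    define k where "k = max k1 k2"
    have sub: "dcell k x \<subseteq> \<Omega>" and x'_out: "x' \<notin> dcell k x" using k1[of k] k2[of k] by (auto simp: k_def)
    define c where "c = (k, cell_index k x)"
    have Qc: "Q c = dcell k x" by (simp add: Q_def pt_def c_def dcell_cell_point)
    have cell: "dcell k (pt c) = dcell k x" using Qc by (simp add: Q_def c_def)
    have cI: "c \<in> I" using Qc sub by (auto simp: I_def)
    show False
    proof (rule values_separated[OF sub, where F="\<lambda>j. f (r j)" and D="D c" and G="G c" and H="avg_lim g" and x'=x' and y="g x"])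
      fix i d assume d: "d \<in> D c"
      then have "good_slice r k (pt c) i d" using D(2)[of c] by (auto simp: G_def c_def)
      then show "uniform_limit {z \<in> dcell k x. z $ i = d $ i} (\<lambda>j. f (r j)) (avg_lim g) sequentially"
        using good_slice_uniform_limit[of k "pt c" r i d] r(1) sub by (simp add: cell)
      have "avg_lim g ` slice c i d \<in> \<A>"
        unfolding \<A>_def by (rule insertI2, rule image_eqI[where x="(c, d, i)"]) (use cI d in simp_all)
      then have "g x \<notin> avg_lim g ` slice c i d"
        using y unfolding \<Gamma>_def by blast
      then show "g x \<notin> avg_lim g ` {z \<in> dcell k x. z $ i = d $ i}"
        by (simp only: slice_def Qc not_False_eq_True)
    next
      show "AE z in lborel. z \<in> dcell k x \<longrightarrow> z \<in> G c"
      proof -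
        have "fst c = k" by (simp add: c_def)
        then have Gc: "G c = {z \<in> dcell k x. \<forall>i. good_slice r k (pt c) i z}"
          by (simp only: G_def Qc)
        from r(2)[of k "pt c", unfolded cell, OF sub] show ?thesis
          by eventually_elim (simp add: Gc)
      qed
      show "D c \<subseteq> dcell k x" using D(2)[of c] by (auto simp: G_def Qc)
      show "\<And>i. 2 ^ k * x $ i \<notin> \<int>" using x(2) by (simp add: P_def)
      show "(\<lambda>j. f (r j) x) \<longlonglongrightarrow> g x" by (rule conv[OF x])
      show "(\<lambda>j. f (r j) x') \<longlonglongrightarrow> g x" unfolding eq by (rule conv[OF x'])
    qed (use cont inj D(3) x'(1) x'_out in auto)
  qed
  have "\<exists>!x. x \<in> \<Omega> \<and> g_hat x = y" if y: "y \<in> g_hat ` \<Omega> - \<Gamma>" for y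
  proof -
    have "0 \<in> \<Gamma>" by (simp add: \<Gamma>_def \<A>_def)
    then have y0: "y \<noteq> 0" using y by auto
    then have P: "P x \<and> g x = y" if "g_hat x = y" for x using that by (auto simp: g_hat_def split: if_splits)
    obtain x where x: "x \<in> \<Omega>" "g_hat x = y" using y by auto
    show ?thesis
    proof (rule ex1I[of _ x])
      show "x \<in> \<Omega> \<and> g_hat x = y" using x by simp
      fix x' assume "x' \<in> \<Omega> \<and> g_hat x' = y"
      then show "x' = x" using unique[of x' x] P x y by auto
    qed
  qed
  with AE_g dim show ?thesis by blast
qed

end
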